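(* If $n>2$ and $k\ge 0$, then $H_1(A_{n,k})\cong\mathbb Z/2\cong H_1(A_n^k)$ (group homology with integer coefficients).
   Context: $F_{n+k}$ is the free group on $x_1,\dots,x_n,y_1,\dots,y_k$. $A_n^k=\{\phi\in\mathrm{Aut}(F_{n+k}) : \phi(y_i)\text{ is conjugate to }y_i\text{ for }1\le i\le k\}$. $G_{n,k}$ is the graph with basepoint $*$ consisting of $n$ loops at $*$ together with, for each $j=1,\dots,k$, an edge (stem) from $*$ to another vertex with a circle $C_j$ attached at that vertex. $A_{n,k}$ is the group of path components of the space of basepointed self homotopy equivalences of $G_{n,k}$ that fix each circle $C_j$ pointwise. Algebraically, for $\langle\nu,w\rangle=(\nu_1,\dots,\nu_n,w_1,\dots,w_k)\in(F_{n+k})^{n+k}$ let $\alpha\langle\nu,w\rangle$ be the endomorphism $x_i\mapsto\nu_i$, $y_j\mapsto w_j^{-1}y_jw_j$; then $A_{n,k}\cong\{\langle\nu,w\rangle:\alpha\langle\nu,w\rangle\in\mathrm{Aut}(F_{n+k})\}$ with multiplication $\langle\nu,w\rangle\cdot\langle\nu',w'\rangle=\langle\alpha\langle\nu',w'\rangle[\nu],\,w'\cdot\alpha\langle\nu',w'\rangle[w]\rangle$ (componentwise). *)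

theory Defs
  imports "HOL-Algebra.Algebra"
begin

section \<open>Group homology with integer coefficients\<close>

text \<open>Homology of the inhomogeneous bar complex \<open>C\<^sub>p = \<int>[G\<^sup>p]\<close>
  (trivial coefficients), where \<open>[g\<^sub>1|\<dots>|g\<^sub>p]\<close> is represented by a list of length \<open>p\<close> and
  \<open>d[g\<^sub>1|\<dots>|g\<^sub>p] = [g\<^sub>2|\<dots>|g\<^sub>p] + (\<Sum>0<i<p. (-1)^i [g\<^sub>1|\<dots>|g\<^sub>i g\<^sub>i\<^sub>+\<^sub>1|\<dots>|g\<^sub>p]) + (-1)^p [g\<^sub>1|\<dots>|g\<^sub>p\<^sub>-\<^sub>1]\<close>.\<close>

definition bar_chain_group :: "('a, 'm) monoid_scheme \<Rightarrow> nat \<Rightarrow> ('a list \<Rightarrow>\<^sub>0 int) monoid" where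
  "bar_chain_group G p = free_Abelian_group {gs. length gs = p \<and> set gs \<subseteq> carrier G}"

definition bar_face :: "('a, 'm) monoid_scheme \<Rightarrow> nat \<Rightarrow> 'a list \<Rightarrow> 'a list" where
  "bar_face G i gs =
    (if i = 0 then tl gs
     else if i = length gs then butlast gs
     else take (i - 1) gs @ (gs ! (i - 1) \<otimes>\<^bsub>G\<^esub> gs ! i) # drop (i + 1) gs)"

text \<open>The differential out of degree \<open>p\<close>; it is zero in degree \<open>0\<close>.\<close>

definition bar_boundary ::
    "('a, 'm) monoid_scheme \<Rightarrow> nat \<Rightarrow> ('a list \<Rightarrow>\<^sub>0 int) \<Rightarrow> ('a list \<Rightarrow>\<^sub>0 int)" where
  "bar_boundary G p c =
    (if p = 0 then 0
     else frag_extend (\<lambda>gs. \<Sum>i\<le>p. frag_cmul ((-1) ^ i) (frag_of (bar_face G i gs))) c)"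

definition bar_cycles :: "('a, 'm) monoid_scheme \<Rightarrow> nat \<Rightarrow> ('a list \<Rightarrow>\<^sub>0 int) set" where
  "bar_cycles G p = kernel (bar_chain_group G p) (bar_chain_group G (p - 1)) (bar_boundary G p)"

definition bar_boundaries :: "('a, 'm) monoid_scheme \<Rightarrow> nat \<Rightarrow> ('a list \<Rightarrow>\<^sub>0 int) set" where
  "bar_boundaries G p = bar_boundary G (p + 1) ` carrier (bar_chain_group G (p + 1))"

definition group_homology ::
    "nat \<Rightarrow> ('a, 'm) monoid_scheme \<Rightarrow> ('a list \<Rightarrow>\<^sub>0 int) set monoid" where
  "group_homology p G = (bar_chain_group G p \<lparr>carrier := bar_cycles G p\<rparr>) Mod bar_boundaries G p"


section \<open>Free groups\<close>

text \<open>A letter \<open>(a, True)\<close> stands for the generator \<open>a\<close>, and \<open>(a, False)\<close> for its inverse.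
  Elements of the free group are the reduced words.\<close>

type_synonym 'a word = "('a \<times> bool) list"

fun reduced :: "'a word \<Rightarrow> bool" where
  "reduced (l # m # w) \<longleftrightarrow> \<not> (fst l = fst m \<and> snd l \<noteq> snd m) \<and> reduced (m # w)"
| "reduced _ \<longleftrightarrow> True"

text \<open>Left multiplication of a reduced word by a letter, cancelling if possible.\<close>

fun push :: "'a \<times> bool \<Rightarrow> 'a word \<Rightarrow> 'a word" where
  "push l [] = [l]"
| "push l (m # w) = (if fst l = fst m \<and> snd l \<noteq> snd m then w else l # m # w)"

definition free_group :: "'a set \<Rightarrow> 'a word monoid" where
  "free_group S =
    \<lparr>carrier = {w. reduced w \<and> fst ` set w \<subseteq> S}, monoid.mult = (\<lambda>u v. foldr push u v), one = []\<rparr>"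

definition gen :: "'a \<Rightarrow> 'a word" where
  "gen a = [(a, True)]"

text \<open>The homomorphism from a free group to \<open>H\<close> sending each generator \<open>a\<close> to \<open>f a\<close>.\<close>

definition free_lift :: "('b, 'm) monoid_scheme \<Rightarrow> ('a \<Rightarrow> 'b) \<Rightarrow> 'a word \<Rightarrow> 'b" where
  "free_lift H f w =
    foldr (\<lambda>(a, b) h. (if b then f a else inv\<^bsub>H\<^esub> (f a)) \<otimes>\<^bsub>H\<^esub> h) w \<one>\<^bsub>H\<^esub>"


section \<open>The groups $A_n^k$ and $A_{n,k}$\<close>

datatype basis = GenX nat | GenY nat

definition Fnk :: "nat \<Rightarrow> nat \<Rightarrow> basis word monoid" where
  "Fnk n k = free_group (GenX ` {1..n} \<union> GenY ` {1..k})"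

abbreviation xgen :: "nat \<Rightarrow> basis word" where "xgen i \<equiv> gen (GenX i)"
abbreviation ygen :: "nat \<Rightarrow> basis word" where "ygen j \<equiv> gen (GenY j)"

text \<open>$A_n^k$, as a subgroup of \<open>Aut(F\<^sub>n\<^sub>+\<^sub>k)\<close> under composition.\<close>

definition A_sym :: "nat \<Rightarrow> nat \<Rightarrow> (basis word \<Rightarrow> basis word) monoid" where
  "A_sym n k = AutoGroup (Fnk n k)
    \<lparr>carrier := {\<phi> \<in> auto (Fnk n k). \<forall>j\<in>{1..k}. \<exists>g\<in>carrier (Fnk n k).
        \<phi> (ygen j) = inv\<^bsub>Fnk n k\<^esub> g \<otimes>\<^bsub>Fnk n k\<^esub> ygen j \<otimes>\<^bsub>Fnk n k\<^esub> g}\<rparr>"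

text \<open>The endomorphism \<open>\<alpha>\<langle>\<nu>, w\<rangle>\<close> given by \<open>x\<^sub>i \<mapsto> \<nu>\<^sub>i\<close> and \<open>y\<^sub>j \<mapsto> w\<^sub>j\<^sup>-\<^sup>1 y\<^sub>j w\<^sub>j\<close>,
  as an extensional function on the carrier.\<close>

definition alpha :: "nat \<Rightarrow> nat \<Rightarrow> (nat \<Rightarrow> basis word) \<times> (nat \<Rightarrow> basis word) \<Rightarrow>
    basis word \<Rightarrow> basis word" where
  "alpha n k = (\<lambda>(\<nu>, w). restrict
    (free_lift (Fnk n k) (\<lambda>b. case b of
        GenX i \<Rightarrow> \<nu> i
      | GenY j \<Rightarrow> inv\<^bsub>Fnk n k\<^esub> (w j) \<otimes>\<^bsub>Fnk n k\<^esub> ygen j \<otimes>\<^bsub>Fnk n k\<^esub> w j))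
    (carrier (Fnk n k)))"

text \<open>$A_{n,k}$ in its algebraic description: it stands for the group of path components of the
  space of based self homotopy equivalences of the graph $G_{n,k}$ fixing every circle \<open>C\<^sub>j\<close>
  pointwise. The word \<open>w\<^sub>j\<close> records the image of the stem to \<open>C\<^sub>j\<close>, so \<open>\<langle>\<nu>, w\<rangle>\<close> carries more
  information than \<open>\<alpha>\<langle>\<nu>, w\<rangle>\<close>.
  The map \<open>\<alpha>\<close> reverses products: \<open>\<alpha>(a \<cdot> b) = \<alpha>(b) \<circ> \<alpha>(a)\<close>.\<close>

definition A_bd :: "nat \<Rightarrow> nat \<Rightarrow> ((nat \<Rightarrow> basis word) \<times> (nat \<Rightarrow> basis word)) monoid" where
  "A_bd n k =
    \<lparr>carrier = {a \<in> ({1..n} \<rightarrow>\<^sub>E carrier (Fnk n k)) \<times> ({1..k} \<rightarrow>\<^sub>E carrier (Fnk n k)).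
        alpha n k a \<in> auto (Fnk n k)},
     monoid.mult = (\<lambda>(\<nu>, w) (\<nu>', w').
       (\<lambda>i\<in>{1..n}. alpha n k (\<nu>', w') (\<nu> i),
        \<lambda>j\<in>{1..k}. w' j \<otimes>\<^bsub>Fnk n k\<^esub> alpha n k (\<nu>', w') (w j))),
     one = (\<lambda>i\<in>{1..n}. xgen i, \<lambda>j\<in>{1..k}. \<one>\<^bsub>Fnk n k\<^esub>)\<rparr>"

end

theory Submission
  imports Defs "Jordan_Normal_Form.Determinant"
begin

text \<open>Let \<open>f\<close> be a homomorphism from \<open>A_bd n k\<close> to an abelian group. Left multiplication by the
  transvections \<open>x\<^sub>i \<mapsto> x\<^sub>i g\<close>, \<open>x\<^sub>i \<mapsto> g x\<^sub>i\<close> and the partial conjugations \<open>w\<^sub>j \<mapsto> g\<close>, where \<open>g\<close> is a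
  letter, does not change the value of \<open>f\<close>: since \<open>n \<ge> 3\<close>, these moves are commutators, except
  for the twist \<open>w\<^sub>j = y\<^sub>j\<^sup>\<plusminus>\<^sup>1\<close>, which is a product of conjugates of transvections. Applied to a tuple
  \<open>\<langle>\<nu>, w\<rangle>\<close>, the moves are Nielsen transformations that respect the conjugacy classes of the
  \<open>y\<^sub>j\<close>. A tuple of minimal length, with ties broken by an ordering of the words, is Nielsen
  reduced; as it generates the free group, it consists of a permutation of the \<open>x\<^sub>i\<^sup>\<plusminus>\<^sup>1\<close> and
  of the \<open>y\<^sub>j\<close>. Rotations \<open>(\<nu>\<^sub>i, \<nu>\<^sub>l) \<mapsto> (\<nu>\<^sub>l, \<nu>\<^sub>i\<^sup>-\<^sup>1)\<close> are products of moves and lead further to the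
  identity or to the reflection \<open>x\<^sub>1 \<mapsto> x\<^sub>1\<^sup>-\<^sup>1\<close>. The determinant of the action on the abelianised
  quotient by the \<open>y\<^sub>j\<close> tells these two apart, so \<open>f\<close> is trivial on its kernel, and \<open>H\<^sub>1\<close> is \<open>\<int>/2\<close>.
  The group \<open>A_sym n k\<close> is an anti-homomorphic image of \<open>A_bd n k\<close>, and the determinant factors
  through it, so the same argument applies there.\<close>

section \<open>Words and cancellation\<close>

text \<open>No generating set of the group has to be known beforehand: the bookkeeping is done by
  the value of \<open>f\<close> alone. What shapes the argument is that a conjugate w^-1 y w may not
  be multiplied by other entries; only its stem w may be changed. Nielsen reduction therefore has to
  be redone with fewer moves. It survives for reasons of parity: a conjugate of a letter has odd
  length, so its two neighbours never cancel one half of it each, and ties that need the ordering of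
  words occur only around an entry at some x. If the neighbour in such a tie is a conjugate, the
  disputed prefix lies in its inverse stem, where a move on w is available. A second point is that
  an endpoint found for \<open>f\<close> need not be the one seen by the determinant; both are read
  off at once by reducing with respect to the pair of homomorphisms. Finally, H_1 is tested only
  against homomorphisms into H_1 itself, with the class map as the decisive instance, so no
  quantification over all abelian groups is involved.\<close>

definition flip :: "'a \<times> bool \<Rightarrow> 'a \<times> bool" where
  "flip l = (fst l, \<not> snd l)"

definition winv :: "'a word \<Rightarrow> 'a word" where
  "winv w = rev (map flip w)"

abbreviation wmult :: "'a word \<Rightarrow> 'a word \<Rightarrow> 'a word" (infixr "\<star>" 70) where
  "u \<star> v \<equiv> foldr push u v"

lemma flip_flip [simp]: "flip (flip l) = l"
  by (simp add: flip_def)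

lemma flip_neq [simp]: "flip l \<noteq> l" "l \<noteq> flip l"
  by (auto simp: flip_def prod_eq_iff)

lemma fst_flip [simp]: "fst (flip l) = fst l"
  by (simp add: flip_def)

lemma flip_Pair [simp]: "flip (a, b) = (a, \<not> b)"
  by (simp add: flip_def)

lemma flip_eq_iff [simp]: "flip l = flip m \<longleftrightarrow> l = m"
  by (auto simp: flip_def prod_eq_iff)

lemma flip_swap: "l = flip m \<longleftrightarrow> m = flip l"
  by auto

lemma winv_simps [simp]:
  "winv [] = []" "winv (u @ v) = winv v @ winv u" "winv (l # u) = winv u @ [flip l]"
  "winv (winv u) = u" "length (winv u) = length u" "fst ` set (winv u) = fst ` set u"
  by (auto simp: winv_def rev_map comp_def image_image)

lemma winv_eq_iff [simp]: "winv u = winv v \<longleftrightarrow> u = v"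
  by (metis winv_simps(4))

lemma winv_eq_Nil [simp]: "winv u = [] \<longleftrightarrow> u = []"
  by (simp add: winv_def)

lemma reduced_iff_successively: "reduced w \<longleftrightarrow> successively (\<lambda>l m. m \<noteq> flip l) w"
  by (induction w rule: reduced.induct) (auto simp: flip_def prod_eq_iff)

lemma reduced_append_iff:
  "reduced (u @ v) \<longleftrightarrow> reduced u \<and> reduced v \<and> (u = [] \<or> v = [] \<or> hd v \<noteq> flip (last u))"
  by (simp add: reduced_iff_successively successively_append_iff)

lemma reduced_Cons_iff: "reduced (l # w) \<longleftrightarrow> w = [] \<or> hd w \<noteq> flip l \<and> reduced w"
  by (auto simp: reduced_iff_successively successively_Cons)

lemma reduced_winv [simp]: "reduced (winv w) \<longleftrightarrow> reduced w"
  unfolding reduced_iff_successively winv_def successively_rev successively_map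
  by (rule successively_cong) (auto simp: flip_swap)

lemma reduced_append3:
  assumes "reduced (u @ v)" "reduced (v @ w)" "v \<noteq> []"
  shows "reduced (u @ v @ w)"
  using assms by (auto simp: reduced_append_iff)

lemma push_Cons: "push l (m # w) = (if m = flip l then w else l # m # w)"
  by (auto simp: flip_def prod_eq_iff)

declare push.simps(2) [simp del]
declare push_Cons [simp]

lemma push_eq_Cons: "reduced (l # w) \<Longrightarrow> push l w = l # w"
  by (cases w) (auto simp: reduced_Cons_iff)

lemma reduced_push: "reduced w \<Longrightarrow> reduced (push l w)"
  by (cases w) (auto simp: reduced_Cons_iff)

lemma push_push_flip: "reduced w \<Longrightarrow> push l (push (flip l) w) = w"
  by (cases w) (auto simp: reduced_Cons_iff push_eq_Cons)

lemma set_push: "set (push l w) \<subseteq> insert l (set w)"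
  by (cases w) auto

lemma reduced_wmult: "reduced v \<Longrightarrow> reduced (u \<star> v)"
  by (induction u) (auto simp: reduced_push)

lemma set_wmult: "set (u \<star> v) \<subseteq> set u \<union> set v"
  by (induction u) (use set_push in fastforce)+

lemma push_wmult: "reduced v \<Longrightarrow> push l u \<star> v = push l (u \<star> v)"
  by (cases u) (auto simp: push_push_flip reduced_wmult)

lemma wmult_assoc: "reduced w \<Longrightarrow> (u \<star> v) \<star> w = u \<star> v \<star> w"
  by (induction u) (auto simp: push_wmult)

lemma wmult_eq_append: "reduced (u @ v) \<Longrightarrow> u \<star> v = u @ v"
proof (induction u)
  case (Cons l u)
  then have "reduced (u @ v)"
    by (auto simp: reduced_Cons_iff)
  with Cons show ?case
    by (simp add: push_eq_Cons)
qed simp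

lemma wmult_Nil: "reduced u \<Longrightarrow> u \<star> [] = u"
  using wmult_eq_append[of u "[]"] by simp

text \<open>The cancellation is literal, letter by letter, so reducedness does not enter.\<close>

lemma winv_wmult_append [simp]: "winv p \<star> (p @ b) = b"
  by (induction p) (auto simp: foldr_append)

lemma winv_wmult_self [simp]: "winv p \<star> p = []"
  using winv_wmult_append[of p "[]"] by simp

lemma wmult_winv_self [simp]: "p \<star> winv p = []"
  using winv_wmult_self[of "winv p"] by simp

lemma append_winv_wmult: "(a @ winv p) \<star> (p @ b) = a \<star> b"
  by (simp add: foldr_append)

lemma length_push_le: "length (push l w) \<le> Suc (length w)"
  by (cases w) auto

lemma length_wmult_le: "length (u \<star> v) \<le> length u + length v"
proof (induction u)
  case (Cons l u)
  then show ?case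
    using length_push_le[of l "u \<star> v"] by simp
qed simp

text \<open>Induction on \<open>u\<close> from its right end, removing letters while they cancel
  against the head of \<open>v\<close>. All Nielsen estimates below count the letters of the
  cancelled part \<open>p\<close>.\<close>

lemma cancellation:
  assumes "reduced u" "reduced v"
  obtains a p b where "u = a @ winv p" "v = p @ b" "reduced (a @ b)" "u \<star> v = a @ b"
proof -
  have "\<exists>a p b. u = a @ winv p \<and> v = p @ b \<and> reduced (a @ b)"
    using assms
  proof (induction u arbitrary: v rule: rev_induct)
    case (Nil v)
    then show ?case
      by (rule_tac x = "[]" in exI, rule_tac x = "[]" in exI, rule_tac x = v in exI, simp)
  next
    case (snoc l u v)
    show ?case
    proof (cases "v \<noteq> [] \<and> hd v = flip l")
      case True
      then obtain v' where v: "v = flip l # v'"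
        by (cases v) auto
      with snoc.prems have "reduced u" "reduced v'"
        by (auto simp: reduced_append_iff reduced_Cons_iff)
      with snoc.IH obtain a p b where "u = a @ winv p" "v' = p @ b" "reduced (a @ b)"
        by blast
      with v show ?thesis
        by (rule_tac x = a in exI, rule_tac x = "flip l # p" in exI, rule_tac x = b in exI, auto)
    next
      case False
      with snoc.prems show ?thesis
        by (rule_tac x = "u @ [l]" in exI, rule_tac x = "[]" in exI, rule_tac x = v in exI, (auto simp: reduced_append_iff reduced_Cons_iff))
    qed
  qed
  then show ?thesis
    using that append_winv_wmult wmult_eq_append by metis
qed

lemma winv_wmult: "reduced u \<Longrightarrow> reduced v \<Longrightarrow> winv (u \<star> v) = winv v \<star> winv u"
proof -
  assume uv: "reduced u" "reduced v"
  obtain a p b where *: "u = a @ winv p" "v = p @ b" "reduced (a @ b)" "u \<star> v = a @ b"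
    using cancellation[OF uv] .
  have "winv v \<star> winv u = winv b \<star> winv a"
    using append_winv_wmult[of "winv b" p "winv a"] * by simp
  also have "\<dots> = winv b @ winv a"
    using * by (intro wmult_eq_append) (simp flip: winv_simps(2))
  finally show ?thesis
    using * by simp
qed

text \<open>In a nonempty word equal to its own inverse, the middle letter would be its own inverse,
  or the two middle letters would cancel.\<close>

lemma reduced_eq_winv_self: "reduced u \<Longrightarrow> u = winv u \<Longrightarrow> u = []"
proof (rule ccontr)
  assume u: "reduced u" "u = winv u" "u \<noteq> []"
  have nth: "u ! i = flip (u ! (length u - Suc i))" if "i < length u" for i
    using that arg_cong[OF u(2), of "\<lambda>w. w ! i"] by (simp add: winv_def rev_nth)
  show False
  proof (cases "even (length u)")
    case False
    then obtain m where "length u = 2 * m + 1"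
      by (rule oddE)
    with nth[of m] show False by simp
  next
    case True
    then obtain m where m: "length u = 2 * m"
      by auto
    with u(3) obtain r where r: "m = Suc r"
      by (cases m) auto
    have "u ! m = flip (u ! r)"
      using nth[of m] m r by simp
    moreover have "u ! m \<noteq> flip (u ! r)"
      using u(1) m r unfolding reduced_iff_successively successively_conv_nth by auto
    ultimately show False by simp
  qed
qed

text \<open>If more than half of \<open>u\<close> cancelled, the cancelled prefix and the cancelled
  suffix of \<open>u\<close> would overlap in a nonempty word equal to its own inverse.\<close>

lemma length_square_ge:
  assumes "reduced u"
  shows "length u \<le> length (u \<star> u)"
proof -
  obtain a p b where *: "u = a @ winv p" "u = p @ b" "reduced (a @ b)" "u \<star> u = a @ b"
    using cancellation[OF assms assms] .
  show ?thesis
  proof (rule ccontr)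
    assume "\<not> ?thesis"
    then have len: "length a < length p" "length a = length b"
      using arg_cong[OF *(1), of length] arg_cong[OF *(2), of length] arg_cong[OF *(4), of length]
      by auto
    define c where "c = drop (length a) p"
    have p: "p = a @ c"
      using * len unfolding c_def
      by (metis append_eq_append_conv_if append_take_drop_id less_imp_le_nat)
    with * have "winv p = c @ b" "winv p = winv c @ winv a"
      by auto
    then have "c = winv c"
      by (metis append_eq_append_conv winv_simps(5))
    moreover have "reduced c"
      using assms * p by (auto simp: reduced_append_iff)
    ultimately show False
      using reduced_eq_winv_self[of c] p len by simp
  qed
qed

section \<open>Nielsen reduced sets\<close>

definition wprod :: "'a word list \<Rightarrow> 'a word" where
  "wprod us = foldr (\<lambda>u v. u \<star> v) us []"

lemma wprod_simps [simp]: "wprod [] = []" "wprod (u # us) = u \<star> wprod us"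
  by (auto simp: wprod_def)

lemma reduced_wprod [simp]: "reduced (wprod us)"
  by (induction us) (auto simp: reduced_wmult)

lemma wprod_append: "wprod (us @ vs) = wprod us \<star> wprod vs"
  by (induction us) (auto simp: wmult_assoc)

lemma not_successively_split:
  "\<not> successively P xs \<Longrightarrow> \<exists>as x y bs. xs = as @ [x, y] @ bs \<and> \<not> P x y"
proof (induction P xs rule: successively.induct)
  case (3 P x y xs)
  show ?case
  proof (cases "P x y")
    case True
    with 3 obtain as x' y' bs where "y # xs = as @ [x', y'] @ bs" "\<not> P x' y'"
      by auto
    then show ?thesis
      by (metis append_Cons)
  next
    case False
    then show ?thesis
      by (metis append_Cons append_Nil)
  qed
qed auto

lemma append_eq_appendE:
  assumes "xs @ ys = zs @ ws" "length xs \<le> length zs"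
  obtains t where "zs = xs @ t" "ys = t @ ws"
  using assms by (fastforce simp: append_eq_append_conv2)

text \<open>Nielsen's conditions for a set closed under inversion. If p letters of each factor
  cancel in \<open>u \<star> v\<close> and q in \<open>v \<star> w\<close>, then \<open>two\<close>
  says 2p <= length v and \<open>three\<close> says p + q < length v: the two neighbours never
  consume \<open>v\<close> entirely. Stated through pairs, \<open>three\<close> avoids the triple
  product.\<close>

locale nielsen_reduced =
  fixes U :: "'a word set"
  assumes red: "u \<in> U \<Longrightarrow> reduced u"
    and winv_closed: "u \<in> U \<Longrightarrow> winv u \<in> U"
    and Nil_notin: "[] \<notin> U"
    and two: "\<lbrakk>u \<in> U; v \<in> U; v \<noteq> winv u\<rbrakk> \<Longrightarrow> length u \<le> length (u \<star> v)"
    and three: "\<lbrakk>u \<in> U; v \<in> U; w \<in> U; v \<noteq> winv u; w \<noteq> winv v\<rbrakk> \<Longrightarrow>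
      length u + length w < length (u \<star> v) + length (v \<star> w)"
begin

lemma two': "\<lbrakk>u \<in> U; v \<in> U; v \<noteq> winv u\<rbrakk> \<Longrightarrow> length v \<le> length (u \<star> v)"
proof -
  assume uv: "u \<in> U" "v \<in> U" "v \<noteq> winv u"
  then have "length (winv v) \<le> length (winv v \<star> winv u)"
    by (intro two winv_closed) auto
  also have "winv v \<star> winv u = winv (u \<star> v)"
    using uv by (simp add: winv_wmult red)
  finally show ?thesis
    by simp
qed

text \<open>By \<open>three\<close>, a nonempty part \<open>s\<close> of each factor survives in the reduced form of the product,
  and the next factor cancels only a proper part of \<open>s\<close>.\<close>

lemma wprod_decomposition:
  assumes "us \<noteq> []" "set us \<subseteq> U" "successively (\<lambda>u v. v \<noteq> winv u) us"
  shows "\<exists>g s t. wprod us = g @ s \<and> last us = t @ s \<and> s \<noteq> [] \<and> length us \<le> Suc (length g) \<and>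
    (\<forall>v\<in>U. v \<noteq> winv (last us) \<longrightarrow> length (last us) + length v < 2 * length s + length (last us \<star> v))"
  using assms
proof (induction us rule: rev_induct)
  case (snoc v us)
  then have v: "v \<in> U" "reduced v" "v \<noteq> []"
    using red Nil_notin by auto
  show ?case
  proof (cases "us = []")
    case True
    have "\<forall>w\<in>U. w \<noteq> winv v \<longrightarrow> length v + length w < 2 * length v + length (v \<star> w)"
    proof (intro ballI impI)
      fix w assume "w \<in> U" "w \<noteq> winv v"
      then have "length w \<le> length (v \<star> w)" "length v > 0"
        using v two'[OF v(1)] by auto
      then show "length v + length w < 2 * length v + length (v \<star> w)"
        by linarith
    qed
    then show ?thesis
      using True v
      by (rule_tac x = "[]" in exI, rule_tac x = v in exI, rule_tac x = "[]" in exI) (simp add: wmult_Nil)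
  next
    case False
    define u where "u = last us"
    have u: "u \<in> U" "v \<noteq> winv u"
      using False snoc.prems last_in_set[of us] unfolding u_def
      by (auto simp: successively_append_iff)
    then have "reduced u"
      using red by simp
    obtain g s t where IH: "wprod us = g @ s" "u = t @ s" "s \<noteq> []" "length us \<le> Suc (length g)"
      "length u + length v < 2 * length s + length (u \<star> v)"
      using snoc False u v(1) unfolding u_def by (auto simp: successively_append_iff)
    obtain a p b where *: "u = a @ winv p" "v = p @ b" "reduced (a @ b)" "u \<star> v = a @ b"
      using cancellation[OF \<open>reduced u\<close> v(2)] .
    \<comment> \<open>The length of \<open>u \<star> v\<close> is that of both factors minus twice
      the length of \<open>p\<close>, so this is \<open>IH(5)\<close> rewritten.\<close>
    have "length p < length s"
      using IH(5) unfolding *(4) unfolding *(1,2) by simp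
    obtain s' where s: "s = s' @ winv p" and a: "a = t @ s'"
    proof (rule append_eq_appendE)
      show eq: "t @ s = a @ winv p"
        using IH(2) *(1) by simp
      show "length t \<le> length a"
        using \<open>length p < length s\<close> arg_cong[OF eq, of length] by simp
    qed
    have s': "s' \<noteq> []"
      using s \<open>length p < length s\<close> by auto
    have "reduced (g @ s' @ b)"
    proof (rule reduced_append3)
      show "reduced (g @ s')"
        using reduced_wprod[of us] IH(1) s by (auto simp: reduced_append_iff)
      show "reduced (s' @ b)"
        using *(3) a by (simp add: reduced_append_iff)
    qed (fact s')
    have "wprod (us @ [v]) = (g @ s) \<star> v"
      using v IH(1) by (simp add: wprod_append wmult_Nil)
    also have "\<dots> = ((g @ s') @ winv p) \<star> (p @ b)"
      using s *(2) by simp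
    also have "\<dots> = (g @ s') \<star> b"
      by (rule append_winv_wmult)
    also have "\<dots> = (g @ s') @ b"
      using \<open>reduced (g @ s' @ b)\<close> by (intro wmult_eq_append) simp
    finally have "wprod (us @ [v]) = (g @ s') @ b" .
    \<comment> \<open>By \<open>two\<close>, at most half of \<open>v\<close> is cancelled.\<close>
    moreover have "b \<noteq> []"
      using two[OF u(1) v(1) u(2)] v(3) *(2) unfolding *(4) unfolding *(1) by auto
    moreover have "length (us @ [v]) \<le> Suc (length (g @ s'))"
      using IH(4) s' by (cases s') auto
    moreover have "length v + length w < 2 * length b + length (v \<star> w)" if "w \<in> U" "w \<noteq> winv v" for w
    proof -
      have "length u = length a + length p" "length v = length p + length b"
        "length (u \<star> v) = length a + length b"
        using * by simp_all
      then show ?thesis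
        using three[OF u(1) v(1) that(1) u(2) that(2)] by linarith
    qed
    ultimately show ?thesis
      using *(2)
      by (rule_tac x = "g @ s'" in exI, rule_tac x = b in exI, rule_tac x = p in exI) simp
  qed
qed simp

text \<open>In a shortest expression no factor is followed by its inverse. Then every factor but the
  last leaves a letter in the product, and the last one leaves another, so a product of length one
  has a single factor.\<close>

lemma letter_in_set:
  assumes "set us \<subseteq> U" "length (wprod us) = 1"
  shows "wprod us \<in> U"
proof -
  let ?P = "\<lambda>vs. set vs \<subseteq> U \<and> wprod vs = wprod us"
  obtain vs where vs: "?P vs" and min: "\<And>vs'. ?P vs' \<Longrightarrow> length vs \<le> length vs'"
    using ex_has_least_nat[of ?P us length] assms(1) by blast
  have ne: "vs \<noteq> []"
    using assms(2) vs by auto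
  have "successively (\<lambda>u v. v \<noteq> winv u) vs"
  proof (rule ccontr)
    assume "\<not> ?thesis"
    then obtain as x y bs where "vs = as @ [x, y] @ bs" "\<not> y \<noteq> winv x"
      using not_successively_split by blast
    then have split: "vs = as @ [x, winv x] @ bs"
      by simp
    have "wprod vs = wprod as \<star> (x \<star> winv x) \<star> wprod bs"
      unfolding split by (simp add: wprod_append wmult_assoc del: wmult_winv_self)
    then have "wprod vs = wprod (as @ bs)"
      by (simp add: wprod_append)
    with vs have "?P (as @ bs)"
      by (auto simp: split)
    from min[OF this] show False
      by (simp add: split)
  qed
  then obtain g s where gs: "wprod vs = g @ s" "s \<noteq> []" "length vs \<le> Suc (length g)"
    using wprod_decomposition[OF ne] vs by blast
  moreover have "length g + length s = 1"
    using assms(2) vs gs(1) by (metis length_append)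
  ultimately have "length vs \<le> 1"
    by (cases s) auto
  with ne obtain u where "vs = [u]"
    by (cases vs) auto
  with vs red show ?thesis
    by (auto simp: wmult_Nil)
qed

end

section \<open>Minimal tuples are Nielsen reduced\<close>

text \<open>Nielsen's left half, including the middle letter. For a conjugate of a letter it is the
  inverse stem followed by that letter.\<close>

definition half :: "'a list \<Rightarrow> 'a list" where
  "half u = take ((length u + 1) div 2) u"

definition letter_image ::
    "'a set \<Rightarrow> ('a \<Rightarrow> 'a word) \<Rightarrow> ('a \<Rightarrow> 'a word) \<Rightarrow> 'a \<Rightarrow> bool \<Rightarrow> 'a word" where
  "letter_image XS \<nu> w b \<epsilon> =
    (if b \<in> XS then if \<epsilon> then \<nu> b else winv (\<nu> b) else winv (w b) \<star> [(b, \<epsilon>)] \<star> w b)"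

text \<open>The function \<open>val\<close> compares words of equal length and breaks the ties left by
  the word length in Nielsen's reduction process.\<close>

locale minimal_tuple =
  fixes XS YS :: "'a set" and \<nu> w :: "'a \<Rightarrow> 'a word" and val :: "'a word \<Rightarrow> nat"
    and el :: "'a \<Rightarrow> bool \<Rightarrow> 'a word" and V :: "'a word \<Rightarrow> nat"
  defines "el \<equiv> letter_image XS \<nu> w"
    and "V \<equiv> \<lambda>u. val (half u) + val (half (winv u))"
  assumes disjoint: "XS \<inter> YS = {}"
    and \<nu>_reduced: "b \<in> XS \<Longrightarrow> reduced (\<nu> b)"
    and w_reduced: "b \<in> YS \<Longrightarrow> reduced (w b)"
    and \<nu>_letters: "b \<in> XS \<Longrightarrow> fst ` set (\<nu> b) \<subseteq> XS \<union> YS"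
    and \<nu>_nonempty: "b \<in> XS \<Longrightarrow> \<nu> b \<noteq> []"
    and val_mono: "\<lbrakk>length p = length q; val p < val q\<rbrakk> \<Longrightarrow> val (p @ r) < val (q @ r)"
    and val_inj: "\<lbrakk>length p = length q; fst ` set p \<subseteq> XS \<union> YS; fst ` set q \<subseteq> XS \<union> YS; val p = val q\<rbrakk> \<Longrightarrow> p = q"
    and right_len: "\<lbrakk>b \<in> XS; c \<in> XS \<union> YS; c \<noteq> b\<rbrakk> \<Longrightarrow> length (\<nu> b) \<le> length (\<nu> b \<star> el c \<epsilon>)"
    and left_len: "\<lbrakk>b \<in> XS; c \<in> XS \<union> YS; c \<noteq> b\<rbrakk> \<Longrightarrow> length (\<nu> b) \<le> length (el c \<epsilon> \<star> \<nu> b)"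
    and conj_len: "\<lbrakk>b \<in> YS; c \<in> XS \<union> YS\<rbrakk> \<Longrightarrow> length (w b) \<le> length (w b \<star> el c \<epsilon>)"
    and right_val: "\<lbrakk>b \<in> XS; c \<in> XS \<union> YS; c \<noteq> b; length (\<nu> b \<star> el c \<epsilon>) = length (\<nu> b)\<rbrakk> \<Longrightarrow>
      V (\<nu> b) \<le> V (\<nu> b \<star> el c \<epsilon>)"
    and left_val: "\<lbrakk>b \<in> XS; c \<in> XS \<union> YS; c \<noteq> b; length (el c \<epsilon> \<star> \<nu> b) = length (\<nu> b)\<rbrakk> \<Longrightarrow>
      V (\<nu> b) \<le> V (el c \<epsilon> \<star> \<nu> b)"
    \<comment> \<open>\<open>winv (w b)\<close> is how the conjugate at \<open>b\<close> begins, so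
      its value plays the role of the value of a left half.\<close>
    and conj_val: "\<lbrakk>b \<in> YS; c \<in> XS \<union> YS; length (w b \<star> el c \<epsilon>) = length (w b)\<rbrakk> \<Longrightarrow>
      val (winv (w b)) \<le> val (winv (w b \<star> el c \<epsilon>))"
begin

lemma el_X: "b \<in> XS \<Longrightarrow> el b \<epsilon> = (if \<epsilon> then \<nu> b else winv (\<nu> b))"
  by (simp add: el_def letter_image_def)

lemma el_Y_wmult: "b \<in> YS \<Longrightarrow> el b \<epsilon> = winv (w b) \<star> [(b, \<epsilon>)] \<star> w b"
  using disjoint by (auto simp: el_def letter_image_def)

text \<open>Otherwise the twist by the opposite letter would remove the first letter of
  \<open>w b\<close>.\<close>

lemma w_hd: "b \<in> YS \<Longrightarrow> w b = [] \<or> fst (hd (w b)) \<noteq> b"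
proof (rule ccontr)
  assume b: "b \<in> YS" and "\<not> ?thesis"
  then obtain \<delta> r where r: "w b = (b, \<delta>) # r"
    by (cases "w b") auto
  have "w b \<star> el b (\<not> \<delta>) = (w b \<star> winv (w b)) \<star> [(b, \<not> \<delta>)] \<star> w b"
    unfolding el_Y_wmult[OF b]
    using w_reduced[OF b] by (subst wmult_assoc[of _ "w b"]) (auto simp: reduced_push)
  also have "\<dots> = r"
    unfolding wmult_winv_self r by simp
  finally show False
    using conj_len[OF b, of b "\<not> \<delta>"] b r by simp
qed

text \<open>By \<open>w_hd\<close> nothing cancels around the middle letter. Having the conjugate as
  a literal word exposes its odd length and its middle letter, on which the case distinctions below
  rest.\<close>

lemma el_Y:
  assumes "b \<in> YS"
  shows "el b \<epsilon> = winv (w b) @ (b, \<epsilon>) # w b" "reduced (winv (w b) @ (b, \<epsilon>) # w b)"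
proof -
  have 1: "reduced ([(b, \<delta>)] @ w b)" for \<delta>
    using w_hd[OF assms] w_reduced[OF assms] by (auto simp: reduced_Cons_iff)
  have 2: "reduced (winv (w b) @ [(b, \<epsilon>)])"
    using 1[of "\<not> \<epsilon>"] reduced_winv[of "[(b, \<not> \<epsilon>)] @ w b"] by simp
  show 3: "reduced (winv (w b) @ (b, \<epsilon>) # w b)"
    using reduced_append3[OF 2 1] by simp
  have "[(b, \<epsilon>)] \<star> w b = (b, \<epsilon>) # w b"
    using wmult_eq_append[OF 1] by simp
  then show "el b \<epsilon> = winv (w b) @ (b, \<epsilon>) # w b"
    using wmult_eq_append[OF 3] el_Y_wmult[OF assms, of \<epsilon>] by simp
qed

lemma winv_el: "b \<in> XS \<union> YS \<Longrightarrow> winv (el b \<epsilon>) = el b (\<not> \<epsilon>)"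
  by (auto simp: el_X el_Y(1))

lemma reduced_el: "b \<in> XS \<union> YS \<Longrightarrow> reduced (el b \<epsilon>)"
  by (auto simp: el_X \<nu>_reduced el_Y)

lemma el_nonempty: "b \<in> XS \<union> YS \<Longrightarrow> el b \<epsilon> \<noteq> []"
  using \<nu>_nonempty[of b] by (auto simp: el_X el_Y split: if_splits)

lemma V_winv [simp]: "V (winv u) = V u"
  by (simp add: V_def)

lemma winv_el_wmult_el:
  "\<lbrakk>b \<in> XS \<union> YS; c \<in> XS \<union> YS\<rbrakk> \<Longrightarrow> winv (el b \<epsilon> \<star> el c \<delta>) = el c (\<not> \<delta>) \<star> el b (\<not> \<epsilon>)"
  by (simp add: winv_wmult reduced_el winv_el)

lemma length_el_wmult_el:
  "\<lbrakk>b \<in> XS \<union> YS; c \<in> XS \<union> YS\<rbrakk> \<Longrightarrow> length (el b \<epsilon> \<star> el c \<delta>) = length (el c (\<not> \<delta>) \<star> el b (\<not> \<epsilon>))"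
  using winv_el_wmult_el[of b c \<epsilon> \<delta>] by (metis winv_simps(5))

lemma V_el_wmult_el:
  "\<lbrakk>b \<in> XS \<union> YS; c \<in> XS \<union> YS\<rbrakk> \<Longrightarrow> V (el b \<epsilon> \<star> el c \<delta>) = V (el c (\<not> \<delta>) \<star> el b (\<not> \<epsilon>))"
  using winv_el_wmult_el[of b c \<epsilon> \<delta>] by (metis V_winv)

text \<open>The minimality assumptions speak of \<open>\<nu> b\<close> only. For the inverse entry
  the whole product is inverted, which exchanges right and left moves.\<close>

lemma X_minimal:
  assumes b: "b \<in> XS" and c: "c \<in> XS \<union> YS" "c \<noteq> b"
  shows "length (el b \<epsilon>) \<le> length (el b \<epsilon> \<star> el c \<delta>)"
    and "length (el b \<epsilon> \<star> el c \<delta>) = length (el b \<epsilon>) \<Longrightarrow> V (el b \<epsilon>) \<le> V (el b \<epsilon> \<star> el c \<delta>)"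
proof -
  have b': "b \<in> XS \<union> YS"
    using b by simp
  have "length (el b \<epsilon>) \<le> length (el b \<epsilon> \<star> el c \<delta>) \<and>
    (length (el b \<epsilon> \<star> el c \<delta>) = length (el b \<epsilon>) \<longrightarrow> V (el b \<epsilon>) \<le> V (el b \<epsilon> \<star> el c \<delta>))"
  proof (cases \<epsilon>)
    case True
    with b have "el b \<epsilon> = \<nu> b"
      by (simp add: el_X)
    then show ?thesis
      using right_len[OF b c, of \<delta>] right_val[OF b c, of \<delta>] by simp
  next
    case False
    with b have *: "el b \<epsilon> = winv (\<nu> b)" "el b (\<not> \<epsilon>) = \<nu> b"
      by (simp_all add: el_X)
    show ?thesis
      unfolding length_el_wmult_el[OF b' c(1)] V_el_wmult_el[OF b' c(1)] unfolding *
      using left_len[OF b c, of "\<not> \<delta>"] left_val[OF b c, of "\<not> \<delta>"] by simp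
  qed
  then show "length (el b \<epsilon>) \<le> length (el b \<epsilon> \<star> el c \<delta>)"
    "length (el b \<epsilon> \<star> el c \<delta>) = length (el b \<epsilon>) \<Longrightarrow> V (el b \<epsilon>) \<le> V (el b \<epsilon> \<star> el c \<delta>)"
    by blast+
qed

lemma X_minimal':
  assumes b: "b \<in> XS" and c: "c \<in> XS \<union> YS" "c \<noteq> b"
  shows "length (el b \<epsilon>) \<le> length (el c \<delta> \<star> el b \<epsilon>)"
    and "length (el c \<delta> \<star> el b \<epsilon>) = length (el b \<epsilon>) \<Longrightarrow> V (el b \<epsilon>) \<le> V (el c \<delta> \<star> el b \<epsilon>)"
proof -
  have b': "b \<in> XS \<union> YS"
    using b by simp
  have *: "length (el b \<epsilon>) = length (el b (\<not> \<epsilon>))" "V (el b \<epsilon>) = V (el b (\<not> \<epsilon>))"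
    using winv_el[OF b', of \<epsilon>] V_winv[of "el b \<epsilon>"] winv_simps(5)[of "el b \<epsilon>"] by simp_all
  show "length (el b \<epsilon>) \<le> length (el c \<delta> \<star> el b \<epsilon>)"
    "length (el c \<delta> \<star> el b \<epsilon>) = length (el b \<epsilon>) \<Longrightarrow> V (el b \<epsilon>) \<le> V (el c \<delta> \<star> el b \<epsilon>)"
    using X_minimal[OF assms, of "\<not> \<epsilon>" "\<not> \<delta>"] length_el_wmult_el[OF c(1) b', of \<delta> \<epsilon>]
      V_el_wmult_el[OF c(1) b', of \<delta> \<epsilon>] *
    by simp_all
qed

text \<open>The case in which the conjugate at \<open>b\<close> cancels beyond its middle letter.
  For \<open>c\<close> in \<open>XS\<close> a left move would shorten \<open>\<nu> c\<close>. For
  two conjugates with stems of different length, the longer stem ends in the middle letter and the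
  stem of the other conjugate, and a move would shorten it; stems of equal length force
  \<open>b = c\<close>.\<close>

lemma Y_cancels_long:
  assumes b: "b \<in> YS" and c: "c \<in> XS \<union> YS" "c \<noteq> b"
    and len: "length (el b \<epsilon> \<star> el c \<delta>) < length (el c \<delta>)"
    and prefix: "el c \<delta> = winv (w b) @ (b, \<not> \<epsilon>) # r"
  shows False
proof (cases "c \<in> XS")
  case True
  with X_minimal'(1)[of c b \<delta> \<epsilon>] len b c show False
    by auto
next
  case False
  with c have c': "c \<in> YS" by auto
  have eq: "winv (w b) @ (b, \<not> \<epsilon>) # r = winv (w c) @ (c, \<delta>) # w c"
    using prefix el_Y(1)[OF c'] by simp
  consider (eq) "length (w b) = length (w c)" | (lt) "length (w b) < length (w c)"
    | (gt) "length (w c) < length (w b)"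
    by linarith
  then show False
  proof cases
    case eq
    with \<open>winv (w b) @ (b, \<not> \<epsilon>) # r = winv (w c) @ (c, \<delta>) # w c\<close> c show False
      by simp
  next
    case lt
    have "(winv (w b) @ [(b, \<not> \<epsilon>)]) @ r = winv (w c) @ (c, \<delta>) # w c"
      using eq by simp
    then obtain t where "winv (w c) = (winv (w b) @ [(b, \<not> \<epsilon>)]) @ t"
      using lt by (elim append_eq_appendE) auto
    then have t: "winv (w c) = winv (w b) @ (b, \<not> \<epsilon>) # t"
      by simp
    have "w c = winv (winv (w c))"
      by simp
    also have "\<dots> = (winv t) @ (b, \<epsilon>) # w b"
      unfolding t by simp
    finally have "w c \<star> el b (\<not> \<epsilon>) = (winv t @ winv (winv (w b) @ [(b, \<not> \<epsilon>)])) \<star> ((winv (w b) @ [(b, \<not> \<epsilon>)]) @ w b)"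
      using el_Y(1)[OF b, of "\<not> \<epsilon>"] by simp
    also have "\<dots> = winv t \<star> w b"
      by (rule append_winv_wmult)
    finally have "length (w c \<star> el b (\<not> \<epsilon>)) \<le> length t + length (w b)"
      using length_wmult_le[of "winv t" "w b"] by simp
    moreover have "length (w c) = length (w b) + Suc (length t)"
      using arg_cong[OF t, of length] by simp
    ultimately show False
      using conj_len[OF c', of b "\<not> \<epsilon>"] b by simp
  next
    case gt
    have "(winv (w c) @ [(c, \<delta>)]) @ w c = winv (w b) @ (b, \<not> \<epsilon>) # r"
      using eq by simp
    then obtain t where "winv (w b) = (winv (w c) @ [(c, \<delta>)]) @ t"
      using gt by (elim append_eq_appendE) auto
    then have t: "winv (w b) = winv (w c) @ (c, \<delta>) # t"
      by simp
    have "w b = winv (winv (w b))"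
      by simp
    also have "\<dots> = (winv t) @ (c, \<not> \<delta>) # w c"
      unfolding t by simp
    finally have "w b \<star> el c \<delta> = (winv t @ winv (winv (w c) @ [(c, \<delta>)])) \<star> ((winv (w c) @ [(c, \<delta>)]) @ w c)"
      using el_Y(1)[OF c', of \<delta>] by simp
    also have "\<dots> = winv t \<star> w c"
      by (rule append_winv_wmult)
    finally have "length (w b \<star> el c \<delta>) \<le> length t + length (w c)"
      using length_wmult_le[of "winv t" "w c"] by simp
    moreover have "length (w b) = length (w c) + Suc (length t)"
      using arg_cong[OF t, of length] by simp
    ultimately show False
      using conj_len[OF b, of c \<delta>] c by simp
  qed
qed

text \<open>For \<open>b = c\<close> the signs agree and the product is a square. A conjugate at
  \<open>b\<close> admits no multiplication by \<open>el c\<close>, but if only letters of its stem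
  cancel, the same cancellation would shorten \<open>w b\<close>; if its middle letter cancels too,
  \<open>Y_cancels_long\<close> applies.\<close>

lemma el_two:
  assumes b: "b \<in> XS \<union> YS" and c: "c \<in> XS \<union> YS" and neq: "el c \<delta> \<noteq> winv (el b \<epsilon>)"
  shows "length (el b \<epsilon>) \<le> length (el b \<epsilon> \<star> el c \<delta>)"
proof (cases "b = c")
  case True
  with neq winv_el[OF b, of \<epsilon>] have "\<delta> = \<epsilon>"
    by (cases \<delta>; cases \<epsilon>; auto)
  with True show ?thesis
    using length_square_ge[OF reduced_el[OF b]] by simp
next
  case False
  show ?thesis
  proof (cases "b \<in> XS")
    case True
    with X_minimal(1)[of b c] False c show ?thesis by auto
  next
    case False
    with b have b': "b \<in> YS" by auto
    obtain a p q where *: "el b \<epsilon> = a @ winv p" "el c \<delta> = p @ q" "reduced (a @ q)" "el b \<epsilon> \<star> el c \<delta> = a @ q"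
      using cancellation[OF reduced_el[OF b] reduced_el[OF c]] .
    show ?thesis
    proof (rule ccontr)
      assume "\<not> ?thesis"
      then have "length q < length p"
        using * by simp
      have eq: "winv (w b) @ (b, \<epsilon>) # w b = a @ winv p"
        using el_Y(1)[OF b'] *(1) by simp
      show False
      proof (cases "length p \<le> length (w b)")
        case True
        have "(winv (w b) @ [(b, \<epsilon>)]) @ w b = a @ winv p"
          using eq by simp
        moreover have "length (winv (w b) @ [(b, \<epsilon>)]) \<le> length a"
          using arg_cong[OF eq, of length] True by simp
        ultimately obtain w' where "w b = w' @ winv p"
          by (elim append_eq_appendE)
        then have "w b \<star> el c \<delta> = w' \<star> q" "length (w b) = length w' + length p"
          using *(2) append_winv_wmult by auto
        then show False
          using conj_len[OF b' c, of \<delta>] \<open>length q < length p\<close> length_wmult_le[of w' q] by simp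
      next
        case long: False
        have "winv (el b \<epsilon>) = p @ winv a"
          using *(1) by simp
        then have eq': "winv (w b) @ (b, \<not> \<epsilon>) # w b = p @ winv a"
          using winv_el[OF b] el_Y(1)[OF b', of "\<not> \<epsilon>"] by simp
        have "(winv (w b) @ [(b, \<not> \<epsilon>)]) @ w b = p @ winv a"
          using eq' by simp
        then obtain r where "p = (winv (w b) @ [(b, \<not> \<epsilon>)]) @ r"
          using long by (elim append_eq_appendE) auto
        then have "el c \<delta> = winv (w b) @ (b, \<not> \<epsilon>) # (r @ q)"
          using *(2) by simp
        moreover have "length a < length p"
          using arg_cong[OF eq, of length] long by simp
        then have "length (el b \<epsilon> \<star> el c \<delta>) < length (el c \<delta>)"
          using * by simp
        ultimately show False
          using Y_cancels_long[OF b' c] \<open>b \<noteq> c\<close> by metis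
      qed
    qed
  qed
qed

lemma el_two':
  assumes b: "b \<in> XS \<union> YS" and c: "c \<in> XS \<union> YS" and neq: "el c \<delta> \<noteq> winv (el b \<epsilon>)"
  shows "length (el c \<delta>) \<le> length (el b \<epsilon> \<star> el c \<delta>)"
proof -
  have "length (el c \<delta>) = length (el c (\<not> \<delta>))"
    using winv_simps(5)[of "el c \<delta>"] winv_el[OF c, of \<delta>] by simp
  also have "el b (\<not> \<epsilon>) \<noteq> winv (el c (\<not> \<delta>))"
    using neq winv_el[OF c, of "\<not> \<delta>"] winv_el[OF b, of "\<epsilon>"] by auto
  then have "length (el c (\<not> \<delta>)) \<le> length (el c (\<not> \<delta>) \<star> el b (\<not> \<epsilon>))"
    by (rule el_two[OF c b])
  also have "\<dots> = length (el b \<epsilon> \<star> el c \<delta>)"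
    by (rule length_el_wmult_el[OF b c, symmetric])
  finally show ?thesis .
qed

text \<open>Taking up at most half of the word, \<open>p\<close> and \<open>q\<close> lie within its
  left half, and the left half of the inverse does not see them.\<close>

lemma V_mono:
  assumes "length p = length q" "length q \<le> length r" "val p < val q"
  shows "V (p @ r) < V (q @ r)"
proof -
  have half: "half (s @ r) = s @ take ((length s + length r + 1) div 2 - length s) r"
    "half (winv (s @ r)) = take ((length s + length r + 1) div 2) (winv r)"
    if "length s \<le> length r" for s
    using that by (simp_all add: half_def add.commute)
  show ?thesis
    using assms half[of p] half[of q] val_mono[OF assms(1,3)] by (simp add: V_def)
qed

text \<open>If \<open>v = p q\<^sup>-\<^sup>1\<close> cancels exactly half against the next factor \<open>q r\<close>, then replacing the latter
  by \<open>p r\<close> keeps its length, so \<open>val\<close> decides.\<close>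

lemma tie_break:
  assumes c: "c \<in> XS" and d: "d \<in> XS \<union> YS" "d \<noteq> c"
    and v: "el c \<delta> = p @ winv q" and x: "el d \<zeta> = q @ r"
    and len: "length p = length q" "length q \<le> length r"
    and red: "reduced (p @ r)" and less: "val p < val q"
  shows False
proof (cases "d \<in> XS")
  case True
  have "el c \<delta> \<star> el d \<zeta> = p @ r"
    using v x append_winv_wmult[of p q r] wmult_eq_append[OF red] by simp
  then show False
    using X_minimal'(2)[OF True _ d(2)[symmetric], of \<delta> \<zeta>] V_mono[OF len less] c x len by simp
next
  case False
  with d have d': "d \<in> YS" by simp
  have eq: "q @ r = winv (w d) @ (d, \<zeta>) # w d"
    using x el_Y(1)[OF d'] by simp
  \<comment> \<open>The conjugate has odd length, so a prefix no longer than the rest stops before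
    the middle letter.\<close>
  moreover have "length q \<le> length (winv (w d))"
    using arg_cong[OF eq, of length] len by simp
  ultimately obtain t where t: "winv (w d) = q @ t" "r = t @ (d, \<zeta>) # w d"
    by (elim append_eq_appendE)
  have wd: "w d = winv t @ winv q"
    using arg_cong[OF t(1), of winv] by simp
  have "reduced (p @ t)"
    using red t(2) by (auto simp: reduced_append_iff)
  then have red': "reduced (winv t @ winv p)"
    using reduced_winv[of "p @ t"] by simp
  have "el c (\<not> \<delta>) = q @ winv p"
    using v winv_el[of c \<delta>] c by simp
  \<comment> \<open>This move on the stem replaces the beginning \<open>q\<close> of the inverse
    stem by \<open>p\<close>.\<close>
  then have prod: "w d \<star> el c (\<not> \<delta>) = winv t @ winv p"
    using wd append_winv_wmult[of "winv t" q "winv p"] wmult_eq_append[OF red'] by simp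
  then have "val (winv (w d)) \<le> val (p @ t)"
    using conj_val[OF d', of c "\<not> \<delta>"] c wd len by simp
  with val_mono[OF len(1) less, of t] t(1) show False
    by simp
qed

text \<open>If the inequality failed, the neighbours would cancel exactly half of
  \<open>el c \<delta>\<close> each, so it would be \<open>p @ winv q\<close> with halves of equal
  length. They differ, and the one of larger value can be replaced by the other in the neighbour
  that cancels against it, contrary to \<open>tie_break\<close>.\<close>

lemma el_three:
  assumes b: "b \<in> XS \<union> YS" and c: "c \<in> XS \<union> YS" and d: "d \<in> XS \<union> YS"
    and bc: "el c \<delta> \<noteq> winv (el b \<epsilon>)" and cd: "el d \<zeta> \<noteq> winv (el c \<delta>)"
  shows "length (el b \<epsilon>) + length (el d \<zeta>) <
    length (el b \<epsilon> \<star> el c \<delta>) + length (el c \<delta> \<star> el d \<zeta>)"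
proof (rule ccontr)
  assume "\<not> ?thesis"
  with el_two[OF b c bc] el_two'[OF c d cd]
  have len: "length (el b \<epsilon> \<star> el c \<delta>) = length (el b \<epsilon>)"
    "length (el c \<delta> \<star> el d \<zeta>) = length (el d \<zeta>)"
    by linarith+
  obtain a p p' where 1: "el b \<epsilon> = a @ winv p" "el c \<delta> = p @ p'" "reduced (a @ p')"
      "el b \<epsilon> \<star> el c \<delta> = a @ p'"
    using cancellation[OF reduced_el[OF b] reduced_el[OF c]] .
  obtain q' q r where 2: "el c \<delta> = q' @ winv q" "el d \<zeta> = q @ r" "reduced (q' @ r)"
      "el c \<delta> \<star> el d \<zeta> = q' @ r"
    using cancellation[OF reduced_el[OF c] reduced_el[OF d]] .
  have "length p' = length p" "length q' = length q"
    using len 1 2 by simp_all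
  moreover from this have "length p = length q"
    using arg_cong[OF 1(2), of length] arg_cong[OF 2(1), of length] by simp
  ultimately have pq: "length p = length q" "q' = p" "p' = winv q"
    using 1(2) 2(1) by simp_all
  have v: "el c \<delta> = p @ winv q"
    using 1(2) pq by simp
  \<comment> \<open>\<open>el c \<delta>\<close> has even length here, a conjugate of a letter has
    odd length.\<close>
  have "c \<in> XS"
  proof (rule ccontr)
    assume "c \<notin> XS"
    with c have "length (el c \<delta>) = 2 * length (w c) + 1"
      by (simp add: el_Y(1))
    then show False
      using arg_cong[OF v, of length] pq(1) by simp presburger
  qed
  have "p \<noteq> q"
  proof
    assume "p = q"
    then have "el c \<delta> = winv (el c \<delta>)"
      using v by simp
    then show False
      using reduced_eq_winv_self[OF reduced_el[OF c]] el_nonempty[OF c] by blast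
  qed
  \<comment> \<open>If a neighbour belonged to the same generator, it would be the same word;
    comparing its two factorisations would give \<open>p = q\<close>.\<close>
  have same: "\<delta> = \<epsilon>" if "el c \<epsilon> \<noteq> winv (el c \<delta>)" for \<delta> \<epsilon>
    using that winv_el[OF c, of \<delta>] by (cases \<delta>; cases \<epsilon>) auto
  have "b \<noteq> c"
  proof
    assume "b = c"
    then have "a @ winv p = p @ winv q"
      using bc same[of \<delta> \<epsilon>] 1(1) v by simp
    with pq \<open>p \<noteq> q\<close> show False
      by simp
  qed
  have "d \<noteq> c"
  proof
    assume "d = c"
    then have "q @ r = p @ winv q"
      using cd same[of \<zeta> \<delta>] 2(2) v by simp
    with pq \<open>p \<noteq> q\<close> show False
      by simp
  qed
  have "fst ` set (el c \<delta>) \<subseteq> XS \<union> YS"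
    using \<open>c \<in> XS\<close> \<nu>_letters by (simp add: el_X)
  moreover have "fst ` set (el c \<delta>) = fst ` set p \<union> fst ` set q"
    unfolding v by (simp add: image_Un)
  ultimately have "fst ` set p \<subseteq> XS \<union> YS" "fst ` set q \<subseteq> XS \<union> YS"
    by auto
  with val_inj[OF pq(1)] \<open>p \<noteq> q\<close> consider "val p < val q" | "val q < val p"
    by (meson linorder_neqE_nat)
  then show False
  proof cases
    case 1
    show False
    proof (rule tie_break[OF \<open>c \<in> XS\<close> d \<open>d \<noteq> c\<close> v 2(2) pq(1) _ _ 1])
      show "length q \<le> length r"
        using el_two'[OF c d cd] el_two[OF c d cd] 2 v pq by simp
      show "reduced (p @ r)"
        using 2(3) pq by simp
    qed
  next
    case 3: 2
    have v': "el c (\<not> \<delta>) = q @ winv p"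
      using winv_el[OF c, of \<delta>] v by simp
    have u': "el b (\<not> \<epsilon>) = p @ winv a"
      using winv_el[OF b, of \<epsilon>] 1(1) by simp
    show False
    proof (rule tie_break[OF \<open>c \<in> XS\<close> b \<open>b \<noteq> c\<close> v' u' pq(1)[symmetric] _ _ 3])
      show "length p \<le> length (winv a)"
        using el_two'[OF b c bc] 1 v pq by simp
      show "reduced (q @ winv a)"
        using 1(3) pq reduced_winv[of "a @ winv q"] by simp
    qed
  qed
qed

sublocale nielsen_reduced "{el b \<epsilon> | b \<epsilon>. b \<in> XS \<union> YS}"
proof
  fix u v x
  assume "u \<in> {el b \<epsilon> | b \<epsilon>. b \<in> XS \<union> YS}"
  then obtain b \<epsilon> where u: "u = el b \<epsilon>" "b \<in> XS \<union> YS"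
    by blast
  show "reduced u"
    unfolding u(1) by (rule reduced_el[OF u(2)])
  show "winv u \<in> {el b \<epsilon> | b \<epsilon>. b \<in> XS \<union> YS}"
    unfolding u(1) winv_el[OF u(2)] using u(2) by blast
  assume "v \<in> {el b \<epsilon> | b \<epsilon>. b \<in> XS \<union> YS}"
  then obtain c \<delta> where v: "v = el c \<delta>" "c \<in> XS \<union> YS"
    by blast
  assume vu: "v \<noteq> winv u"
  then show "length u \<le> length (u \<star> v)"
    unfolding u(1) v(1) by (rule el_two[OF u(2) v(2)])
  assume "x \<in> {el b \<epsilon> | b \<epsilon>. b \<in> XS \<union> YS}"
  then obtain d \<zeta> where x: "x = el d \<zeta>" "d \<in> XS \<union> YS"
    by blast
  assume "x \<noteq> winv v"
  with vu show "length u + length x < length (u \<star> v) + length (v \<star> x)"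
    unfolding u(1) v(1) x(1) by (rule el_three[OF u(2) v(2) x(2)])
next
  show "[] \<notin> {el b \<epsilon> | b \<epsilon>. b \<in> XS \<union> YS}"
    by (rule notI) (use el_nonempty in \<open>auto dest: sym\<close>)
qed

text \<open>Every generator is itself an entry by \<open>letter_in_set\<close>. A conjugate of
  length one is the letter of its own circle, so the generators in \<open>XS\<close> come from
  entries at \<open>XS\<close>. By finiteness they use up all of these, and a generator in
  \<open>YS\<close> can only come from a conjugate with empty stem.\<close>

lemma minimal_generating:
  assumes fin: "finite XS"
    and gen: "\<And>b. b \<in> XS \<union> YS \<Longrightarrow>
      \<exists>us. set us \<subseteq> {el b \<epsilon> | b \<epsilon>. b \<in> XS \<union> YS} \<and> wprod us = [(b, True)]"
  shows "b \<in> XS \<Longrightarrow> \<exists>c\<in>XS. \<exists>\<epsilon>. \<nu> c = [(b, \<epsilon>)]" "b \<in> YS \<Longrightarrow> w b = []"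
proof -
  have letter: "\<exists>c\<in>XS \<union> YS. \<exists>\<epsilon>. el c \<epsilon> = [(b, True)]" if "b \<in> XS \<union> YS" for b
    using gen[OF that] letter_in_set by fastforce
  have X: "\<nu> c = [(b, \<epsilon>)]" if "c \<in> XS" "el c \<epsilon> = [(b, True)]" for b c \<epsilon>
  proof (cases \<epsilon>)
    case False
    then have "winv (winv (\<nu> c)) = winv [(b, True)]"
      using that by (simp only: el_X if_False)
    with False show ?thesis
      by simp
  qed (use that in \<open>simp add: el_X\<close>)
  have Y: "c = b \<and> w c = []" if "c \<in> YS" "el c \<epsilon> = [(b, True)]" for b c \<epsilon>
    using that el_Y(1)[OF that(1), of \<epsilon>] by (cases "w c") auto
  have x: "\<exists>c\<in>XS. \<exists>\<epsilon>. \<nu> c = [(b, \<epsilon>)]" if "b \<in> XS" for b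
    using letter[of b] that X Y disjoint by blast
  then obtain \<sigma> where \<sigma>: "\<And>b. b \<in> XS \<Longrightarrow> \<sigma> b \<in> XS \<and> (\<exists>\<epsilon>. \<nu> (\<sigma> b) = [(b, \<epsilon>)])"
    by metis
  then have "inj_on \<sigma> XS"
    by (intro inj_onI) (metis list.inject prod.inject)
  moreover have "\<sigma> ` XS \<subseteq> XS"
    using \<sigma> by blast
  ultimately have surj: "\<sigma> ` XS = XS"
    using fin endo_inj_surj by blast
  show "b \<in> XS \<Longrightarrow> \<exists>c\<in>XS. \<exists>\<epsilon>. \<nu> c = [(b, \<epsilon>)]"
    by (rule x)
  assume b: "b \<in> YS"
  then obtain c \<epsilon> where c: "c \<in> XS \<union> YS" "el c \<epsilon> = [(b, True)]"
    using letter[of b] by blast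
  have "c \<notin> XS"
  proof
    assume cX: "c \<in> XS"
    then obtain b' where "b' \<in> XS" "c = \<sigma> b'"
      using surj by blast
    with \<sigma>[of b'] X[OF cX c(2)] have "b \<in> XS"
      by auto
    with b disjoint show False
      by blast
  qed
  with Y[of c] c show "w b = []"
    by blast
qed

end

section \<open>Free groups and their endomorphisms\<close>

lemma free_group_simps:
  "carrier (free_group S) = {w. reduced w \<and> fst ` set w \<subseteq> S}"
  "u \<otimes>\<^bsub>free_group S\<^esub> v = u \<star> v" "\<one>\<^bsub>free_group S\<^esub> = []"
  by (simp_all add: free_group_def)

lemma letters_wmult: "fst ` set u \<subseteq> S \<Longrightarrow> fst ` set v \<subseteq> S \<Longrightarrow> fst ` set (u \<star> v) \<subseteq> S"
  using set_wmult[of u v] by blast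

lemma group_free_group: "group (free_group S)"
proof (rule groupI)
  fix w assume w: "w \<in> carrier (free_group S)"
  then have "winv w \<in> carrier (free_group S)"
    by (simp add: free_group_simps)
  moreover have "winv w \<otimes>\<^bsub>free_group S\<^esub> w = \<one>\<^bsub>free_group S\<^esub>"
    by (simp add: free_group_simps)
  ultimately show "\<exists>v\<in>carrier (free_group S). v \<otimes>\<^bsub>free_group S\<^esub> w = \<one>\<^bsub>free_group S\<^esub>"
    by blast
qed (simp_all add: free_group_simps reduced_wmult letters_wmult wmult_assoc)

lemma inv_free_group: "w \<in> carrier (free_group S) \<Longrightarrow> inv\<^bsub>free_group S\<^esub> w = winv w"
  by (rule group.inv_equality[OF group_free_group]) (simp_all add: free_group_simps)

context group
begin

lemma free_lift_simps [simp]: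
  "free_lift G f [] = \<one>"
  "free_lift G f ((a, b) # w) = (if b then f a else inv (f a)) \<otimes> free_lift G f w"
  by (simp_all add: free_lift_def)

lemma free_lift_closed:
  "\<lbrakk>f \<in> S \<rightarrow> carrier G; fst ` set w \<subseteq> S\<rbrakk> \<Longrightarrow> free_lift G f w \<in> carrier G"
  by (induction w) (auto simp: Pi_iff)

lemma free_lift_push:
  assumes f: "f \<in> S \<rightarrow> carrier G" and "a \<in> S" "fst ` set w \<subseteq> S"
  shows "free_lift G f (push (a, b) w) = (if b then f a else inv (f a)) \<otimes> free_lift G f w"
proof (cases "\<exists>w'. w = flip (a, b) # w'")
  case True
  then obtain w' where w: "w = (a, \<not> b) # w'"
    by auto
  have "free_lift G f w' \<in> carrier G" "f a \<in> carrier G"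
    using assms w free_lift_closed[OF f, of w'] by auto
  then show ?thesis
    by (simp add: w m_assoc[symmetric])
next
  case False
  then show ?thesis
    by (cases w) auto
qed

lemma free_lift_wmult:
  assumes f: "f \<in> S \<rightarrow> carrier G" and "fst ` set u \<subseteq> S" "fst ` set v \<subseteq> S"
  shows "free_lift G f (u \<star> v) = free_lift G f u \<otimes> free_lift G f v"
  using assms(2)
proof (induction u)
  case Nil
  then show ?case
    using free_lift_closed[OF f assms(3)] by simp
next
  case (Cons l u)
  obtain a b where l: "l = (a, b)"
    by (cases l)
  have "f a \<in> carrier G" "free_lift G f u \<in> carrier G" "free_lift G f v \<in> carrier G"
    using Cons.prems assms(3) f l by (auto intro: free_lift_closed[OF f])
  moreover have "free_lift G f (push (a, b) (u \<star> v)) =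
      (if b then f a else inv (f a)) \<otimes> free_lift G f (u \<star> v)"
    using Cons.prems assms(3) l by (intro free_lift_push[OF f] letters_wmult) auto
  ultimately show ?case
    using Cons l by (simp add: m_assoc)
qed

lemma free_lift_hom: "f \<in> S \<rightarrow> carrier G \<Longrightarrow> free_lift G f \<in> hom (free_group S) G"
  by (rule homI) (auto simp: free_group_simps free_lift_closed free_lift_wmult)

end

lemma gen_carrier [simp]: "gen a \<in> carrier (free_group S) \<longleftrightarrow> a \<in> S"
  by (simp add: gen_def free_group_simps)

lemma free_group_hom_unique:
  assumes "group H" "h \<in> hom (free_group S) H" "h' \<in> hom (free_group S) H"
    and "\<And>a. a \<in> S \<Longrightarrow> h (gen a) = h' (gen a)" and "w \<in> carrier (free_group S)"
  shows "h w = h' w"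
proof -
  interpret h: group_hom "free_group S" H h
    using assms group_free_group by (simp add: group_hom_def group_hom_axioms_def)
  interpret h': group_hom "free_group S" H h'
    using assms group_free_group by (simp add: group_hom_def group_hom_axioms_def)
  show ?thesis
    using assms(5)
  proof (induction w)
    case Nil
    then show ?case
      using h.hom_one h'.hom_one by (simp add: free_group_simps)
  next
    case (Cons l w)
    obtain a b where l: "l = (a, b)"
      by (cases l)
    have w: "w \<in> carrier (free_group S)" "a \<in> S"
      using Cons.prems l by (auto simp: free_group_simps reduced_Cons_iff)
    have "[l] = (if b then gen a else inv\<^bsub>free_group S\<^esub> gen a)"
      using inv_free_group[of "gen a" S] w(2) l by (simp add: gen_def free_group_simps)
    moreover have "h (inv\<^bsub>free_group S\<^esub> gen a) = h' (inv\<^bsub>free_group S\<^esub> gen a)"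
      using w(2) assms(4) h.hom_inv h'.hom_inv by (metis gen_carrier)
    ultimately have "h [l] = h' [l]"
      using assms(4) w(2) by simp
    moreover have "l # w = [l] \<otimes>\<^bsub>free_group S\<^esub> w" "[l] \<in> carrier (free_group S)"
      using Cons.prems push_eq_Cons[of l w] by (auto simp: free_group_simps)
    ultimately show ?case
      using h.hom_mult h'.hom_mult Cons.IH w(1) by metis
  qed
qed

section \<open>The groups as units of a monoid of endomorphisms\<close>

locale fnk =
  fixes n k :: nat
begin

text \<open>Index conditions are kept in the form \<open>i \<in> {1..n}\<close>, in which they are
  premises of the simplification rules below.\<close>

declare One_nat_def [simp del] atLeastAtMost_iff [simp del]

abbreviation F :: "basis word monoid" where "F \<equiv> Fnk n k"

abbreviation S :: "basis set" where "S \<equiv> GenX ` {1..n} \<union> GenY ` {1..k}"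

text \<open>All tuples under the same multiplication, whether or not \<open>alpha\<close> is
  bijective on them. The laws of this monoid can be checked without inverses, and
  \<open>A_bd n k\<close> then turns out to be its group of units.\<close>

definition E :: "((nat \<Rightarrow> basis word) \<times> (nat \<Rightarrow> basis word)) monoid" where
  "E = (A_bd n k)\<lparr>carrier := ({1..n} \<rightarrow>\<^sub>E carrier F) \<times> ({1..k} \<rightarrow>\<^sub>E carrier F)\<rparr>"

sublocale F: group F
  by (simp add: Fnk_def group_free_group)

lemma xgen_carrier [simp]: "xgen i \<in> carrier F \<longleftrightarrow> i \<in> {1..n}"
  and ygen_carrier [simp]: "ygen j \<in> carrier F \<longleftrightarrow> j \<in> {1..k}"
  by (auto simp: Fnk_def)

lemma E_carrier: "a \<in> carrier E \<longleftrightarrow> fst a \<in> {1..n} \<rightarrow>\<^sub>E carrier F \<and> snd a \<in> {1..k} \<rightarrow>\<^sub>E carrier F"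
  by (cases a) (simp add: E_def)

lemma E_closed [simp]:
  "a \<in> carrier E \<Longrightarrow> i \<in> {1..n} \<Longrightarrow> fst a i \<in> carrier F"
  "a \<in> carrier E \<Longrightarrow> j \<in> {1..k} \<Longrightarrow> snd a j \<in> carrier F"
  by (auto simp: E_carrier PiE_iff)

lemma E_eqI:
  assumes "a \<in> carrier E" "b \<in> carrier E"
    and "\<And>i. i \<in> {1..n} \<Longrightarrow> fst a i = fst b i" "\<And>j. j \<in> {1..k} \<Longrightarrow> snd a j = snd b j"
  shows "a = b"
proof (rule prod_eqI)
  show "fst a = fst b"
    by (rule PiE_ext[of _ "{1..n}" "\<lambda>_. carrier F"]) (use assms in \<open>simp_all add: E_carrier\<close>)
  show "snd a = snd b"
    by (rule PiE_ext[of _ "{1..k}" "\<lambda>_. carrier F"]) (use assms in \<open>simp_all add: E_carrier\<close>)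
qed

lemma A_bd_mult:
  "a \<otimes>\<^bsub>A_bd n k\<^esub> b =
    (\<lambda>i\<in>{1..n}. alpha n k b (fst a i), \<lambda>j\<in>{1..k}. snd b j \<otimes>\<^bsub>F\<^esub> alpha n k b (snd a j))"
  by (cases a; cases b) (simp add: A_bd_def)

lemma E_mult: "a \<otimes>\<^bsub>E\<^esub> b = a \<otimes>\<^bsub>A_bd n k\<^esub> b"
  by (simp add: E_def)

lemma fst_mult: "i \<in> {1..n} \<Longrightarrow> fst (a \<otimes>\<^bsub>A_bd n k\<^esub> b) i = alpha n k b (fst a i)"
  and snd_mult: "j \<in> {1..k} \<Longrightarrow> snd (a \<otimes>\<^bsub>A_bd n k\<^esub> b) j = snd b j \<otimes>\<^bsub>F\<^esub> alpha n k b (snd a j)"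
  by (simp_all add: A_bd_mult)

lemma A_bd_one: "\<one>\<^bsub>A_bd n k\<^esub> = (\<lambda>i\<in>{1..n}. xgen i, \<lambda>j\<in>{1..k}. \<one>\<^bsub>F\<^esub>)"
  by (simp add: A_bd_def)

lemma fst_one [simp]: "i \<in> {1..n} \<Longrightarrow> fst \<one>\<^bsub>A_bd n k\<^esub> i = xgen i"
  and snd_one [simp]: "j \<in> {1..k} \<Longrightarrow> snd \<one>\<^bsub>A_bd n k\<^esub> j = \<one>\<^bsub>F\<^esub>"
  by (simp_all add: A_bd_one)

lemma E_one: "\<one>\<^bsub>E\<^esub> = \<one>\<^bsub>A_bd n k\<^esub>"
  by (simp add: E_def)

lemma A_bd_carrier: "a \<in> carrier (A_bd n k) \<longleftrightarrow> a \<in> carrier E \<and> alpha n k a \<in> auto F"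
  by (cases a) (simp add: A_bd_def E_def)

context
  fixes a
  assumes a: "a \<in> carrier E"
begin

lemma alpha_restrict:
  "alpha n k a = restrict (free_lift F (\<lambda>b. case b of GenX i \<Rightarrow> fst a i
      | GenY j \<Rightarrow> inv\<^bsub>F\<^esub> (snd a j) \<otimes>\<^bsub>F\<^esub> ygen j \<otimes>\<^bsub>F\<^esub> snd a j)) (carrier F)"
  by (simp add: alpha_def case_prod_unfold)

lemma alpha_images:
  "(\<lambda>b. case b of GenX i \<Rightarrow> fst a i | GenY j \<Rightarrow> inv\<^bsub>F\<^esub> (snd a j) \<otimes>\<^bsub>F\<^esub> ygen j \<otimes>\<^bsub>F\<^esub> snd a j)
    \<in> S \<rightarrow> carrier F"
  using E_closed[OF a] by auto

lemma alpha_hom: "alpha n k a \<in> hom F F"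
proof -
  have "free_lift F (\<lambda>b. case b of GenX i \<Rightarrow> fst a i
      | GenY j \<Rightarrow> inv\<^bsub>F\<^esub> (snd a j) \<otimes>\<^bsub>F\<^esub> ygen j \<otimes>\<^bsub>F\<^esub> snd a j) \<in> hom F F"
    using F.free_lift_hom[OF alpha_images] by (simp flip: Fnk_def)
  then show ?thesis
    unfolding alpha_restrict by (simp add: hom_def Pi_iff)
qed

lemma alpha_closed [simp]: "v \<in> carrier F \<Longrightarrow> alpha n k a v \<in> carrier F"
  using alpha_hom by (rule hom_in_carrier)

lemma alpha_mult [simp]:
  "\<lbrakk>u \<in> carrier F; v \<in> carrier F\<rbrakk> \<Longrightarrow> alpha n k a (u \<otimes>\<^bsub>F\<^esub> v) = alpha n k a u \<otimes>\<^bsub>F\<^esub> alpha n k a v"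
  using alpha_hom by (rule hom_mult)

lemma group_hom_alpha: "group_hom F F (alpha n k a)"
  using alpha_hom by (simp add: group_hom_def group_hom_axioms_def F.is_group)

lemma alpha_one [simp]: "alpha n k a \<one>\<^bsub>F\<^esub> = \<one>\<^bsub>F\<^esub>"
  using group_hom.hom_one[OF group_hom_alpha] .

lemma alpha_inv [simp]: "v \<in> carrier F \<Longrightarrow> alpha n k a (inv\<^bsub>F\<^esub> v) = inv\<^bsub>F\<^esub> alpha n k a v"
  using group_hom.hom_inv[OF group_hom_alpha] .

lemma alpha_xgen [simp]: "i \<in> {1..n} \<Longrightarrow> alpha n k a (xgen i) = fst a i"
proof -
  assume i: "i \<in> {1..n}"
  then have "fst a i \<in> carrier F"
    using a by simp
  moreover have "xgen i \<in> carrier F"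
    using i by (simp only: xgen_carrier)
  ultimately show ?thesis
    unfolding alpha_restrict by (simp add: gen_def)
qed

lemma alpha_ygen [simp]:
  "j \<in> {1..k} \<Longrightarrow> alpha n k a (ygen j) = inv\<^bsub>F\<^esub> (snd a j) \<otimes>\<^bsub>F\<^esub> ygen j \<otimes>\<^bsub>F\<^esub> snd a j"
proof -
  assume j: "j \<in> {1..k}"
  then have "snd a j \<in> carrier F" "ygen j \<in> carrier F"
    using a by simp_all
  then show ?thesis
    unfolding alpha_restrict by (simp add: gen_def)
qed

lemma alpha_extensional: "alpha n k a \<in> extensional (carrier F)"
  unfolding alpha_restrict by simp

end

lemma F_hom_unique:
  assumes "h \<in> hom F F" "h' \<in> hom F F"
    and "\<And>i. i \<in> {1..n} \<Longrightarrow> h (xgen i) = h' (xgen i)"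
    and "\<And>j. j \<in> {1..k} \<Longrightarrow> h (ygen j) = h' (ygen j)" and "v \<in> carrier F"
  shows "h v = h' v"
proof (rule free_group_hom_unique[of F h S h'])
  show "h \<in> hom (free_group S) F" "h' \<in> hom (free_group S) F" "v \<in> carrier (free_group S)"
    using assms by (simp_all flip: Fnk_def)
qed (use assms F.is_group in auto)

lemma E_mult_closed: "\<lbrakk>a \<in> carrier E; b \<in> carrier E\<rbrakk> \<Longrightarrow> a \<otimes>\<^bsub>A_bd n k\<^esub> b \<in> carrier E"
  by (subst E_carrier) (simp add: A_bd_mult)

lemma E_one_closed: "\<one>\<^bsub>A_bd n k\<^esub> \<in> carrier E"
  by (simp add: E_carrier A_bd_one)

text \<open>On \<open>ygen j\<close> this explains the order of the factors in the second component:
  conjugating by w' alpha'(w) means conjugating by w' first, which gives alpha'(y_j), and then by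
  alpha'(w).\<close>

lemma alpha_A_mult:
  assumes a: "a \<in> carrier E" and b: "b \<in> carrier E" and v: "v \<in> carrier F"
  shows "alpha n k (a \<otimes>\<^bsub>A_bd n k\<^esub> b) v = alpha n k b (alpha n k a v)"
proof -
  have ab: "a \<otimes>\<^bsub>A_bd n k\<^esub> b \<in> carrier E"
    by (rule E_mult_closed[OF a b])
  have "alpha n k (a \<otimes>\<^bsub>A_bd n k\<^esub> b) v = (alpha n k b \<circ> alpha n k a) v"
  proof (rule F_hom_unique[of _ "alpha n k b \<circ> alpha n k a"])
    show "alpha n k b \<circ> alpha n k a \<in> hom F F"
      using alpha_hom[OF a] alpha_hom[OF b] by (rule hom_compose)
    show "alpha n k (a \<otimes>\<^bsub>A_bd n k\<^esub> b) \<in> hom F F"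
      by (rule alpha_hom[OF ab])
  next
    fix i assume "i \<in> {1..n}"
    then show "alpha n k (a \<otimes>\<^bsub>A_bd n k\<^esub> b) (xgen i) = (alpha n k b \<circ> alpha n k a) (xgen i)"
      using a b ab by (simp add: fst_mult)
  next
    fix j assume j: "j \<in> {1..k}"
    then have "snd a j \<in> carrier F" "snd b j \<in> carrier F" "ygen j \<in> carrier F"
      using a b by simp_all
    then show "alpha n k (a \<otimes>\<^bsub>A_bd n k\<^esub> b) (ygen j) = (alpha n k b \<circ> alpha n k a) (ygen j)"
      using a b ab j
      by (simp add: snd_mult F.inv_mult_group F.m_assoc)
  qed (fact v)
  then show ?thesis by simp
qed

lemma alpha_A_one: "v \<in> carrier F \<Longrightarrow> alpha n k \<one>\<^bsub>A_bd n k\<^esub> v = v"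
proof -
  assume v: "v \<in> carrier F"
  have "alpha n k \<one>\<^bsub>A_bd n k\<^esub> v = (\<lambda>v. v) v"
  proof (rule F_hom_unique[of _ "\<lambda>v. v"])
    show "alpha n k \<one>\<^bsub>A_bd n k\<^esub> \<in> hom F F"
      by (rule alpha_hom[OF E_one_closed])
    show "(\<lambda>v. v) \<in> hom F F"
      by (simp add: hom_def)
  next
    fix i assume "i \<in> {1..n}"
    then show "alpha n k \<one>\<^bsub>A_bd n k\<^esub> (xgen i) = xgen i"
      using E_one_closed by simp
  next
    fix j assume j: "j \<in> {1..k}"
    then have "ygen j \<in> carrier F" by simp
    then show "alpha n k \<one>\<^bsub>A_bd n k\<^esub> (ygen j) = ygen j"
      using E_one_closed j by simp
  qed (fact v)
  then show ?thesis by simp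
qed

lemma monoid_E: "monoid E"
proof (rule monoidI; unfold E_mult E_one)
  fix a b c assume abc: "a \<in> carrier E" "b \<in> carrier E" "c \<in> carrier E"
  show "(a \<otimes>\<^bsub>A_bd n k\<^esub> b) \<otimes>\<^bsub>A_bd n k\<^esub> c = a \<otimes>\<^bsub>A_bd n k\<^esub> (b \<otimes>\<^bsub>A_bd n k\<^esub> c)"
    by (rule E_eqI) (use abc in \<open>simp_all add: E_mult_closed fst_mult snd_mult alpha_A_mult F.m_assoc\<close>)
next
  fix a assume a: "a \<in> carrier E"
  show "\<one>\<^bsub>A_bd n k\<^esub> \<otimes>\<^bsub>A_bd n k\<^esub> a = a"
    by (rule E_eqI) (use a in \<open>simp_all add: E_mult_closed E_one_closed fst_mult snd_mult\<close>)
  show "a \<otimes>\<^bsub>A_bd n k\<^esub> \<one>\<^bsub>A_bd n k\<^esub> = a"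
    by (rule E_eqI) (use a in \<open>simp_all add: E_mult_closed E_one_closed fst_mult snd_mult alpha_A_one\<close>)
qed (simp_all add: E_mult_closed E_one_closed)

sublocale E: monoid E
  by (rule monoid_E)

text \<open>An inverse of \<open>alpha n k a\<close> as a map already yields an inverse tuple,
  because the stems of the inverse can be solved for.\<close>

lemma Units_E: "Units E = carrier (A_bd n k)"
proof
  show "Units E \<subseteq> carrier (A_bd n k)"
  proof
    fix a assume "a \<in> Units E"
    then obtain b where ab: "a \<in> carrier E" "b \<in> carrier E"
      "a \<otimes>\<^bsub>A_bd n k\<^esub> b = \<one>\<^bsub>A_bd n k\<^esub>" "b \<otimes>\<^bsub>A_bd n k\<^esub> a = \<one>\<^bsub>A_bd n k\<^esub>"
      by (auto simp: Units_def E_mult E_one)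
    have inverse: "alpha n k b (alpha n k a v) = v" "alpha n k a (alpha n k b v) = v" if "v \<in> carrier F" for v
      using alpha_A_mult[of a b v] alpha_A_mult[of b a v] ab that by (simp_all add: alpha_A_one)
    have "bij_betw (alpha n k a) (carrier F) (carrier F)"
      by (rule bij_betw_byWitness[of _ "alpha n k b"]) (use ab inverse in auto)
    then show "a \<in> carrier (A_bd n k)"
      using ab alpha_hom alpha_extensional by (simp add: A_bd_carrier auto_def Bij_def)
  qed
  show "carrier (A_bd n k) \<subseteq> Units E"
  proof
    fix a assume "a \<in> carrier (A_bd n k)"
    then have a: "a \<in> carrier E" and "alpha n k a \<in> auto F"
      by (auto simp: A_bd_carrier)
    then have bij: "bij_betw (alpha n k a) (carrier F) (carrier F)"
      by (simp add: auto_def Bij_def)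
    define \<beta> where "\<beta> = inv_into (carrier F) (alpha n k a)"
    have "restrict \<beta> (carrier F) \<in> hom F F"
      unfolding \<beta>_def using \<open>alpha n k a \<in> auto F\<close> by (intro F.restrict_inv_into_hom) (auto simp: auto_def)
    then have \<beta>_hom: "\<beta> \<in> hom F F"
      by (simp add: hom_def Pi_iff)
    have \<beta>: "\<beta> (alpha n k a v) = v" "alpha n k a (\<beta> v) = v" "\<beta> v \<in> carrier F" if "v \<in> carrier F" for v
      using bij that unfolding \<beta>_def
      by (auto simp: bij_betw_def f_inv_into_f inv_into_into)
    \<comment> \<open>The stems are forced: the product of \<open>a\<close> and \<open>b\<close> has
      the stem \<open>snd b j\<close> times \<open>\<beta> (snd a j)\<close>, which must be
      trivial.\<close>
    define b where "b = (\<lambda>i\<in>{1..n}. \<beta> (xgen i), \<lambda>j\<in>{1..k}. \<beta> (inv\<^bsub>F\<^esub> snd a j))"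
    have b: "b \<in> carrier E"
      unfolding b_def using \<beta>(3) a by (simp add: E_carrier[of "(_, _)"])
    have fst_b: "fst b i = \<beta> (xgen i)" if "i \<in> {1..n}" for i
      using that by (simp add: b_def)
    have snd_b: "snd b j = \<beta> (inv\<^bsub>F\<^esub> snd a j)" if "j \<in> {1..k}" for j
      using that by (simp add: b_def)
    interpret \<beta>: group_hom F F \<beta>
      using \<beta>_hom by (simp add: group_hom_def group_hom_axioms_def F.is_group)
    have alpha_b: "alpha n k b v = \<beta> v" if "v \<in> carrier F" for v
    proof (rule F_hom_unique[OF alpha_hom[OF b] \<beta>_hom _ _ that])
      show "alpha n k b (xgen i) = \<beta> (xgen i)" if "i \<in> {1..n}" for i
        using that b by (simp add: fst_b snd_b)
      show "alpha n k b (ygen j) = \<beta> (ygen j)" if j: "j \<in> {1..k}" for j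
      proof -
        have c: "snd a j \<in> carrier F" "ygen j \<in> carrier F"
          using a j by simp_all
        \<comment> \<open>Applying \<open>\<beta>\<close> to this equation exhibits
          \<open>\<beta> (ygen j)\<close> as the conjugate prescribed by
          \<open>snd b j\<close>.\<close>
        have "ygen j = snd a j \<otimes>\<^bsub>F\<^esub> alpha n k a (ygen j) \<otimes>\<^bsub>F\<^esub> inv\<^bsub>F\<^esub> snd a j"
          using a c j by (simp add: F.m_assoc F.inv_solve_left')
            (simp flip: F.m_assoc)
        then have "\<beta> (ygen j) = \<beta> (snd a j) \<otimes>\<^bsub>F\<^esub> ygen j \<otimes>\<^bsub>F\<^esub> inv\<^bsub>F\<^esub> \<beta> (snd a j)"
          using a c \<beta>(1)[OF c(2)] \<beta>.hom_mult \<beta>.hom_inv by (metis F.inv_closed F.m_closed alpha_closed)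
        then show ?thesis
          using b c j by (simp add: fst_b snd_b)
      qed
    qed
    have "a \<otimes>\<^bsub>A_bd n k\<^esub> b = \<one>\<^bsub>A_bd n k\<^esub>"
    proof (rule E_eqI[OF E_mult_closed[OF a b] E_one_closed])
      show "fst (a \<otimes>\<^bsub>A_bd n k\<^esub> b) i = fst \<one>\<^bsub>A_bd n k\<^esub> i" if i: "i \<in> {1..n}" for i
        using a b i \<beta>(1)[of "xgen i"] by (simp add: fst_mult alpha_b)
      show "snd (a \<otimes>\<^bsub>A_bd n k\<^esub> b) j = snd \<one>\<^bsub>A_bd n k\<^esub> j" if j: "j \<in> {1..k}" for j
        using a b j by (simp add: snd_mult alpha_b snd_b \<beta>(3))
    qed
    moreover have "b \<otimes>\<^bsub>A_bd n k\<^esub> a = \<one>\<^bsub>A_bd n k\<^esub>"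
    proof (rule E_eqI[OF E_mult_closed[OF b a] E_one_closed])
      show "fst (b \<otimes>\<^bsub>A_bd n k\<^esub> a) i = fst \<one>\<^bsub>A_bd n k\<^esub> i" if i: "i \<in> {1..n}" for i
        using a b i \<beta>(2)[of "xgen i"] by (simp add: fst_mult fst_b)
      show "snd (b \<otimes>\<^bsub>A_bd n k\<^esub> a) j = snd \<one>\<^bsub>A_bd n k\<^esub> j" if j: "j \<in> {1..k}" for j
        using a b j by (simp add: snd_mult snd_b \<beta>(2) del: \<beta>.hom_inv)
    qed
    ultimately show "a \<in> Units E"
      using a b by (auto simp: Units_def E_mult E_one)
  qed
qed

lemma A_bd_eq: "A_bd n k = units_of E"
  unfolding units_of_def Units_E E_one by (simp add: E_def)

lemma group_A_bd: "group (A_bd n k)"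
  unfolding A_bd_eq by (rule E.units_group)

sublocale A: group "A_bd n k"
  by (rule group_A_bd)

lemma A_bd_E [simp]: "a \<in> carrier (A_bd n k) \<Longrightarrow> a \<in> carrier E"
  by (simp add: A_bd_carrier)

lemma A_bdI:
  assumes "a \<in> carrier E" "b \<in> carrier E"
    "a \<otimes>\<^bsub>A_bd n k\<^esub> b = \<one>\<^bsub>A_bd n k\<^esub>" "b \<otimes>\<^bsub>A_bd n k\<^esub> a = \<one>\<^bsub>A_bd n k\<^esub>"
  shows "a \<in> carrier (A_bd n k)"
  using assms Units_E by (auto simp: Units_def E_mult E_one)

section \<open>The surjection between the two groups\<close>

lemma A_sym_carrier:
  "carrier (A_sym n k) = {\<phi> \<in> auto F. \<forall>j\<in>{1..k}. \<exists>g\<in>carrier F.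
    \<phi> (ygen j) = inv\<^bsub>F\<^esub> g \<otimes>\<^bsub>F\<^esub> ygen j \<otimes>\<^bsub>F\<^esub> g}"
  by (simp add: A_sym_def)

lemma A_sym_mult:
  "\<lbrakk>\<phi> \<in> auto F; \<psi> \<in> auto F\<rbrakk> \<Longrightarrow> \<phi> \<otimes>\<^bsub>A_sym n k\<^esub> \<psi> = compose (carrier F) \<phi> \<psi>"
  by (simp add: A_sym_def AutoGroup_def BijGroup_def auto_def)

text \<open>Surjectivity is a choice of conjugators, one for each circle. They are not unique: this
  is the information that \<open>alpha\<close> forgets.\<close>

lemma alpha_image: "alpha n k ` carrier (A_bd n k) = carrier (A_sym n k)"
proof
  show "alpha n k ` carrier (A_bd n k) \<subseteq> carrier (A_sym n k)"
  proof
    fix \<phi> assume "\<phi> \<in> alpha n k ` carrier (A_bd n k)"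
    then obtain a where a: "\<phi> = alpha n k a" "a \<in> carrier E" "alpha n k a \<in> auto F"
      by (auto simp: A_bd_carrier)
    moreover have "\<exists>g\<in>carrier F. \<phi> (ygen j) = inv\<^bsub>F\<^esub> g \<otimes>\<^bsub>F\<^esub> ygen j \<otimes>\<^bsub>F\<^esub> g" if "j \<in> {1..k}" for j
      using a that by (intro bexI[of _ "snd a j"]) (simp_all)
    ultimately show "\<phi> \<in> carrier (A_sym n k)"
      unfolding A_sym_carrier by blast
  qed
  show "carrier (A_sym n k) \<subseteq> alpha n k ` carrier (A_bd n k)"
  proof
    fix \<phi> assume "\<phi> \<in> carrier (A_sym n k)"
    then have \<phi>: "\<phi> \<in> auto F"
      and "\<forall>j\<in>{1..k}. \<exists>g. g \<in> carrier F \<and> \<phi> (ygen j) = inv\<^bsub>F\<^esub> g \<otimes>\<^bsub>F\<^esub> ygen j \<otimes>\<^bsub>F\<^esub> g"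
      unfolding A_sym_carrier by blast+
    then obtain w where w: "\<And>j. j \<in> {1..k} \<Longrightarrow> w j \<in> carrier F \<and>
        \<phi> (ygen j) = inv\<^bsub>F\<^esub> (w j) \<otimes>\<^bsub>F\<^esub> ygen j \<otimes>\<^bsub>F\<^esub> w j"
      by metis
    have hom: "\<phi> \<in> hom F F" and ext: "\<phi> \<in> extensional (carrier F)"
      using \<phi> by (auto simp: auto_def Bij_def)
    define a where "a = (\<lambda>i\<in>{1..n}. \<phi> (xgen i), \<lambda>j\<in>{1..k}. w j)"
    have a: "a \<in> carrier E"
      unfolding a_def using w hom by (simp add: E_carrier[of "(_, _)"] hom_in_carrier)
    have ax: "fst a i = \<phi> (xgen i)" if "i \<in> {1..n}" for i
      using that by (simp add: a_def)
    have ay: "snd a j = w j" if "j \<in> {1..k}" for j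
      using that by (simp add: a_def)
    have "alpha n k a v = \<phi> v" if "v \<in> carrier F" for v
      by (rule F_hom_unique[OF alpha_hom[OF a] hom _ _ that])
        (use a w in \<open>simp_all add: ax ay\<close>)
    then have "alpha n k a = \<phi>"
      using alpha_extensional[OF a] ext by (rule extensionalityI[rotated 2])
    then show "\<phi> \<in> alpha n k ` carrier (A_bd n k)"
      using a \<phi> by (auto simp: A_bd_carrier)
  qed
qed

lemma alpha_anti_hom:
  assumes "a \<in> carrier (A_bd n k)" "b \<in> carrier (A_bd n k)"
  shows "alpha n k (a \<otimes>\<^bsub>A_bd n k\<^esub> b) = alpha n k b \<otimes>\<^bsub>A_sym n k\<^esub> alpha n k a"
proof -
  have "alpha n k (a \<otimes>\<^bsub>A_bd n k\<^esub> b) = compose (carrier F) (alpha n k b) (alpha n k a)"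
    using assms by (intro extensionalityI[OF alpha_extensional])
      (auto simp: compose_eq alpha_A_mult E_mult_closed)
  then show ?thesis
    using assms by (simp add: A_sym_mult A_bd_carrier)
qed

lemma alpha_A_bd_one: "alpha n k \<one>\<^bsub>A_bd n k\<^esub> = \<one>\<^bsub>A_sym n k\<^esub>"
  by (rule extensionalityI[OF alpha_extensional])
    (auto simp: E_one_closed A_sym_def AutoGroup_def BijGroup_def alpha_A_one)

text \<open>Closure under products and inverses is carried over from \<open>A_bd n k\<close> along
  \<open>alpha\<close>; associativity and the unit law come from \<open>AutoGroup F\<close>.\<close>

lemma group_A_sym: "group (A_sym n k)"
proof -
  interpret Aut: group "AutoGroup F"
    by (rule F.AutoGroup)
  have mem: "alpha n k a \<in> carrier (A_sym n k)" if "a \<in> carrier (A_bd n k)" for a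
    using that alpha_image by blast
  show ?thesis
  proof (rule groupI)
    fix \<phi> \<psi> \<chi> assume "\<phi> \<in> carrier (A_sym n k)" "\<psi> \<in> carrier (A_sym n k)" "\<chi> \<in> carrier (A_sym n k)"
    then show "\<phi> \<otimes>\<^bsub>A_sym n k\<^esub> \<psi> \<otimes>\<^bsub>A_sym n k\<^esub> \<chi> = \<phi> \<otimes>\<^bsub>A_sym n k\<^esub> (\<psi> \<otimes>\<^bsub>A_sym n k\<^esub> \<chi>)"
      using Aut.m_assoc by (simp add: A_sym_def AutoGroup_def)
  next
    fix \<phi> \<psi> assume "\<phi> \<in> carrier (A_sym n k)" "\<psi> \<in> carrier (A_sym n k)"
    then show "\<phi> \<otimes>\<^bsub>A_sym n k\<^esub> \<psi> \<in> carrier (A_sym n k)"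
      unfolding alpha_image[symmetric] using alpha_anti_hom A.m_closed by (auto simp flip: alpha_anti_hom)
  next
    show "\<one>\<^bsub>A_sym n k\<^esub> \<in> carrier (A_sym n k)"
      using mem[OF A.one_closed] alpha_A_bd_one by simp
  next
    fix \<phi> assume \<phi>: "\<phi> \<in> carrier (A_sym n k)"
    then show "\<one>\<^bsub>A_sym n k\<^esub> \<otimes>\<^bsub>A_sym n k\<^esub> \<phi> = \<phi>"
      using Aut.l_one by (simp add: A_sym_def AutoGroup_def)
    obtain a where a: "a \<in> carrier (A_bd n k)" "\<phi> = alpha n k a"
      using \<phi> alpha_image by blast
    then have "alpha n k (inv\<^bsub>A_bd n k\<^esub> a) \<otimes>\<^bsub>A_sym n k\<^esub> \<phi> = \<one>\<^bsub>A_sym n k\<^esub>"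
      using alpha_anti_hom[of a "inv\<^bsub>A_bd n k\<^esub> a"] by (simp add: alpha_A_bd_one)
    then show "\<exists>\<psi>\<in>carrier (A_sym n k). \<psi> \<otimes>\<^bsub>A_sym n k\<^esub> \<phi> = \<one>\<^bsub>A_sym n k\<^esub>"
      using mem a(1) by blast
  qed
qed

end

section \<open>Elementary moves\<close>

context fnk
begin

definition right_mv :: "nat \<Rightarrow> basis word \<Rightarrow> (nat \<Rightarrow> basis word) \<times> (nat \<Rightarrow> basis word)" where
  "right_mv i g = (\<lambda>i'\<in>{1..n}. if i' = i then xgen i \<otimes>\<^bsub>F\<^esub> g else xgen i', \<lambda>j\<in>{1..k}. \<one>\<^bsub>F\<^esub>)"

definition left_mv :: "nat \<Rightarrow> basis word \<Rightarrow> (nat \<Rightarrow> basis word) \<times> (nat \<Rightarrow> basis word)" where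
  "left_mv i g = (\<lambda>i'\<in>{1..n}. if i' = i then g \<otimes>\<^bsub>F\<^esub> xgen i else xgen i', \<lambda>j\<in>{1..k}. \<one>\<^bsub>F\<^esub>)"

definition conj_mv :: "nat \<Rightarrow> basis word \<Rightarrow> (nat \<Rightarrow> basis word) \<times> (nat \<Rightarrow> basis word)" where
  "conj_mv j g = (\<lambda>i\<in>{1..n}. xgen i, \<lambda>j'\<in>{1..k}. if j' = j then g else \<one>\<^bsub>F\<^esub>)"

lemma mv_simps [simp]:
  "i' \<in> {1..n} \<Longrightarrow> fst (right_mv i g) i' = (if i' = i then xgen i \<otimes>\<^bsub>F\<^esub> g else xgen i')"
  "i' \<in> {1..n} \<Longrightarrow> fst (left_mv i g) i' = (if i' = i then g \<otimes>\<^bsub>F\<^esub> xgen i else xgen i')"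
  "i' \<in> {1..n} \<Longrightarrow> fst (conj_mv j g) i' = xgen i'"
  "j' \<in> {1..k} \<Longrightarrow> snd (right_mv i g) j' = \<one>\<^bsub>F\<^esub>"
  "j' \<in> {1..k} \<Longrightarrow> snd (left_mv i g) j' = \<one>\<^bsub>F\<^esub>"
  "j' \<in> {1..k} \<Longrightarrow> snd (conj_mv j g) j' = (if j' = j then g else \<one>\<^bsub>F\<^esub>)"
  by (simp_all add: right_mv_def left_mv_def conj_mv_def)

lemma mv_E [simp]:
  "\<lbrakk>i \<in> {1..n}; g \<in> carrier F\<rbrakk> \<Longrightarrow> right_mv i g \<in> carrier E"
  "\<lbrakk>i \<in> {1..n}; g \<in> carrier F\<rbrakk> \<Longrightarrow> left_mv i g \<in> carrier E"
  "g \<in> carrier F \<Longrightarrow> conj_mv j g \<in> carrier E"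
  by (auto simp: E_carrier right_mv_def left_mv_def conj_mv_def)

lemma letter_eq: "b \<in> S \<Longrightarrow> [(b, \<epsilon>)] = (if \<epsilon> then gen b else inv\<^bsub>F\<^esub> gen b)"
proof -
  assume "b \<in> S"
  then have "inv\<^bsub>F\<^esub> gen b = winv (gen b)"
    unfolding Fnk_def by (intro inv_free_group) simp
  then show ?thesis
    by (simp add: gen_def)
qed

lemma letter_cases:
  assumes "b \<in> S"
  obtains i where "i \<in> {1..n}" "b = GenX i" "[(b, \<epsilon>)] = (if \<epsilon> then xgen i else inv\<^bsub>F\<^esub> xgen i)"
    | j where "j \<in> {1..k}" "b = GenY j" "[(b, \<epsilon>)] = (if \<epsilon> then ygen j else inv\<^bsub>F\<^esub> ygen j)"
  using assms that letter_eq[OF assms] by blast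

lemma letter_carrier [simp]: "[(b, \<epsilon>)] \<in> carrier F \<longleftrightarrow> b \<in> S"
  by (auto simp: Fnk_def free_group_simps)

lemma inv_letter [simp]: "b \<in> S \<Longrightarrow> inv\<^bsub>F\<^esub> [(b, \<epsilon>)] = [(b, \<not> \<epsilon>)]"
  using inv_free_group[of "[(b, \<epsilon>)]" S] by (simp add: Fnk_def free_group_simps)

lemma F_cancel [simp]:
  "\<lbrakk>x \<in> carrier F; y \<in> carrier F\<rbrakk> \<Longrightarrow> x \<otimes>\<^bsub>F\<^esub> (inv\<^bsub>F\<^esub> x \<otimes>\<^bsub>F\<^esub> y) = y"
  "\<lbrakk>x \<in> carrier F; y \<in> carrier F\<rbrakk> \<Longrightarrow> inv\<^bsub>F\<^esub> x \<otimes>\<^bsub>F\<^esub> (x \<otimes>\<^bsub>F\<^esub> y) = y"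
  by (simp_all add: F.m_assoc[symmetric])

lemma letter_cancel:
  assumes "b \<in> S"
  shows "u \<in> carrier F \<Longrightarrow> u \<otimes>\<^bsub>F\<^esub> [(b, \<delta>)] \<otimes>\<^bsub>F\<^esub> [(b, \<not> \<delta>)] = u"
    "u \<in> carrier F \<Longrightarrow> [(b, \<delta>)] \<otimes>\<^bsub>F\<^esub> ([(b, \<not> \<delta>)] \<otimes>\<^bsub>F\<^esub> u) = u"
    "[(b, \<delta>)] \<otimes>\<^bsub>F\<^esub> [(b, \<not> \<delta>)] = \<one>\<^bsub>F\<^esub>"
proof -
  have c: "[(b, \<delta>)] \<in> carrier F"
    using assms by simp
  show "u \<otimes>\<^bsub>F\<^esub> [(b, \<delta>)] \<otimes>\<^bsub>F\<^esub> [(b, \<not> \<delta>)] = u"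
    "[(b, \<delta>)] \<otimes>\<^bsub>F\<^esub> ([(b, \<not> \<delta>)] \<otimes>\<^bsub>F\<^esub> u) = u" if "u \<in> carrier F"
    unfolding inv_letter[OF assms, symmetric]
    using c that by (simp_all only: F.m_assoc F.inv_closed F_cancel F.r_inv F.r_one)
  show "[(b, \<delta>)] \<otimes>\<^bsub>F\<^esub> [(b, \<not> \<delta>)] = \<one>\<^bsub>F\<^esub>"
    unfolding inv_letter[OF assms, symmetric] using c by (rule F.r_inv)
qed

lemma alpha_mv [simp]:
  "\<lbrakk>i \<in> {1..n}; g \<in> carrier F; b \<in> S; b \<noteq> GenX i\<rbrakk> \<Longrightarrow> alpha n k (right_mv i g) [(b, \<epsilon>)] = [(b, \<epsilon>)]"
  "\<lbrakk>i \<in> {1..n}; g \<in> carrier F; b \<in> S; b \<noteq> GenX i\<rbrakk> \<Longrightarrow> alpha n k (left_mv i g) [(b, \<epsilon>)] = [(b, \<epsilon>)]"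
  "\<lbrakk>g \<in> carrier F; b \<in> S; b \<noteq> GenY j\<rbrakk> \<Longrightarrow> alpha n k (conj_mv j g) [(b, \<epsilon>)] = [(b, \<epsilon>)]"
  by (rule letter_cases[of b \<epsilon>]; (assumption | simp split: if_splits); fail)+

text \<open>A letter commutes with its inverse and itself. Hence the twist along a circle is
  invisible to \<open>alpha\<close> although it is a nontrivial element of
  \<open>A_bd n k\<close>.\<close>

lemma alpha_twist [simp]:
  assumes "j \<in> {1..k}"
  shows "alpha n k (conj_mv j [(GenY j, \<delta>)]) [(GenY j, \<epsilon>)] = [(GenY j, \<epsilon>)]"
proof -
  have j: "GenY j \<in> S" "[(GenY j, True)] = ygen j"
    using assms by (auto simp: gen_def)
  then have c: "ygen j \<in> carrier F" "[(GenY j, \<delta>)] \<in> carrier F"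
    using assms by simp_all
  have comm: "ygen j \<otimes>\<^bsub>F\<^esub> [(GenY j, \<delta>)] = [(GenY j, \<delta>)] \<otimes>\<^bsub>F\<^esub> ygen j"
    unfolding letter_eq[OF j(1), of \<delta>] using c(1) by simp
  have "alpha n k (conj_mv j [(GenY j, \<delta>)]) (ygen j) = ygen j"
    using assms c comm by (simp add: F.m_assoc del: inv_letter)
  then show ?thesis
    unfolding letter_eq[OF j(1), of \<epsilon>] using c mv_E(3)[OF c(2), of j] by (simp del: alpha_ygen)
qed

lemma mv_A_bd [simp]:
  "\<lbrakk>i \<in> {1..n}; b \<in> S; b \<noteq> GenX i\<rbrakk> \<Longrightarrow> right_mv i [(b, \<epsilon>)] \<in> carrier (A_bd n k)"
  "\<lbrakk>i \<in> {1..n}; b \<in> S; b \<noteq> GenX i\<rbrakk> \<Longrightarrow> left_mv i [(b, \<epsilon>)] \<in> carrier (A_bd n k)"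
  "\<lbrakk>j \<in> {1..k}; b \<in> S\<rbrakk> \<Longrightarrow> conj_mv j [(b, \<epsilon>)] \<in> carrier (A_bd n k)"
proof -
  note cancel = letter_cancel[where b = b and \<delta> = \<epsilon>] letter_cancel[where b = b and \<delta> = "\<not> \<epsilon>"]
  show "right_mv i [(b, \<epsilon>)] \<in> carrier (A_bd n k)" if "i \<in> {1..n}" "b \<in> S" "b \<noteq> GenX i"
    by (rule A_bdI[of _ "right_mv i [(b, \<not> \<epsilon>)]"]; (rule E_eqI)?)
      (use that cancel in
        \<open>simp_all add: fst_mult snd_mult E_mult_closed E_one_closed\<close>)
  show "left_mv i [(b, \<epsilon>)] \<in> carrier (A_bd n k)" if "i \<in> {1..n}" "b \<in> S" "b \<noteq> GenX i"
    by (rule A_bdI[of _ "left_mv i [(b, \<not> \<epsilon>)]"]; (rule E_eqI)?)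
      (use that cancel in
        \<open>simp_all add: fst_mult snd_mult E_mult_closed E_one_closed\<close>)
  have fixed: "alpha n k (conj_mv j [(b, \<delta>)]) [(b, \<delta>')] = [(b, \<delta>')]"
    if "j \<in> {1..k}" "b \<in> S" for \<delta> \<delta>'
    using that by (cases "b = GenY j") simp_all
  show "conj_mv j [(b, \<epsilon>)] \<in> carrier (A_bd n k)" if "j \<in> {1..k}" "b \<in> S"
    by (rule A_bdI[of _ "conj_mv j [(b, \<not> \<epsilon>)]"]; (rule E_eqI)?)
      (use that cancel in
        \<open>simp_all add: fst_mult snd_mult E_mult_closed E_one_closed fixed\<close>)
qed

text \<open>Because \<open>alpha\<close> reverses products, a move has to be multiplied from the
  left in order to act on the entries of \<open>a\<close>. For a letter \<open>g\<close>, its image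
  under \<open>alpha n k a\<close> is an entry, the inverse of one, or a conjugate of a circle
  letter, so these are Nielsen transformations.\<close>

lemma right_mv_mult:
  assumes "a \<in> carrier E" "i \<in> {1..n}" "g \<in> carrier F"
  shows "i' \<in> {1..n} \<Longrightarrow> fst (right_mv i g \<otimes>\<^bsub>A_bd n k\<^esub> a) i' =
      (if i' = i then fst a i \<otimes>\<^bsub>F\<^esub> alpha n k a g else fst a i')"
    "j \<in> {1..k} \<Longrightarrow> snd (right_mv i g \<otimes>\<^bsub>A_bd n k\<^esub> a) j = snd a j"
  using assms by (simp_all add: fst_mult snd_mult)

lemma left_mv_mult:
  assumes "a \<in> carrier E" "i \<in> {1..n}" "g \<in> carrier F"
  shows "i' \<in> {1..n} \<Longrightarrow> fst (left_mv i g \<otimes>\<^bsub>A_bd n k\<^esub> a) i' =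
      (if i' = i then alpha n k a g \<otimes>\<^bsub>F\<^esub> fst a i else fst a i')"
    "j \<in> {1..k} \<Longrightarrow> snd (left_mv i g \<otimes>\<^bsub>A_bd n k\<^esub> a) j = snd a j"
  using assms by (simp_all add: fst_mult snd_mult)

lemma conj_mv_mult:
  assumes "a \<in> carrier E" "g \<in> carrier F"
  shows "i \<in> {1..n} \<Longrightarrow> fst (conj_mv j g \<otimes>\<^bsub>A_bd n k\<^esub> a) i = fst a i"
    "j' \<in> {1..k} \<Longrightarrow> snd (conj_mv j g \<otimes>\<^bsub>A_bd n k\<^esub> a) j' =
      (if j' = j then snd a j \<otimes>\<^bsub>F\<^esub> alpha n k a g else snd a j')"
  using assms by (simp_all add: fst_mult snd_mult)

end

section \<open>Homomorphisms to abelian groups are trivial on the elementary moves\<close>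

locale fnk_hom = fnk + H: comm_group H for H (structure) +
  fixes f
  assumes f_hom: "f \<in> hom (A_bd n k) H" and n_gt_2: "n > 2"
begin

sublocale f: group_hom "A_bd n k" H f
  using f_hom by unfold_locales

text \<open>The equation makes \<open>c\<close> the commutator of \<open>a\<close> and
  \<open>b\<close>, written without inverses so that it can be verified entry by entry.\<close>

lemma hom_eq_one:
  assumes "a \<in> carrier (A_bd n k)" "b \<in> carrier (A_bd n k)" "c \<in> carrier (A_bd n k)"
    and "c \<otimes>\<^bsub>A_bd n k\<^esub> (b \<otimes>\<^bsub>A_bd n k\<^esub> a) = a \<otimes>\<^bsub>A_bd n k\<^esub> b"
  shows "f c = \<one>"
proof -
  have c: "f a \<in> carrier H" "f b \<in> carrier H" "f c \<in> carrier H"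
    using assms by simp_all
  have "f c \<otimes> (f b \<otimes> f a) = f (c \<otimes>\<^bsub>A_bd n k\<^esub> (b \<otimes>\<^bsub>A_bd n k\<^esub> a))"
    using assms(1-3) by simp
  also have "\<dots> = f b \<otimes> f a"
    unfolding assms(4) using assms(1,2) c by (simp add: H.m_comm)
  finally show ?thesis
    using c by simp
qed

text \<open>Room for an auxiliary generator besides x_i and the letter of the move: this is where
  \<open>n > 2\<close> enters the commutator identities.\<close>

lemma third_index:
  obtains m where "m \<in> {1..n}" "m \<noteq> i" "GenX m \<noteq> b"
proof -
  define l where "l = (case b of GenX l \<Rightarrow> l | GenY _ \<Rightarrow> i)"
  have "card {i, l} < card {1..n}"
    using n_gt_2 by (simp add: card_insert_if)
  then have "\<not> {1..n} \<subseteq> {i, l}"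
    using card_mono[of "{i, l}" "{1..n}"] by auto
  then obtain m where "m \<in> {1..n}" "m \<noteq> i" "m \<noteq> l"
    by blast
  then show ?thesis
    using that by (auto simp: l_def split: basis.splits)
qed

text \<open>With g the given letter, the move is the commutator of x_i -> x_i x_m and x_m -> x_m g.
  The left moves below are treated by the mirror image of this identity.\<close>

lemma f_right_mv:
  assumes i: "i \<in> {1..n}" and b: "b \<in> S" "b \<noteq> GenX i"
  shows "f (right_mv i [(b, \<epsilon>)]) = \<one>"
proof -
  obtain m where m: "m \<in> {1..n}" "m \<noteq> i" "GenX m \<noteq> b"
    using third_index .
  have x: "xgen m = [(GenX m, True)]" "xgen m \<in> carrier F" "GenX m \<in> S" "xgen i \<in> carrier F"
    "[(b, \<epsilon>)] \<in> carrier F"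
    using m i b by (auto simp: gen_def)
  have mv: "right_mv i (xgen m) \<in> carrier (A_bd n k)"
    unfolding x(1) using i m x(3) by simp
  show ?thesis
    by (rule hom_eq_one[of "right_mv i (xgen m)" "right_mv m [(b, \<epsilon>)]"]; (rule E_eqI)?)
      (use i b m x(2-) mv in \<open>simp_all add: fst_mult snd_mult E_mult_closed alpha_A_mult F.m_assoc\<close>)
qed

lemma f_left_mv:
  assumes i: "i \<in> {1..n}" and b: "b \<in> S" "b \<noteq> GenX i"
  shows "f (left_mv i [(b, \<epsilon>)]) = \<one>"
proof -
  obtain m where m: "m \<in> {1..n}" "m \<noteq> i" "GenX m \<noteq> b"
    using third_index .
  have x: "xgen m = [(GenX m, True)]" "xgen m \<in> carrier F" "GenX m \<in> S" "xgen i \<in> carrier F"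
    "[(b, \<epsilon>)] \<in> carrier F"
    using m i b by (auto simp: gen_def)
  have mv: "left_mv i (xgen m) \<in> carrier (A_bd n k)"
    unfolding x(1) using i m x(3) by simp
  show ?thesis
    by (rule hom_eq_one[of "left_mv i (xgen m)" "left_mv m [(b, \<epsilon>)]"]; (rule E_eqI)?)
      (use i b m x(2-) mv in \<open>simp_all add: fst_mult snd_mult E_mult_closed alpha_A_mult F.m_assoc\<close>)
qed

text \<open>The commutator of the move of the stem by x_m with x_m -> x_m g, where g is the given
  letter. The move of the stem has to fix g, hence the exclusion of y_j.\<close>

lemma f_conj_mv:
  assumes j: "j \<in> {1..k}" and b: "b \<in> S" "b \<noteq> GenY j"
  shows "f (conj_mv j [(b, \<epsilon>)]) = \<one>"
proof -
  obtain m where m: "m \<in> {1..n}" "GenX m \<noteq> b"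
    using third_index .
  have x: "xgen m = [(GenX m, True)]" "xgen m \<in> carrier F" "GenX m \<in> S" "[(b, \<epsilon>)] \<in> carrier F"
    using m b by (auto simp: gen_def)
  have mv: "conj_mv j (xgen m) \<in> carrier (A_bd n k)"
    unfolding x(1) using j m x(3) by simp
  show ?thesis
    by (rule hom_eq_one[of "conj_mv j (xgen m)" "right_mv m [(b, \<epsilon>)]"]; (rule E_eqI)?)
      (use j b m x(2-) mv in \<open>simp_all add: fst_mult snd_mult E_mult_closed alpha_A_mult F.m_assoc\<close>)
qed

text \<open>Conjugating the circle \<open>C\<^sub>j\<close> by \<open>x\<^sub>m\<close> turns the right transvection of \<open>x\<^sub>m\<close> by \<open>y\<^sub>j\<close> into
  the left one, up to the twist along \<open>C\<^sub>j\<close>.\<close>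

lemma f_twist:
  assumes j: "j \<in> {1..k}"
  shows "f (conj_mv j [(GenY j, \<epsilon>)]) = \<one>"
proof -
  obtain m where m: "m \<in> {1..n}"
    using third_index .
  have x: "xgen m = [(GenX m, True)]" "xgen m \<in> carrier F" "GenX m \<in> S"
    and y: "GenY j \<in> S" "[(GenY j, \<epsilon>)] \<in> carrier F"
    using m j by (auto simp: gen_def)
  define a where "a = conj_mv j (xgen m)"
  define b where "b = right_mv m [(GenY j, \<epsilon>)]"
  define l where "l = left_mv m [(GenY j, \<epsilon>)]"
  define t where "t = conj_mv j [(GenY j, \<epsilon>)]"
  have A: "a \<in> carrier (A_bd n k)" "b \<in> carrier (A_bd n k)" "l \<in> carrier (A_bd n k)" "t \<in> carrier (A_bd n k)"
    using m j x(3) y(1) by (simp_all add: a_def b_def l_def t_def x(1))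
  have "a \<in> carrier E" "ygen j \<in> carrier F" "snd a j = xgen m"
    using j A by (simp_all add: a_def)
  then have conj: "alpha n k a [(GenY j, \<epsilon>)] = inv\<^bsub>F\<^esub> xgen m \<otimes>\<^bsub>F\<^esub> ([(GenY j, \<epsilon>)] \<otimes>\<^bsub>F\<^esub> xgen m)"
    unfolding letter_eq[OF y(1), of \<epsilon>] using x(2) j
    by (simp add: F.inv_mult_group F.m_assoc)
  have fixed: "alpha n k b [(GenY j, \<epsilon>)] = [(GenY j, \<epsilon>)]"
    using m y by (simp add: b_def)
  have vals: "i \<in> {1..n} \<Longrightarrow> fst a i = xgen i" "i \<in> {1..n} \<Longrightarrow> fst t i = xgen i"
    "i \<in> {1..n} \<Longrightarrow> fst b i = (if i = m then xgen i \<otimes>\<^bsub>F\<^esub> [(GenY j, \<epsilon>)] else xgen i)"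
    "i \<in> {1..n} \<Longrightarrow> fst l i = (if i = m then [(GenY j, \<epsilon>)] \<otimes>\<^bsub>F\<^esub> xgen i else xgen i)"
    "i' \<in> {1..k} \<Longrightarrow> snd a i' = (if i' = j then xgen m else \<one>\<^bsub>F\<^esub>)"
    "i' \<in> {1..k} \<Longrightarrow> snd t i' = (if i' = j then [(GenY j, \<epsilon>)] else \<one>\<^bsub>F\<^esub>)"
    "i' \<in> {1..k} \<Longrightarrow> snd b i' = \<one>\<^bsub>F\<^esub>" "i' \<in> {1..k} \<Longrightarrow> snd l i' = \<one>\<^bsub>F\<^esub>" for i i'
    by (simp_all add: a_def b_def l_def t_def)
  \<comment> \<open>On both sides the entry at x_m and the stem of C_j become the given power of y_j
    followed by x_m.\<close>
  have "t \<otimes>\<^bsub>A_bd n k\<^esub> (b \<otimes>\<^bsub>A_bd n k\<^esub> a) = a \<otimes>\<^bsub>A_bd n k\<^esub> l"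
    by (rule E_eqI) (use A m x(2) y(2) conj fixed in
      \<open>simp_all add: fst_mult snd_mult alpha_A_mult E_mult_closed vals F.m_assoc\<close>)
  then have "f t \<otimes> (f b \<otimes> f a) = f a \<otimes> f l"
    using A by (metis A.m_closed f.hom_mult)
  moreover have "f b = \<one>" "f l = \<one>"
    using f_right_mv[OF m, of "GenY j"] f_left_mv[OF m, of "GenY j"] y by (auto simp: b_def l_def)
  ultimately show ?thesis
    using A by (simp add: t_def)
qed

lemma f_conj_mv':
  assumes "j \<in> {1..k}" "b \<in> S"
  shows "f (conj_mv j [(b, \<epsilon>)]) = \<one>"
  using assms f_conj_mv f_twist by (cases "b = GenY j") auto

end

section \<open>First homology\<close>

lemma comm_group_integer_mod_group: "comm_group (integer_mod_group m)"
  by (rule group.group_comm_groupI) (simp_all add: add.commute)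

lemma free_Abelian_group_hom_trivial:
  assumes "h \<in> hom (free_Abelian_group S) K" "group K" "\<And>a. a \<in> S \<Longrightarrow> h (frag_of a) = \<one>\<^bsub>K\<^esub>"
    and "Poly_Mapping.keys x \<subseteq> S"
  shows "h x = \<one>\<^bsub>K\<^esub>"
proof -
  interpret group_hom "free_Abelian_group S" K h
    using assms(1,2) by (simp add: group_hom_def group_hom_axioms_def)
  show ?thesis
  proof (rule free_Abelian_group_induct[OF assms(4), of "\<lambda>x. h x = \<one>\<^bsub>K\<^esub>"])
    fix x y assume xy: "Poly_Mapping.keys x \<subseteq> S" "Poly_Mapping.keys y \<subseteq> S" "h x = \<one>\<^bsub>K\<^esub>" "h y = \<one>\<^bsub>K\<^esub>"
    then have "x \<in> carrier (free_Abelian_group S)" "y \<in> carrier (free_Abelian_group S)"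
      by simp_all
    then have "h (x \<otimes>\<^bsub>free_Abelian_group S\<^esub> inv\<^bsub>free_Abelian_group S\<^esub> y) = h x \<otimes>\<^bsub>K\<^esub> inv\<^bsub>K\<^esub> h y"
      by (metis G.inv_closed hom_inv hom_mult)
    with xy show "h (x - y) = \<one>\<^bsub>K\<^esub>"
      by simp
  qed (use assms(3) hom_one in simp_all)
qed

section \<open>Degree one of the bar complex\<close>

locale bar_one = group G for G (structure)
begin

declare One_nat_def [simp del]

abbreviation "C1 \<equiv> bar_chain_group G 1"
abbreviation "C2 \<equiv> bar_chain_group G 2"
abbreviation "B1 \<equiv> bar_boundaries G 1"

lemma C1_eq: "C1 = free_Abelian_group ((\<lambda>g. [g]) ` carrier G)"
proof -
  have "{gs. length gs = 1 \<and> set gs \<subseteq> carrier G} = (\<lambda>g. [g]) ` carrier G"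
    by (auto simp: length_Suc_conv One_nat_def)
  then show ?thesis
    by (simp add: bar_chain_group_def)
qed

lemma C2_eq: "C2 = free_Abelian_group ((\<lambda>(g, h). [g, h]) ` (carrier G \<times> carrier G))"
proof -
  have "{gs. length gs = 2 \<and> set gs \<subseteq> carrier G} = (\<lambda>(g, h). [g, h]) ` (carrier G \<times> carrier G)"
    by (auto simp: length_Suc_conv numeral_2_eq_2 image_iff)
  then show ?thesis
    by (simp add: bar_chain_group_def)
qed

text \<open>Both faces of a list of length one are the empty list, and they enter with opposite
  signs.\<close>

lemma cycles_eq: "bar_cycles G 1 = carrier C1"
proof -
  have "bar_boundary G 1 c = 0" if c: "c \<in> carrier C1" for c
  proof -
    have "bar_boundary G 1 c =
        frag_extend (\<lambda>gs. \<Sum>i\<le>1. frag_cmul ((-1) ^ i) (frag_of (bar_face G i gs))) c"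
      by (simp add: bar_boundary_def)
    also have "\<dots> = frag_extend (\<lambda>_. 0) c"
    proof (rule frag_extend_eq)
      fix gs assume "gs \<in> Poly_Mapping.keys c"
      then obtain g where "gs = [g]"
        using c by (auto simp: C1_eq)
      then show "(\<Sum>i\<le>1. frag_cmul ((-1) ^ i) (frag_of (bar_face G i gs))) = 0"
        by (simp add: bar_face_def One_nat_def)
    qed
    finally have "bar_boundary G 1 c = frag_extend (\<lambda>_. 0) c" .
    then show ?thesis
      by (simp add: frag_extend_def)
  qed
  moreover have "\<one>\<^bsub>bar_chain_group G 0\<^esub> = 0"
    by (simp add: bar_chain_group_def)
  ultimately show ?thesis
    by (auto simp: bar_cycles_def kernel_def)
qed

lemma homology_eq: "group_homology 1 G = C1 Mod B1"
  by (simp add: group_homology_def cycles_eq)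

lemma boundary_pair:
  "bar_boundary G 2 (frag_of [g, h]) = frag_of [h] - frag_of [g \<otimes> h] + frag_of [g]"
  by (simp add: bar_boundary_def bar_face_def numeral_2_eq_2 frag_cmul_distrib)

lemma boundary_hom: "bar_boundary G 2 \<in> hom C2 C1"
proof (rule homI)
  have D: "bar_boundary G 2 = frag_extend (\<lambda>gs. bar_boundary G 2 (frag_of gs))"
    by (rule ext) (simp add: bar_boundary_def)
  show "bar_boundary G 2 x \<in> carrier C1" if x: "x \<in> carrier C2" for x
  proof -
    have pair: "Poly_Mapping.keys (bar_boundary G 2 (frag_of [g, h])) \<subseteq> (\<lambda>g. [g]) ` carrier G"
      if "g \<in> carrier G" "h \<in> carrier G" for g h
      unfolding boundary_pair using that
      by (intro order.trans[OF keys_add] order.trans[OF keys_diff] Un_least) auto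
    have "Poly_Mapping.keys (bar_boundary G 2 x) \<subseteq>
        (\<Union>gs\<in>Poly_Mapping.keys x. Poly_Mapping.keys (bar_boundary G 2 (frag_of gs)))"
      by (subst D) (rule keys_frag_extend)
    also have "\<dots> \<subseteq> (\<lambda>g. [g]) ` carrier G"
    proof (rule UN_least)
      fix gs assume "gs \<in> Poly_Mapping.keys x"
      then obtain g h where "gs = [g, h]" "g \<in> carrier G" "h \<in> carrier G"
        using x by (auto simp: C2_eq)
      then show "Poly_Mapping.keys (bar_boundary G 2 (frag_of gs)) \<subseteq> (\<lambda>g. [g]) ` carrier G"
        using pair by simp
    qed
    finally show ?thesis
      by (simp add: C1_eq)
  qed
  show "bar_boundary G 2 (x \<otimes>\<^bsub>C2\<^esub> y) = bar_boundary G 2 x \<otimes>\<^bsub>C1\<^esub> bar_boundary G 2 y" for x y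
    by (simp add: C1_eq C2_eq bar_boundary_def frag_extend_add)
qed

lemma B1_eq: "B1 = bar_boundary G 2 ` carrier C2"
  by (simp add: bar_boundaries_def)

lemma group_C1: "group C1" and group_C2: "group C2"
  by (simp_all add: bar_chain_group_def)

lemma subgroup_B1: "subgroup B1 C1"
proof -
  interpret group_hom C2 C1 "bar_boundary G 2"
    using boundary_hom group_C1 group_C2 by (simp add: group_hom_def group_hom_axioms_def)
  show ?thesis
    using img_is_subgroup by (simp add: B1_eq)
qed

lemma comm_group_C1: "comm_group C1"
  by (simp add: bar_chain_group_def abelian_free_Abelian_group)

lemma comm_group_homology: "comm_group (group_homology 1 G)"
  unfolding homology_eq using comm_group.abelian_FactGroup[OF comm_group_C1 subgroup_B1] .

lemma B1_closed:
  "x \<in> B1 \<Longrightarrow> y \<in> B1 \<Longrightarrow> x + y \<in> B1"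
  "x \<in> B1 \<Longrightarrow> y \<in> B1 \<Longrightarrow> x - y \<in> B1"
  "0 \<in> B1"
proof -
  interpret subgroup B1 C1
    by (rule subgroup_B1)
  show plus: "x + y \<in> B1" if "x \<in> B1" "y \<in> B1" for x y
    using m_closed[OF that] by (simp add: C1_eq)
  have "- y \<in> B1" if "y \<in> B1" for y
    using m_inv_closed[OF that] mem_carrier[OF that] by (simp add: C1_eq)
  then show "x \<in> B1 \<Longrightarrow> y \<in> B1 \<Longrightarrow> x - y \<in> B1"
    using plus[of x "- y"] by simp
  show "0 \<in> B1"
    using one_closed by (simp add: C1_eq)
qed

lemma boundary_pair_in_B1:
  "\<lbrakk>g \<in> carrier G; h \<in> carrier G\<rbrakk> \<Longrightarrow> frag_of [h] - frag_of [g \<otimes> h] + frag_of [g] \<in> B1"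
  unfolding boundary_pair[symmetric] B1_eq
  by (intro imageI) (force simp: C2_eq)

text \<open>The boundary of \<open>[g, h]\<close> is the relation that makes classes
  multiplicative.\<close>

lemma class_hom: "(\<lambda>g. B1 #>\<^bsub>C1\<^esub> frag_of [g]) \<in> hom G (group_homology 1 G)"
proof (rule homI)
  interpret C1: comm_group C1
    by (rule comm_group_C1)
  interpret N: normal B1 C1
    by (rule C1.subgroup_imp_normal[OF subgroup_B1])
  have mem: "frag_of [g] \<in> carrier C1" if "g \<in> carrier G" for g
    using that by (simp add: C1_eq)
  show "B1 #>\<^bsub>C1\<^esub> frag_of [g] \<in> carrier (group_homology 1 G)" if "g \<in> carrier G" for g
    using mem[OF that] by (auto simp: homology_eq FactGroup_def RCOSETS_def)
  show "B1 #>\<^bsub>C1\<^esub> frag_of [g \<otimes> h] =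
      (B1 #>\<^bsub>C1\<^esub> frag_of [g]) \<otimes>\<^bsub>group_homology 1 G\<^esub> (B1 #>\<^bsub>C1\<^esub> frag_of [h])"
    if g: "g \<in> carrier G" and h: "h \<in> carrier G" for g h
  proof -
    have "(B1 #>\<^bsub>C1\<^esub> frag_of [g]) \<otimes>\<^bsub>group_homology 1 G\<^esub> (B1 #>\<^bsub>C1\<^esub> frag_of [h]) =
        B1 #>\<^bsub>C1\<^esub> (frag_of [g] \<otimes>\<^bsub>C1\<^esub> frag_of [h])"
      using g h mem by (simp add: homology_eq FactGroup_def N.rcos_sum)
    also have "frag_of [g] \<otimes>\<^bsub>C1\<^esub> frag_of [h] =
        (frag_of [h] - frag_of [g \<otimes> h] + frag_of [g]) \<otimes>\<^bsub>C1\<^esub> frag_of [g \<otimes> h]"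
      by (simp add: C1_eq)
    also have "B1 #>\<^bsub>C1\<^esub> \<dots> = B1 #>\<^bsub>C1\<^esub> frag_of [g \<otimes> h]"
      using g h mem boundary_pair_in_B1[OF g h] N.mem_carrier N.subset
      by (simp add: C1.coset_mult_assoc[symmetric] C1.coset_join2 subgroup_B1)
    finally show ?thesis ..
  qed
qed

text \<open>A criterion that does not pass through the abelianisation. The premise
  \<open>trivial\<close> is applied to the class map and then says that \<open>frag_of [g]\<close>
  is a boundary whenever \<open>s g = 0\<close>. As only homomorphisms into the homology group
  itself occur, the premise stays within one type.\<close>

lemma homology_iso_Z2:
  assumes s: "s \<in> hom G (integer_mod_group 2)" and e: "e \<in> carrier G" "s e = 1"
    and trivial: "\<And>f g. \<lbrakk>f \<in> hom G (group_homology 1 G); g \<in> carrier G; s g = 0\<rbrakk> \<Longrightarrow>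
      f g = \<one>\<^bsub>group_homology 1 G\<^esub>"
  shows "group_homology 1 G \<cong> integer_mod_group 2"
proof -
  let ?Z2 = "integer_mod_group 2"
  interpret C1: comm_group C1
    by (rule comm_group_C1)
  interpret s: group_hom G ?Z2 s
    using s by (simp add: group_hom_def group_hom_axioms_def is_group)
  have Z2: "carrier ?Z2 = {0, 1}"
    by (auto simp: carrier_integer_mod_group)
  interpret Z2: comm_group ?Z2
    by (rule comm_group_integer_mod_group)
  have "(s \<circ> hd) ` ((\<lambda>g. [g]) ` carrier G) \<subseteq> carrier ?Z2"
    using s.hom_closed by auto
  then obtain h where h: "h \<in> hom C1 ?Z2"
    and "\<And>x. x \<in> (\<lambda>g. [g]) ` carrier G \<Longrightarrow> h (frag_of x) = (s \<circ> hd) x"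
    unfolding C1_eq by (rule Z2.free_Abelian_group_universal) blast
  then have h_of: "h (frag_of [g]) = s g" if "g \<in> carrier G" for g
    using that by simp
  interpret h: group_hom C1 ?Z2 h
    using h group_C1 by (simp add: group_hom_def group_hom_axioms_def)
  have h_range: "h x = 0 \<or> h x = 1" if "x \<in> carrier C1" for x
    using h.hom_closed[OF that] Z2 by simp
  have h_diff: "h (x - y) = (h x - h y) mod 2" if "x \<in> carrier C1" "y \<in> carrier C1" for x y
  proof -
    have "h (x - y) = h (x \<otimes>\<^bsub>C1\<^esub> inv\<^bsub>C1\<^esub> y)"
      using that by (simp add: C1_eq)
    also have "\<dots> = (h x + h (inv\<^bsub>C1\<^esub> y)) mod 2"
      using that by simp
    also have "\<dots> = (h x - h y) mod 2"
      using that h.hom_closed[OF that(2)] by (simp add: h.hom_inv mod_add_right_eq del: h.hom_closed)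
    finally show ?thesis .
  qed
  have B1_zero: "h x = 0" if x: "x \<in> B1" for x
  proof -
    obtain y where y: "y \<in> carrier C2" "x = bar_boundary G 2 y"
      using x by (auto simp: B1_eq)
    have "(h \<circ> bar_boundary G 2) y = \<one>\<^bsub>?Z2\<^esub>"
    proof (rule free_Abelian_group_hom_trivial)
      show "h \<circ> bar_boundary G 2 \<in> hom (free_Abelian_group ((\<lambda>(g, h). [g, h]) ` (carrier G \<times> carrier G))) ?Z2"
        using boundary_hom h unfolding C2_eq by (rule Group.hom_compose)
      fix gs assume "gs \<in> (\<lambda>(g, h). [g, h]) ` (carrier G \<times> carrier G)"
      then obtain a b where ab: "gs = [a, b]" "a \<in> carrier G" "b \<in> carrier G"
        by auto
      have mem: "frag_of [g] \<in> carrier C1" if "g \<in> carrier G" for g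
        using that by (simp add: C1_eq)
      have "bar_boundary G 2 (frag_of gs) = (frag_of [b] - frag_of [a \<otimes> b]) \<otimes>\<^bsub>C1\<^esub> frag_of [a]"
        by (simp add: ab boundary_pair C1_eq)
      moreover have "frag_of [b] - frag_of [a \<otimes> b] \<in> carrier C1"
        using mem[OF ab(3)] mem[OF m_closed[OF ab(2,3)]] keys_diff unfolding C1_eq by force
      ultimately have "h (bar_boundary G 2 (frag_of gs)) = (h (frag_of [b] - frag_of [a \<otimes> b]) + s a) mod 2"
        using ab mem h_of by simp
      also have "\<dots> = ((s b - (s a + s b) mod 2) mod 2 + s a) mod 2"
        using ab mem h_of h_diff s.hom_mult by simp
      also have "\<dots> = 0"
        by presburger
      finally show "(h \<circ> bar_boundary G 2) (frag_of gs) = \<one>\<^bsub>?Z2\<^esub>"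
        by simp
    qed (use y in \<open>auto simp: C2_eq\<close>)
    then show ?thesis
      using y by simp
  qed
  have ker: "frag_of [g] \<in> B1" if "g \<in> carrier G" "s g = 0" for g
  proof -
    have "B1 #>\<^bsub>C1\<^esub> frag_of [g] = B1"
      using trivial[OF class_hom that] by (simp add: homology_eq FactGroup_def)
    then show ?thesis
      using C1.coset_join1[OF _ _ subgroup_B1] that by (metis C1_eq frag_of_in_free_Abelian_group imageI
          subgroup.subset[OF subgroup_B1])
  qed
  \<comment> \<open>The chain [e] - [g e] + [g] is a boundary, and so is [g e], because s(g e) =
    0.\<close>
  have odd_sum: "frag_of [e] + frag_of [g] \<in> B1" if "g \<in> carrier G" "s g = 1" for g
  proof -
    have "s (g \<otimes> e) = 0"
      using that e s.hom_mult by simp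
    then have "frag_of [g \<otimes> e] \<in> B1"
      using that e by (intro ker) simp_all
    from B1_closed(1)[OF boundary_pair_in_B1[OF that(1) e(1)] this] show ?thesis
      by simp
  qed
  have odd: "frag_of [g] - frag_of [e] \<in> B1" if "g \<in> carrier G" "s g = 1" for g
    using B1_closed(2)[OF odd_sum[OF that] odd_sum[OF e]] by simp
  have two: "frag_of [e] + frag_of [e] \<in> B1"
    by (rule odd_sum[OF e])
  \<comment> \<open>Modulo boundaries a chain is zero or the class of \<open>e\<close>, as told by
    \<open>h\<close>. The induction runs over differences, and \<open>two\<close> turns minus the
    class of \<open>e\<close> back into plus.\<close>
  have "(h x = 0 \<longrightarrow> x \<in> B1) \<and> (h x = 1 \<longrightarrow> x - frag_of [e] \<in> B1)"
    if "Poly_Mapping.keys x \<subseteq> (\<lambda>g. [g]) ` carrier G" for x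
  proof (rule free_Abelian_group_induct[OF that])
    show "(h 0 = 0 \<longrightarrow> 0 \<in> B1) \<and> (h 0 = 1 \<longrightarrow> 0 - frag_of [e] \<in> B1)"
      using h.hom_one B1_closed(3) by (simp add: C1_eq)
  next
    fix x y
    assume 2: "Poly_Mapping.keys x \<subseteq> (\<lambda>g. [g]) ` carrier G" "Poly_Mapping.keys y \<subseteq> (\<lambda>g. [g]) ` carrier G"
      "(h x = 0 \<longrightarrow> x \<in> B1) \<and> (h x = 1 \<longrightarrow> x - frag_of [e] \<in> B1)"
      "(h y = 0 \<longrightarrow> y \<in> B1) \<and> (h y = 1 \<longrightarrow> y - frag_of [e] \<in> B1)"
    then have xy: "x \<in> carrier C1" "y \<in> carrier C1"
      by (simp_all add: C1_eq)
    from h_range[OF xy(1)] h_range[OF xy(2)] show "(h (x - y) = 0 \<longrightarrow> x - y \<in> B1) \<and> (h (x - y) = 1 \<longrightarrow> x - y - frag_of [e] \<in> B1)"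
    proof (elim disjE)
      assume "h x = 0" "h y = 0"
      then show ?thesis
        using 2 B1_closed(2)[of x y] h_diff[OF xy] by simp
    next
      assume "h x = 0" "h y = 1"
      then show ?thesis
        using 2 B1_closed(2)[OF B1_closed(2)[of x "y - frag_of [e]"] two] h_diff[OF xy]
        by (simp add: algebra_simps)
    next
      assume "h x = 1" "h y = 0"
      then show ?thesis
        using 2 B1_closed(2)[of "x - frag_of [e]" y] h_diff[OF xy] by (simp add: algebra_simps)
    next
      assume "h x = 1" "h y = 1"
      then show ?thesis
        using 2 B1_closed(2)[of "x - frag_of [e]" "y - frag_of [e]"] h_diff[OF xy] by simp
    qed
  next
    fix gs assume "gs \<in> (\<lambda>g. [g]) ` carrier G"
    then show "(h (frag_of gs) = 0 \<longrightarrow> frag_of gs \<in> B1) \<and> (h (frag_of gs) = 1 \<longrightarrow> frag_of gs - frag_of [e] \<in> B1)"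
      using ker odd h_of by auto
  qed
  then have "x \<in> B1" if "x \<in> carrier C1" "h x = 0" for x
    using that by (simp add: C1_eq)
  then have "kernel C1 ?Z2 h = B1"
    using B1_zero subgroup.mem_carrier[OF subgroup_B1] by (auto simp: kernel_def)
  moreover have "h ` carrier C1 = carrier ?Z2"
  proof
    have "h 0 = 0"
      using h.hom_one by (simp add: C1_eq)
    moreover have "0 \<in> carrier C1" "frag_of [e] \<in> carrier C1"
      using e by (simp_all add: C1_eq)
    ultimately show "carrier ?Z2 \<subseteq> h ` carrier C1"
      unfolding Z2 using h_of[OF e(1)] e(2) by (metis empty_subsetI imageI insert_subset)
  qed (use h.hom_closed in blast)
  ultimately show ?thesis
    using h.FactGroup_iso homology_eq by simp
qed

end

section \<open>Reduction of an automorphism by elementary moves\<close>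

text \<open>Words are read as numerals with digits \<open>c l\<close> in base \<open>N\<close>, so
  words of equal length over \<open>T\<close> are compared lexicographically. Numbers are wanted
  rather than an order, because values are added up in \<open>V\<close> and in the measure of a
  tuple.\<close>

lemma exists_word_valuation:
  assumes "finite T"
  shows "\<exists>val :: 'a word \<Rightarrow> nat.
    (\<forall>p q r. length p = length q \<longrightarrow> val p < val q \<longrightarrow> val (p @ r) < val (q @ r)) \<and>
    (\<forall>p q. length p = length q \<longrightarrow> fst ` set p \<subseteq> T \<longrightarrow> fst ` set q \<subseteq> T \<longrightarrow> val p = val q \<longrightarrow> p = q)"
proof -
  have "finite (T \<times> (UNIV :: bool set))"
    using assms by simp
  then obtain c and B :: nat where c: "c ` (T \<times> (UNIV :: bool set)) = {i. i < B}" "inj_on c (T \<times> UNIV)"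
    using finite_imp_inj_to_nat_seg by metis
  \<comment> \<open>One more than the number of digits, which keeps the base positive when
    \<open>T\<close> is empty.\<close>
  define N where "N = Suc B"
  define val where "val = foldl (\<lambda>m l. m * N + c l) 0"
  have foldl: "foldl (\<lambda>m l. m * N + c l) m r = m * N ^ length r + val r" for m r
  proof (induction r rule: rev_induct)
    case (snoc l r)
    then show ?case
      by (simp add: val_def algebra_simps)
  qed (simp add: val_def)
  have append: "val (p @ r) = val p * N ^ length r + val r" for p r
    using foldl[of "val p" r] by (simp add: val_def)
  have inj: "p = q" if "length p = length q" "fst ` set p \<subseteq> T" "fst ` set q \<subseteq> T" "val p = val q" for p q
    using that
  proof (induction p arbitrary: q rule: rev_induct)
    case (snoc l p)
    then obtain q' m where q: "q = q' @ [m]"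
      by (cases q rule: rev_cases) auto
    have lm: "l \<in> T \<times> UNIV" "m \<in> T \<times> UNIV"
      using snoc.prems q by (auto simp: mem_Times_iff)
    then have "c l \<in> {i. i < B}" "c m \<in> {i. i < B}"
      unfolding c(1)[symmetric] by blast+
    then have "c l < N" "c m < N"
      by (simp_all add: N_def)
    have eq: "val p * N + c l = val q' * N + c m"
      using snoc.prems(4) q by (simp add: append) (simp add: val_def)
    have "val p = (val p * N + c l) div N" "c l = (val p * N + c l) mod N"
      "val q' = (val q' * N + c m) div N" "c m = (val q' * N + c m) mod N"
      using \<open>c l < N\<close> \<open>c m < N\<close> by simp_all
    with eq have "val p = val q'" "c l = c m"
      by metis+
    with snoc q c(2) lm show ?case
      by (auto dest: inj_onD)
  qed simp
  show ?thesis
    by (rule exI[of _ val]) (use append inj in \<open>auto simp: N_def\<close>)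
qed

lemma sum_single_update:
  fixes \<phi> :: "'b \<Rightarrow> nat"
  assumes "finite A" "i \<in> A" "\<And>x. x \<in> A \<Longrightarrow> x \<noteq> i \<Longrightarrow> g x = h x"
  shows "(\<Sum>x\<in>A. \<phi> (g x)) + \<phi> (h i) = (\<Sum>x\<in>A. \<phi> (h x)) + \<phi> (g i)"
proof -
  have "(\<Sum>x\<in>A - {i}. \<phi> (g x)) = (\<Sum>x\<in>A - {i}. \<phi> (h x))"
    using assms(3) by (intro sum.cong) auto
  then show ?thesis
    using assms(1,2) by (simp add: sum.remove[of A i])
qed

section \<open>Tuples as data for the Nielsen reduction\<close>

context fnk
begin

lemma F_mult: "u \<otimes>\<^bsub>F\<^esub> v = u \<star> v"
  and F_one: "\<one>\<^bsub>F\<^esub> = []"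
  and F_inv: "u \<in> carrier F \<Longrightarrow> inv\<^bsub>F\<^esub> u = winv u"
  and F_carrier: "u \<in> carrier F \<longleftrightarrow> reduced u \<and> fst ` set u \<subseteq> S"
  by (simp_all add: Fnk_def free_group_simps inv_free_group)

text \<open>Asking that every generator occur up to sign is enough, as there are equally many
  entries. This is the form that \<open>minimal_generating\<close> delivers.\<close>

definition signed_permutation :: "(nat \<Rightarrow> basis word) \<times> (nat \<Rightarrow> basis word) \<Rightarrow> bool" where
  "signed_permutation a \<longleftrightarrow> (\<forall>i\<in>{1..n}. \<exists>l\<in>{1..n}. \<exists>\<epsilon>. fst a l = [(GenX i, \<epsilon>)]) \<and>
    (\<forall>j\<in>{1..k}. snd a j = [])"

definition reflection :: "(nat \<Rightarrow> basis word) \<times> (nat \<Rightarrow> basis word)" where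
  "reflection = (\<lambda>i\<in>{1..n}. if i = 1 then inv\<^bsub>F\<^esub> xgen i else xgen i, \<lambda>j\<in>{1..k}. \<one>\<^bsub>F\<^esub>)"

lemma reflection_A_bd: "reflection \<in> carrier (A_bd n k)"
proof -
  have r: "reflection \<in> carrier E"
    by (simp add: reflection_def E_carrier)
  have x: "fst reflection i = (if i = 1 then inv\<^bsub>F\<^esub> xgen i else xgen i)" if "i \<in> {1..n}" for i
    using that by (simp add: reflection_def)
  have y: "snd reflection j = \<one>\<^bsub>F\<^esub>" if "j \<in> {1..k}" for j
    using that by (simp add: reflection_def)
  have "reflection \<otimes>\<^bsub>A_bd n k\<^esub> reflection = \<one>\<^bsub>A_bd n k\<^esub>"
  proof (rule E_eqI)
    fix i assume i: "i \<in> {1..n}"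
    then have "xgen i \<in> carrier F"
      by simp
    with r i show "fst (reflection \<otimes>\<^bsub>A_bd n k\<^esub> reflection) i = fst \<one>\<^bsub>A_bd n k\<^esub> i"
      by (cases "i = 1") (simp_all add: fst_mult x)
  qed (use r in \<open>simp_all add: E_mult_closed E_one_closed snd_mult y\<close>)
  with r show ?thesis
    by (intro A_bdI)
qed

text \<open>The reduction is indexed by generators instead of numbers; the empty word stands in for
  the generators of the other kind.\<close>

definition xword :: "(nat \<Rightarrow> basis word) \<times> (nat \<Rightarrow> basis word) \<Rightarrow> basis \<Rightarrow> basis word" where
  "xword a b = (case b of GenX i \<Rightarrow> fst a i | GenY j \<Rightarrow> [])"

definition yword :: "(nat \<Rightarrow> basis word) \<times> (nat \<Rightarrow> basis word) \<Rightarrow> basis \<Rightarrow> basis word" where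
  "yword a b = (case b of GenX i \<Rightarrow> [] | GenY j \<Rightarrow> snd a j)"

lemma xword_yword_simps [simp]: "xword a (GenX i) = fst a i" "yword a (GenY j) = snd a j"
  by (simp_all add: xword_def yword_def)

lemma alpha_letter_image:
  assumes "a \<in> carrier E" "b \<in> S"
  shows "alpha n k a [(b, \<epsilon>)] = letter_image (GenX ` {1..n}) (xword a) (yword a) b \<epsilon>"
  using assms(2)
proof (cases rule: letter_cases[of b \<epsilon>])
  case (1 i)
  moreover from this have "fst a i \<in> carrier F"
    using assms by simp
  ultimately show ?thesis
    using assms(1) F_inv[of "fst a i"] by (simp add: letter_image_def)
next
  case (2 j)
  then have w: "snd a j \<in> carrier F" "ygen j \<in> carrier F" "b \<notin> GenX ` {1..n}" "b \<in> S"
    using assms by auto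
  have "alpha n k a [(b, \<epsilon>)] = inv\<^bsub>F\<^esub> snd a j \<otimes>\<^bsub>F\<^esub> ([(b, \<epsilon>)] \<otimes>\<^bsub>F\<^esub> snd a j)"
    using assms 2 w unfolding 2(3) by (simp add: F.inv_mult_group F.m_assoc)
  then show ?thesis
    using w 2(2) F_inv[OF w(1)] by (simp add: letter_image_def F_mult del: foldr.simps)
qed

lemma alpha_letter_X:
  assumes "a \<in> carrier E" "i \<in> {1..n}"
  shows "alpha n k a [(GenX i, \<epsilon>)] = (if \<epsilon> then fst a i else inv\<^bsub>F\<^esub> fst a i)"
proof -
  have "GenX i \<in> S" "xgen i \<in> carrier F"
    using assms by simp_all
  then show ?thesis
    using assms unfolding letter_eq[OF \<open>GenX i \<in> S\<close>] by simp
qed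

lemma alpha_wprod:
  assumes "a \<in> carrier E" "v \<in> carrier F"
  shows "alpha n k a v = wprod (map (\<lambda>l. alpha n k a [l]) v)"
  using assms(2)
proof (induction v)
  case Nil
  then show ?case
    using alpha_one[OF assms(1)] by (simp add: F_one)
next
  case (Cons l v)
  then have c: "[l] \<in> carrier F" "v \<in> carrier F"
    by (auto simp: F_carrier reduced_Cons_iff)
  have "l # v = [l] \<otimes>\<^bsub>F\<^esub> v"
    using Cons.prems push_eq_Cons[of l v] by (simp add: F_mult F_carrier)
  then have "alpha n k a (l # v) = alpha n k a [l] \<otimes>\<^bsub>F\<^esub> alpha n k a v"
    using c assms(1) by (simp only: alpha_mult)
  then show ?case
    using Cons.IH c by (simp add: F_mult del: foldr.simps)
qed

text \<open>By surjectivity of \<open>alpha n k a\<close>, a preimage of the generator exists;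
  reading it letter by letter writes the generator as a product of images of letters.\<close>

lemma generators_wprod:
  assumes a: "a \<in> carrier (A_bd n k)" and b: "b \<in> S"
  shows "\<exists>us. set us \<subseteq> {letter_image (GenX ` {1..n}) (xword a) (yword a) b \<epsilon> | b \<epsilon>. b \<in> S} \<and>
    wprod us = [(b, True)]"
proof -
  have aE: "a \<in> carrier E"
    using a by simp
  have "bij_betw (alpha n k a) (carrier F) (carrier F)"
    using a by (simp add: A_bd_carrier auto_def Bij_def)
  then obtain v where v: "v \<in> carrier F" "alpha n k a v = [(b, True)]"
    using letter_carrier[of b True] b unfolding bij_betw_def by (metis imageE)
  have "set (map (\<lambda>l. alpha n k a [l]) v) \<subseteq>
      {letter_image (GenX ` {1..n}) (xword a) (yword a) b \<epsilon> | b \<epsilon>. b \<in> S}"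
  proof
    fix u assume "u \<in> set (map (\<lambda>l. alpha n k a [l]) v)"
    then obtain c \<delta> where c: "(c, \<delta>) \<in> set v" "u = alpha n k a [(c, \<delta>)]"
      by auto
    then have "c \<in> S"
      using v(1) unfolding F_carrier by force
    with c(2) show "u \<in> {letter_image (GenX ` {1..n}) (xword a) (yword a) b \<epsilon> | b \<epsilon>. b \<in> S}"
      using alpha_letter_image[OF aE \<open>c \<in> S\<close>, of \<delta>] by blast
  qed
  moreover have "wprod (map (\<lambda>l. alpha n k a [l]) v) = [(b, True)]"
    unfolding alpha_wprod[OF aE v(1), symmetric] by (rule v(2))
  ultimately show ?thesis
    by (intro exI conjI)
qed

end

section \<open>Reduction to a signed permutation and then to the reflection\<close>

context fnk_hom
begin

text \<open>Moves do not leave the fibre of \<open>f\<close> through \<open>a0\<close>, so a minimal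
  element of that fibre cannot be improved by any of them; this is what \<open>minimal_tuple\<close>
  asks for.\<close>

lemma reduce_to_permutation:
  assumes a0: "a0 \<in> carrier (A_bd n k)"
  obtains a where "a \<in> carrier (A_bd n k)" "f a = f a0"
    "\<And>i. i \<in> {1..n} \<Longrightarrow> \<exists>l\<in>{1..n}. \<exists>\<epsilon>. fst a l = [(GenX i, \<epsilon>)]"
    "\<And>j. j \<in> {1..k} \<Longrightarrow> snd a j = []"
proof -
  obtain val :: "basis word \<Rightarrow> nat" where
    val_mono: "\<And>p q r. \<lbrakk>length p = length q; val p < val q\<rbrakk> \<Longrightarrow> val (p @ r) < val (q @ r)"
    and val_inj: "\<And>p q. \<lbrakk>length p = length q; fst ` set p \<subseteq> S; fst ` set q \<subseteq> S; val p = val q\<rbrakk> \<Longrightarrow> p = q"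
    using exists_word_valuation[of S] by auto
  define V where "V u = val (half u) + val (half (winv u))" for u
  define \<mu> where "\<mu> a = (\<Sum>i\<in>{1..n}. length (fst a i)) + (\<Sum>j\<in>{1..k}. length (snd a j))"
    for a :: "(nat \<Rightarrow> basis word) \<times> (nat \<Rightarrow> basis word)"
  define \<rho> where "\<rho> a = (\<Sum>i\<in>{1..n}. V (fst a i)) + (\<Sum>j\<in>{1..k}. val (winv (snd a j)))"
    for a :: "(nat \<Rightarrow> basis word) \<times> (nat \<Rightarrow> basis word)"
  define M where "M = {a \<in> carrier (A_bd n k). f a = f a0}"
  \<comment> \<open>The measure is lexicographic: total length first, values only among tuples of
    the same total length.\<close>
  obtain a where a: "a \<in> M" and min: "\<And>a'. (a', a) \<in> measures [\<mu>, \<rho>] \<Longrightarrow> a' \<notin> M"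
    using wfE_min[OF wf_measures[of "[\<mu>, \<rho>]"], of a0 M] a0 by (auto simp: M_def)
  have min_len: "\<mu> a \<le> \<mu> a'" and min_val: "\<mu> a' = \<mu> a \<Longrightarrow> \<rho> a \<le> \<rho> a'" if "a' \<in> M" for a'
    using min[of a'] that by fastforce+
  have aA: "a \<in> carrier (A_bd n k)" "a \<in> carrier E" "f a = f a0"
    using a by (auto simp: M_def)
  let ?el = "letter_image (GenX ` {1..n}) (xword a) (yword a)"
  have move: "m \<otimes>\<^bsub>A_bd n k\<^esub> a \<in> M" if "m \<in> carrier (A_bd n k)" "f m = \<one>" for m
    using that aA f.hom_closed[OF a0] by (simp add: M_def)
  \<comment> \<open>A move changes a single entry, so minimality of the sums passes to that
    entry.\<close>
  have x_move: "length (fst a i) \<le> length (fst a' i) \<and>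
      (length (fst a' i) = length (fst a i) \<longrightarrow> V (fst a i) \<le> V (fst a' i))"
    if "a' \<in> M" "i \<in> {1..n}" "\<And>l. l \<in> {1..n} \<Longrightarrow> l \<noteq> i \<Longrightarrow> fst a' l = fst a l"
      "\<And>j. j \<in> {1..k} \<Longrightarrow> snd a' j = snd a j" for a' i
  proof -
    have "(\<Sum>i\<in>{1..n}. length (fst a' i)) + length (fst a i) = (\<Sum>i\<in>{1..n}. length (fst a i)) + length (fst a' i)"
      "(\<Sum>i\<in>{1..n}. V (fst a' i)) + V (fst a i) = (\<Sum>i\<in>{1..n}. V (fst a i)) + V (fst a' i)"
      using that(2,3) by (intro sum_single_update; simp)+
    moreover have "(\<Sum>j\<in>{1..k}. length (snd a' j)) = (\<Sum>j\<in>{1..k}. length (snd a j))"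
      "(\<Sum>j\<in>{1..k}. val (winv (snd a' j))) = (\<Sum>j\<in>{1..k}. val (winv (snd a j)))"
      using that(4) by simp_all
    ultimately show ?thesis
      using min_len[OF that(1)] min_val[OF that(1)] unfolding \<mu>_def \<rho>_def by linarith
  qed
  have y_move: "length (snd a j) \<le> length (snd a' j) \<and>
      (length (snd a' j) = length (snd a j) \<longrightarrow> val (winv (snd a j)) \<le> val (winv (snd a' j)))"
    if "a' \<in> M" "j \<in> {1..k}" "\<And>l. l \<in> {1..k} \<Longrightarrow> l \<noteq> j \<Longrightarrow> snd a' l = snd a l"
      "\<And>i. i \<in> {1..n} \<Longrightarrow> fst a' i = fst a i" for a' j
  proof -
    have "(\<Sum>i\<in>{1..k}. length (snd a' i)) + length (snd a j) = (\<Sum>i\<in>{1..k}. length (snd a i)) + length (snd a' j)"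
      "(\<Sum>i\<in>{1..k}. val (winv (snd a' i))) + val (winv (snd a j)) =
        (\<Sum>i\<in>{1..k}. val (winv (snd a i))) + val (winv (snd a' j))"
      using that(2,3) sum_single_update[of "{1..k}" j "snd a'" "snd a" length]
        sum_single_update[of "{1..k}" j "snd a'" "snd a" "\<lambda>u. val (winv u)"] by simp_all
    moreover have "(\<Sum>i\<in>{1..n}. length (fst a' i)) = (\<Sum>i\<in>{1..n}. length (fst a i))"
      "(\<Sum>i\<in>{1..n}. V (fst a' i)) = (\<Sum>i\<in>{1..n}. V (fst a i))"
      using that(4) by simp_all
    ultimately show ?thesis
      using min_len[OF that(1)] min_val[OF that(1)] unfolding \<mu>_def \<rho>_def by linarith
  qed
  have right: "length (xword a b) \<le> length (xword a b \<star> ?el c \<epsilon>) \<and>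
      (length (xword a b \<star> ?el c \<epsilon>) = length (xword a b) \<longrightarrow> V (xword a b) \<le> V (xword a b \<star> ?el c \<epsilon>))"
    and left: "length (xword a b) \<le> length (?el c \<epsilon> \<star> xword a b) \<and>
      (length (?el c \<epsilon> \<star> xword a b) = length (xword a b) \<longrightarrow> V (xword a b) \<le> V (?el c \<epsilon> \<star> xword a b))"
    if bX: "b \<in> GenX ` {1..n}" and that: "c \<in> S" "c \<noteq> b" for b c \<epsilon>
  proof -
    obtain i where i: "i \<in> {1..n}" "b = GenX i"
      using bX by blast
    note that = bX that
    have g: "[(c, \<epsilon>)] \<in> carrier F"
      using that(2) by simp
    have el: "alpha n k a [(c, \<epsilon>)] = ?el c \<epsilon>"
      by (rule alpha_letter_image[OF aA(2) that(2)])
    have "right_mv i [(c, \<epsilon>)] \<otimes>\<^bsub>A_bd n k\<^esub> a \<in> M" "left_mv i [(c, \<epsilon>)] \<otimes>\<^bsub>A_bd n k\<^esub> a \<in> M"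
      using that(2,3) i
      by (blast intro: move[OF mv_A_bd(1) f_right_mv] move[OF mv_A_bd(2) f_left_mv])+
    from x_move[OF this(1) i(1)] x_move[OF this(2) i(1)]
    show "length (xword a b) \<le> length (xword a b \<star> ?el c \<epsilon>) \<and>
      (length (xword a b \<star> ?el c \<epsilon>) = length (xword a b) \<longrightarrow> V (xword a b) \<le> V (xword a b \<star> ?el c \<epsilon>))"
      "length (xword a b) \<le> length (?el c \<epsilon> \<star> xword a b) \<and>
      (length (?el c \<epsilon> \<star> xword a b) = length (xword a b) \<longrightarrow> V (xword a b) \<le> V (?el c \<epsilon> \<star> xword a b))"
      using i right_mv_mult[OF aA(2) i(1) g] left_mv_mult[OF aA(2) i(1) g] by (simp_all add: el F_mult)
  qed
  have conj: "length (yword a b) \<le> length (yword a b \<star> ?el c \<epsilon>) \<and>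
      (length (yword a b \<star> ?el c \<epsilon>) = length (yword a b) \<longrightarrow> val (winv (yword a b)) \<le> val (winv (yword a b \<star> ?el c \<epsilon>)))"
    if bY: "b \<in> GenY ` {1..k}" and that: "c \<in> S" for b c \<epsilon>
  proof -
    obtain j where j: "j \<in> {1..k}" "b = GenY j"
      using bY by blast
    note that = bY that
    have g: "[(c, \<epsilon>)] \<in> carrier F"
      using that(2) by simp
    have el: "alpha n k a [(c, \<epsilon>)] = ?el c \<epsilon>"
      by (rule alpha_letter_image[OF aA(2) that(2)])
    have "conj_mv j [(c, \<epsilon>)] \<otimes>\<^bsub>A_bd n k\<^esub> a \<in> M"
      using that(2) j by (blast intro: move[OF mv_A_bd(3) f_conj_mv'])
    from y_move[OF this j(1)] show ?thesis
      using j conj_mv_mult[OF aA(2) g] by (simp add: el F_mult)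
  qed
  interpret minimal_tuple "GenX ` {1..n}" "GenY ` {1..k}" "xword a" "yword a" val ?el
    "\<lambda>u. val (half u) + val (half (winv u))"
  proof unfold_locales
    show "GenX ` {1..n} \<inter> GenY ` {1..k} = {}"
      by auto
    show "reduced (xword a b)" "fst ` set (xword a b) \<subseteq> S" if "b \<in> GenX ` {1..n}" for b
    proof -
      have "xword a b \<in> carrier F"
        using that E_closed(1)[OF aA(2)] by auto
      then show "reduced (xword a b)" "fst ` set (xword a b) \<subseteq> S"
        unfolding F_carrier by blast+
    qed
    show "reduced (yword a b)" if "b \<in> GenY ` {1..k}" for b
      using that E_closed(2)[OF aA(2)] by (auto simp: F_carrier)
    \<comment> \<open>An empty entry would be a generator sent to the identity by an injective
      map.\<close>
    show "xword a b \<noteq> []" if b: "b \<in> GenX ` {1..n}" for b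
    proof
      assume Nil: "xword a b = []"
      obtain i where i: "i \<in> {1..n}" "b = GenX i"
        using b by blast
      then have "alpha n k a (xgen i) = alpha n k a \<one>\<^bsub>F\<^esub>"
        using Nil i aA(2) alpha_one[OF aA(2)] by (simp add: F_one)
      moreover have "inj_on (alpha n k a) (carrier F)"
        using aA(1) by (simp add: A_bd_carrier auto_def Bij_def bij_betw_def)
      ultimately have "xgen i = \<one>\<^bsub>F\<^esub>"
        using i by (auto dest: inj_onD)
      then show False
        by (simp add: F_one gen_def)
    qed
    show "val (p @ r) < val (q @ r)" if "length p = length q" "val p < val q" for p q r
      using that by (rule val_mono)
    show "p = q" if "length p = length q" "fst ` set p \<subseteq> S" "fst ` set q \<subseteq> S" "val p = val q" for p q
      using that by (rule val_inj)
    show "length (xword a b) \<le> length (xword a b \<star> ?el c \<epsilon>)" "length (xword a b) \<le> length (?el c \<epsilon> \<star> xword a b)"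
      if "b \<in> GenX ` {1..n}" "c \<in> S" "c \<noteq> b" for b c \<epsilon>
      using right[OF that, of \<epsilon>] left[OF that, of \<epsilon>] by simp_all
    show "val (half (xword a b)) + val (half (winv (xword a b))) \<le>
        val (half (xword a b \<star> ?el c \<epsilon>)) + val (half (winv (xword a b \<star> ?el c \<epsilon>)))"
      if "b \<in> GenX ` {1..n}" "c \<in> S" "c \<noteq> b" "length (xword a b \<star> ?el c \<epsilon>) = length (xword a b)" for b c \<epsilon>
      using right[OF that(1-3), of \<epsilon>] that(4) by (simp add: V_def)
    show "val (half (xword a b)) + val (half (winv (xword a b))) \<le>
        val (half (?el c \<epsilon> \<star> xword a b)) + val (half (winv (?el c \<epsilon> \<star> xword a b)))"
      if "b \<in> GenX ` {1..n}" "c \<in> S" "c \<noteq> b" "length (?el c \<epsilon> \<star> xword a b) = length (xword a b)" for b c \<epsilon>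
      using left[OF that(1-3), of \<epsilon>] that(4) by (simp add: V_def)
    show "length (yword a b) \<le> length (yword a b \<star> ?el c \<epsilon>)"
      if "b \<in> GenY ` {1..k}" "c \<in> S" for b c \<epsilon>
      using conj[OF that, of \<epsilon>] by simp
    show "val (winv (yword a b)) \<le> val (winv (yword a b \<star> ?el c \<epsilon>))"
      if "b \<in> GenY ` {1..k}" "c \<in> S" "length (yword a b \<star> ?el c \<epsilon>) = length (yword a b)" for b c \<epsilon>
      using conj[OF that(1,2), of \<epsilon>] that(3) by simp
  qed
  have gen: "\<exists>us. set us \<subseteq> {?el b \<epsilon> | b \<epsilon>. b \<in> S} \<and> wprod us = [(b, True)]" if "b \<in> S" for b
    by (rule generators_wprod[OF aA(1) that])
  show thesis
  proof (rule that[OF aA(1,3)])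
    fix i assume "i \<in> {1..n}"
    then show "\<exists>l\<in>{1..n}. \<exists>\<epsilon>. fst a l = [(GenX i, \<epsilon>)]"
      using minimal_generating(1)[OF _ gen, of "GenX i"] by simp
  next
    fix j assume "j \<in> {1..k}"
    then show "snd a j = []"
      using minimal_generating(2)[OF _ gen, of "GenY j"] by auto
  qed
qed

text \<open>With p and q the entries at \<open>i\<close> and \<open>l\<close>, one left and two
  right moves give (p, q) -> (p, p^-1 q) -> (q, p^-1 q) -> (q, p^-1).\<close>

lemma rotate:
  assumes a: "a \<in> carrier (A_bd n k)" "signed_permutation a" and il: "i \<in> {1..n}" "l \<in> {1..n}" "i \<noteq> l"
  obtains a' where "a' \<in> carrier (A_bd n k)" "f a' = f a" "signed_permutation a'"
    "fst a' i = fst a l" "fst a' l = inv\<^bsub>F\<^esub> fst a i"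
    "\<And>m. m \<in> {1..n} \<Longrightarrow> m \<noteq> i \<Longrightarrow> m \<noteq> l \<Longrightarrow> fst a' m = fst a m"
proof -
  define b where "b = left_mv l [(GenX i, False)] \<otimes>\<^bsub>A_bd n k\<^esub> a"
  define c where "c = right_mv i [(GenX l, True)] \<otimes>\<^bsub>A_bd n k\<^esub> b"
  define d where "d = right_mv l [(GenX i, False)] \<otimes>\<^bsub>A_bd n k\<^esub> c"
  have S: "GenX i \<in> S" "GenX l \<in> S" "GenX i \<noteq> GenX l"
    using il by auto
  have g: "[(GenX i, \<epsilon>)] \<in> carrier F" "[(GenX l, \<epsilon>)] \<in> carrier F" for \<epsilon>
    using S by simp_all
  have A: "b \<in> carrier (A_bd n k)" "c \<in> carrier (A_bd n k)" "d \<in> carrier (A_bd n k)"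
    unfolding b_def c_def d_def using a il S by simp_all
  have E: "a \<in> carrier E" "b \<in> carrier E" "c \<in> carrier E"
    using A a by simp_all
  have fa: "f a \<in> carrier H" "f b = f a" "f c = f b" "f d = f c"
  proof -
    have f_mult: "f (m \<otimes>\<^bsub>A_bd n k\<^esub> a') = f a'"
      if "m \<in> carrier (A_bd n k)" "f m = \<one>" "a' \<in> carrier (A_bd n k)" for m a'
      using that f.hom_closed[OF that(3)] by simp
    show "f a \<in> carrier H"
      using a(1) by (rule f.hom_closed)
    show "f b = f a" "f c = f b" "f d = f c"
      unfolding b_def c_def d_def
      by (rule f_mult[OF mv_A_bd(2)[OF il(2) S(1,3)] f_left_mv[OF il(2) S(1,3)] a(1)]
          f_mult[OF mv_A_bd(1)[OF il(1) S(2) S(3)[symmetric]] f_right_mv[OF il(1) S(2) S(3)[symmetric]]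
            A(1)[unfolded b_def]]
          f_mult[OF mv_A_bd(1)[OF il(2) S(1,3)] f_right_mv[OF il(2) S(1,3)] A(2)[unfolded c_def b_def]])+
  qed
  have pq: "fst a i \<in> carrier F" "fst a l \<in> carrier F"
    using E il by simp_all
  have b: "fst b m = (if m = l then inv\<^bsub>F\<^esub> fst a i \<otimes>\<^bsub>F\<^esub> fst a l else fst a m)" if "m \<in> {1..n}" for m
    using left_mv_mult(1)[OF E(1) il(2) g(1) that] il E(1) by (simp add: b_def alpha_letter_X)
  have c: "fst c m = (if m = i then fst a l else fst b m)" if "m \<in> {1..n}" for m
    using right_mv_mult(1)[OF E(2) il(1) g(2) that] il E(2) pq by (simp add: c_def alpha_letter_X b)
  have d: "fst d m = (if m = l then inv\<^bsub>F\<^esub> fst a i else fst c m)" if "m \<in> {1..n}" for m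
    using right_mv_mult(1)[OF E(3) il(2) g(1) that] il E(3) pq
    by (simp add: d_def alpha_letter_X c b F.m_assoc)
  have snd_d: "snd d j = snd a j" if "j \<in> {1..k}" for j
    using right_mv_mult(2)[OF E(3) il(2) g(1) that] right_mv_mult(2)[OF E(2) il(1) g(2) that]
      left_mv_mult(2)[OF E(1) il(2) g(1) that] by (simp add: b_def c_def d_def)
  have fst_d: "fst d i = fst a l" "fst d l = inv\<^bsub>F\<^esub> fst a i"
    "\<And>m. m \<in> {1..n} \<Longrightarrow> m \<noteq> i \<Longrightarrow> m \<noteq> l \<Longrightarrow> fst d m = fst a m"
    using il by (simp_all add: b c d)
  have "signed_permutation d"
    unfolding signed_permutation_def
  proof (intro conjI ballI)
    fix m assume m: "m \<in> {1..n}"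
    then obtain l' \<epsilon> where l': "l' \<in> {1..n}" "fst a l' = [(GenX m, \<epsilon>)]"
      using a(2) by (auto simp: signed_permutation_def)
    have "inv\<^bsub>F\<^esub> [(GenX m, \<epsilon>)] = [(GenX m, \<not> \<epsilon>)]"
      using m by simp
    then have "\<exists>l''\<in>{1..n}. fst d l'' = [(GenX m, \<epsilon>)] \<or> fst d l'' = [(GenX m, \<not> \<epsilon>)]"
      using l' fst_d il by (metis)
    then show "\<exists>l\<in>{1..n}. \<exists>\<epsilon>. fst d l = [(GenX m, \<epsilon>)]"
      by blast
  qed (use a(2) snd_d in \<open>simp add: signed_permutation_def\<close>)
  with that A(3) fa fst_d show thesis
    by auto
qed

text \<open>Rotations are used to maximise the number of correct entries at the places 2 to n. Place
  1 is left out of the count, so that it can absorb a sign.\<close>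

lemma reduce_to_reflection:
  assumes a0: "a0 \<in> carrier (A_bd n k)"
  shows "f a0 = \<one> \<or> reflection \<in> carrier (A_bd n k) \<and> f a0 = f reflection"
proof -
  define M where "M = {a \<in> carrier (A_bd n k). f a = f a0 \<and> signed_permutation a}"
  define C where "C a = {i \<in> {2..n}. fst a i = xgen i}"
    for a :: "(nat \<Rightarrow> basis word) \<times> (nat \<Rightarrow> basis word)"
  have "\<exists>a1. a1 \<in> M"
  proof (rule reduce_to_permutation[OF a0])
    fix a1
    assume "a1 \<in> carrier (A_bd n k)" "f a1 = f a0"
      "\<And>i. i \<in> {1..n} \<Longrightarrow> \<exists>l\<in>{1..n}. \<exists>\<epsilon>. fst a1 l = [(GenX i, \<epsilon>)]"
      "\<And>j. j \<in> {1..k} \<Longrightarrow> snd a1 j = []"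
    then have "a1 \<in> M"
      by (simp add: M_def signed_permutation_def)
    then show "\<exists>a1. a1 \<in> M" ..
  qed
  then obtain a1 where "a1 \<in> M" ..
  then obtain a where a: "a \<in> M" and min: "\<And>a'. a' \<in> M \<Longrightarrow> n - card (C a) \<le> n - card (C a')"
    using ex_has_least_nat[of "\<lambda>a. a \<in> M" a1 "\<lambda>a. n - card (C a)"] by blast
  have max: "\<not> C a \<subset> C a'" if "a' \<in> M" for a'
  proof
    assume "C a \<subset> C a'"
    moreover have sub: "C a' \<subseteq> {2..n}" for a'
      unfolding C_def by (rule Collect_restrict)
    ultimately have "card (C a) < card (C a')"
      by (intro psubset_card_mono finite_subset[OF sub]) simp_all
    moreover have "card (C a') \<le> card {2..n}"
      by (rule card_mono[OF _ sub]) simp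
    ultimately show False
      using min[OF that] n_gt_2 by simp
  qed
  have aA: "a \<in> carrier (A_bd n k)" "f a = f a0" "signed_permutation a" "a \<in> carrier E"
    using a by (auto simp: M_def)
  have fixed: "fst a i = xgen i" if i: "i \<in> {2..n}" for i
  proof (rule ccontr)
    assume neq: "fst a i \<noteq> xgen i"
    have i': "i \<in> {1..n}" "i \<noteq> 1" "1 \<in> {1..n}"
      using i n_gt_2 by (auto simp: atLeastAtMost_iff)
    then obtain l \<epsilon> where l: "l \<in> {1..n}" "fst a l = [(GenX i, \<epsilon>)]"
      using aA(3) by (auto simp: signed_permutation_def)
    have inv_x: "inv\<^bsub>F\<^esub> [(GenX i, False)] = xgen i"
      using i' by (simp add: gen_def)
    have "\<exists>a'\<in>M. fst a' i = xgen i \<and> (\<forall>m\<in>{2..n}. m \<noteq> i \<longrightarrow> m \<noteq> l \<longrightarrow> fst a' m = fst a m)"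
    proof (cases "l = i")
      case True
      with l neq have \<epsilon>: "fst a i = [(GenX i, False)]"
        by (cases \<epsilon>) (auto simp: gen_def)
      \<comment> \<open>x_i stands at its own place with the wrong sign. Rotating twice with place 1
        inverts both entries.\<close>
      obtain b where b: "b \<in> carrier (A_bd n k)" "f b = f a" "signed_permutation b"
        "fst b i = fst a 1" "fst b 1 = inv\<^bsub>F\<^esub> fst a i"
        "\<And>m. m \<in> {1..n} \<Longrightarrow> m \<noteq> i \<Longrightarrow> m \<noteq> 1 \<Longrightarrow> fst b m = fst a m"
        using rotate[OF aA(1,3) i'(1,3,2)] by metis
      obtain c where c: "c \<in> carrier (A_bd n k)" "f c = f b" "signed_permutation c"
        "fst c i = fst b 1" "\<And>m. m \<in> {1..n} \<Longrightarrow> m \<noteq> i \<Longrightarrow> m \<noteq> 1 \<Longrightarrow> fst c m = fst b m"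
        using rotate[OF b(1,3) i'(1,3,2)] by metis
      have "c \<in> M" "fst c i = xgen i"
        using b c aA \<epsilon> inv_x by (auto simp: M_def)
      moreover have "fst c m = fst a m" if "m \<in> {2..n}" "m \<noteq> i" for m
        using b(6)[of m] c(5)[of m] that by (simp add: atLeastAtMost_iff)
      ultimately show ?thesis
        by blast
    next
      case False
      show ?thesis
      \<comment> \<open>A rotation inverts one of the two entries that it exchanges; the sign
        decides in which direction to rotate.\<close>
      proof (cases \<epsilon>)
        case True
        with l have "fst a l = xgen i"
          by (simp add: gen_def)
        moreover obtain b where b: "b \<in> carrier (A_bd n k)" "f b = f a" "signed_permutation b"
          "fst b i = fst a l" "\<And>m. m \<in> {1..n} \<Longrightarrow> m \<noteq> i \<Longrightarrow> m \<noteq> l \<Longrightarrow> fst b m = fst a m"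
          using rotate[OF aA(1,3) i'(1) l(1)] False by metis
        ultimately show ?thesis
          using aA by (intro bexI[of _ b]) (auto simp: M_def atLeastAtMost_iff)
      next
        case neg: False
        obtain b where b: "b \<in> carrier (A_bd n k)" "f b = f a" "signed_permutation b"
          "fst b i = inv\<^bsub>F\<^esub> fst a l" "\<And>m. m \<in> {1..n} \<Longrightarrow> m \<noteq> l \<Longrightarrow> m \<noteq> i \<Longrightarrow> fst b m = fst a m"
          using rotate[OF aA(1,3) l(1) i'(1) False] by metis
        moreover have "fst b i = xgen i"
          using b(4) l(2) neg inv_x by simp
        ultimately show ?thesis
          using aA by (intro bexI[of _ b]) (auto simp: M_def atLeastAtMost_iff)
      qed
    qed
    then obtain a' where a': "a' \<in> M" "fst a' i = xgen i"
      "\<And>m. m \<in> {2..n} \<Longrightarrow> m \<noteq> i \<Longrightarrow> m \<noteq> l \<Longrightarrow> fst a' m = fst a m"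
      by blast
    \<comment> \<open>Place \<open>l\<close> holds a letter of x_i, so the rotation disturbs no
      place that was already correct.\<close>
    have neq_l: "fst a l \<noteq> xgen l"
      using l neq by (auto simp: gen_def)
    have "C a \<subseteq> C a'"
    proof
      fix m assume "m \<in> C a"
      then have m: "m \<in> {2..n}" "fst a m = xgen m"
        by (simp_all add: C_def)
      with neq neq_l have "m \<noteq> i" "m \<noteq> l"
        by auto
      with m a'(3) show "m \<in> C a'"
        by (simp add: C_def)
    qed
    moreover have "i \<in> C a'" "i \<notin> C a"
      using a'(2) i neq by (simp_all add: C_def)
    ultimately have "C a \<subset> C a'"
      by blast
    with max[OF a'(1)] show False ..
  qed
  have one: "1 \<in> {1..n}"
    using n_gt_2 by (simp add: atLeastAtMost_iff)
  then obtain l \<epsilon> where l: "l \<in> {1..n}" "fst a l = [(GenX 1, \<epsilon>)]"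
    using aA(3) by (auto simp: signed_permutation_def)
  have "l = 1"
  proof (rule ccontr)
    assume "l \<noteq> 1"
    then have "l \<in> {2..n}"
      using l(1) by (auto simp: atLeastAtMost_iff)
    with fixed[of l] l(2) \<open>l \<noteq> 1\<close> show False
      by (simp add: gen_def)
  qed
  have others: "fst a i = xgen i" if "i \<in> {1..n}" "i \<noteq> 1" for i
    using fixed[of i] that by (auto simp: atLeastAtMost_iff)
  have trivial: "snd a j = \<one>\<^bsub>F\<^esub>" if "j \<in> {1..k}" for j
    using aA(3) that by (simp add: signed_permutation_def F_one)
  have GenX1: "GenX 1 \<in> S"
    using one by simp
  show ?thesis
  proof (cases \<epsilon>)
    case True
    have "a = \<one>\<^bsub>A_bd n k\<^esub>"
    proof (rule E_eqI[OF aA(4) E_one_closed])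
      show "fst a i = fst \<one>\<^bsub>A_bd n k\<^esub> i" if "i \<in> {1..n}" for i
        using that others l True \<open>l = 1\<close> by (cases "i = 1") (auto simp: gen_def)
    qed (simp add: trivial)
    then show ?thesis
      using aA(2) f.hom_one by simp
  next
    case False
    have x1: "xgen 1 \<in> carrier F"
      using one by simp
    have "a = reflection"
    proof (rule E_eqI[OF aA(4)])
      show "reflection \<in> carrier E"
        using x1 by (auto simp: reflection_def E_carrier)
      show "fst a i = fst reflection i" if "i \<in> {1..n}" for i
        using that others l False \<open>l = 1\<close> letter_eq[OF GenX1, of False]
        by (cases "i = 1") (auto simp: reflection_def)
      show "snd a j = snd reflection j" if "j \<in> {1..k}" for j
        using that trivial by (simp add: reflection_def)
    qed
    then show ?thesis
      using aA by simp
  qed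
qed

end

lemma comm_group_DirProd:
  assumes "comm_group G" "comm_group H"
  shows "comm_group (G \<times>\<times> H)"
proof -
  interpret G: comm_group G by fact
  interpret H: comm_group H by fact
  show ?thesis
    by (rule group.group_comm_groupI[OF DirProd_group[OF G.is_group H.is_group]])
      (auto simp: G.m_comm H.m_comm)
qed

context fnk_hom
begin

text \<open>Reducing for \<open>f\<close> alone does not show which endpoint has the same value
  under \<open>s\<close>. The dichotomy is therefore applied to the pair (f, s) with values in a
  direct product, and \<open>s a = 0\<close> excludes the reflection.\<close>

lemma hom_trivial_on_kernel:
  assumes s: "s \<in> hom (A_bd n k) (integer_mod_group 2)" "s reflection = 1"
    and a: "a \<in> carrier (A_bd n k)" "s a = 0"
  shows "f a = \<one>"
proof -
  interpret fs: fnk_hom n k "H \<times>\<times> integer_mod_group 2" "\<lambda>a. (f a, s a)"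
  proof (intro fnk_hom.intro fnk_hom_axioms.intro comm_group_DirProd comm_group_integer_mod_group)
    show "(\<lambda>a. (f a, s a)) \<in> hom (A_bd n k) (H \<times>\<times> integer_mod_group 2)"
      using s(1) f_hom by (simp add: hom_def Pi_iff)
  qed (fact H.comm_group_axioms n_gt_2)+
  show ?thesis
    using fs.reduce_to_reflection[OF a(1)] a(2) s(2) by auto
qed

end

section \<open>The determinant on the quotient by the circles\<close>

text \<open>The exponent sum of x_l, which is a coordinate on the abelianisation modulo the
  y_j.\<close>

definition expo :: "nat \<Rightarrow> basis word \<Rightarrow> int" where
  "expo l w = sum_list (map (\<lambda>(b, \<epsilon>). if b = GenX l then if \<epsilon> then 1 else -1 else 0) w)"

lemma expo_simps [simp]:
  "expo l [] = 0"
  "expo l ((b, \<epsilon>) # w) = (if b = GenX l then if \<epsilon> then 1 else -1 else 0) + expo l w"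
  by (simp_all add: expo_def)

lemma expo_gen [simp]:
  "expo l (xgen i) = (if i = l then 1 else 0)" "expo l (ygen j) = 0"
  by (simp_all add: gen_def)

lemma expo_push: "expo l (push m w) = expo l [m] + expo l w"
  by (cases m; cases w) (auto simp: push_Cons)

lemma expo_wmult: "expo l (u \<star> v) = expo l u + expo l v"
proof (induction u)
  case (Cons m u)
  then show ?case
    by (cases m) (simp add: expo_push)
qed simp

context fnk
begin

lemma expo_hom: "expo l \<in> hom F integer_group"
  by (rule homI) (simp_all add: F_mult expo_wmult)

lemma A_symD:
  assumes "\<phi> \<in> carrier (A_sym n k)"
  shows "\<phi> \<in> auto F" "\<phi> \<in> hom F F" "v \<in> carrier F \<Longrightarrow> \<phi> v \<in> carrier F"
    "j \<in> {1..k} \<Longrightarrow> \<exists>g\<in>carrier F. \<phi> (ygen j) = inv\<^bsub>F\<^esub> g \<otimes>\<^bsub>F\<^esub> ygen j \<otimes>\<^bsub>F\<^esub> g"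
  using assms by (auto simp: A_sym_carrier auto_def hom_in_carrier)

text \<open>Both sides are homomorphisms to the integers. They agree on \<open>ygen j\<close>
  because a conjugate of y_j has exponent sum zero in every x_l.\<close>

lemma expo_image:
  assumes \<phi>: "\<phi> \<in> carrier (A_sym n k)" and v: "v \<in> carrier F"
  shows "expo l (\<phi> v) = (\<Sum>m\<in>{1..n}. expo m v * expo l (\<phi> (xgen m)))"
proof -
  have "(expo l \<circ> \<phi>) v = (\<lambda>v. \<Sum>m\<in>{1..n}. expo m v * expo l (\<phi> (xgen m))) v"
  proof (rule free_group_hom_unique)
    show "group integer_group"
      by simp
    show "expo l \<circ> \<phi> \<in> hom (free_group S) integer_group"
      using Group.hom_compose[OF A_symD(2)[OF \<phi>] expo_hom] by (simp add: Fnk_def)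
    have "(\<lambda>v. \<Sum>m\<in>{1..n}. expo m v * expo l (\<phi> (xgen m))) \<in> hom F integer_group"
      by (rule homI) (simp_all add: F_mult expo_wmult distrib_right sum.distrib)
    then show "(\<lambda>v. \<Sum>m\<in>{1..n}. expo m v * expo l (\<phi> (xgen m))) \<in> hom (free_group S) integer_group"
      by (simp add: Fnk_def)
    show "v \<in> carrier (free_group S)"
      using v by (simp add: Fnk_def)
    fix b assume "b \<in> S"
    then show "(expo l \<circ> \<phi>) (gen b) = (\<Sum>m\<in>{1..n}. expo m (gen b) * expo l (\<phi> (xgen m)))"
    proof
      assume "b \<in> GenX ` {1..n}"
      then obtain i where i: "i \<in> {1..n}" "b = GenX i"
        by blast
      have "(\<Sum>m\<in>{1..n}. expo m (gen b) * expo l (\<phi> (xgen m))) =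
          (\<Sum>m\<in>{1..n}. if i = m then expo l (\<phi> (xgen m)) else 0)"
        by (rule sum.cong) (auto simp: i)
      then show ?thesis
        using i by simp
    next
      assume "b \<in> GenY ` {1..k}"
      then obtain j where j: "j \<in> {1..k}" "b = GenY j"
        by blast
      then obtain g where g: "g \<in> carrier F" "\<phi> (ygen j) = inv\<^bsub>F\<^esub> g \<otimes>\<^bsub>F\<^esub> ygen j \<otimes>\<^bsub>F\<^esub> g"
        using A_symD(4)[OF \<phi>] by blast
      have "expo l (inv\<^bsub>F\<^esub> g \<otimes>\<^bsub>F\<^esub> g) = 0"
        using g(1) by (simp add: F_one)
      then have "expo l (inv\<^bsub>F\<^esub> g) + expo l g = 0"
        by (simp add: F_mult expo_wmult)
      then show ?thesis
        using j g by (simp add: F_mult expo_wmult)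
    qed
  qed
  then show ?thesis
    by simp
qed

text \<open>Images are written as rows, hence the reversed product in \<open>expo_mat_mult\<close>.
  Matrix indices start at 0, generators at 1.\<close>

definition expo_mat :: "(basis word \<Rightarrow> basis word) \<Rightarrow> int mat" where
  "expo_mat \<phi> = Matrix.mat n n (\<lambda>(i, l). expo (Suc l) (\<phi> (xgen (Suc i))))"

lemma expo_mat_carrier [simp]: "expo_mat \<phi> \<in> carrier_mat n n"
  by (simp add: expo_mat_def)

lemma expo_mat_mult:
  assumes "\<phi> \<in> carrier (A_sym n k)" "\<psi> \<in> carrier (A_sym n k)"
  shows "expo_mat (\<phi> \<otimes>\<^bsub>A_sym n k\<^esub> \<psi>) = expo_mat \<psi> * expo_mat \<phi>"
proof (rule eq_matI)
  fix i l assume "i < dim_row (expo_mat \<psi> * expo_mat \<phi>)" "l < dim_col (expo_mat \<psi> * expo_mat \<phi>)"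
  then have il: "i < n" "l < n"
    by (simp_all add: expo_mat_def)
  then have x: "xgen (Suc i) \<in> carrier F"
    by (simp add: atLeastAtMost_iff)
  have "(expo_mat \<psi> * expo_mat \<phi>) $$ (i, l) =
      (\<Sum>m = 0..<n. expo (Suc m) (\<psi> (xgen (Suc i))) * expo (Suc l) (\<phi> (xgen (Suc m))))"
    using il by (simp add: expo_mat_def scalar_prod_def)
  also have "\<dots> = (\<Sum>m\<in>{1..n}. expo m (\<psi> (xgen (Suc i))) * expo (Suc l) (\<phi> (xgen m)))"
    by (rule sum.reindex_bij_witness[of _ "\<lambda>m. m - 1" Suc]) (auto simp: atLeastAtMost_iff One_nat_def)
  also have "\<dots> = expo (Suc l) (\<phi> (\<psi> (xgen (Suc i))))"
    using expo_image[OF assms(1) A_symD(3)[OF assms(2) x]] by simp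
  also have "\<dots> = expo_mat (\<phi> \<otimes>\<^bsub>A_sym n k\<^esub> \<psi>) $$ (i, l)"
    using il x assms by (simp add: expo_mat_def A_sym_mult A_symD(1) compose_eq)
  finally show "expo_mat (\<phi> \<otimes>\<^bsub>A_sym n k\<^esub> \<psi>) $$ (i, l) = (expo_mat \<psi> * expo_mat \<phi>) $$ (i, l)" ..
qed (simp_all add: expo_mat_def)

lemma expo_mat_one: "expo_mat \<one>\<^bsub>A_sym n k\<^esub> = 1\<^sub>m n"
proof (rule eq_matI)
  fix i l assume il: "i < dim_row (1\<^sub>m n :: int mat)" "l < dim_col (1\<^sub>m n :: int mat)"
  then have "xgen (Suc i) \<in> carrier F"
    by (simp add: atLeastAtMost_iff)
  with il show "expo_mat \<one>\<^bsub>A_sym n k\<^esub> $$ (i, l) = 1\<^sub>m n $$ (i, l)"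
    by (simp add: expo_mat_def alpha_A_one flip: alpha_A_bd_one)
qed (simp_all add: expo_mat_def)

text \<open>The matrices of \<open>\<phi>\<close> and of its inverse multiply to the identity, so
  the determinant is a unit of the integers.\<close>

lemma det_expo_mat: "\<phi> \<in> carrier (A_sym n k) \<Longrightarrow> det (expo_mat \<phi>) = 1 \<or> det (expo_mat \<phi>) = -1"
proof -
  assume \<phi>: "\<phi> \<in> carrier (A_sym n k)"
  interpret group "A_sym n k"
    by (rule group_A_sym)
  have "det (expo_mat \<phi>) * det (expo_mat (inv\<^bsub>A_sym n k\<^esub> \<phi>)) =
      det (expo_mat \<phi> * expo_mat (inv\<^bsub>A_sym n k\<^esub> \<phi>))"
    by (rule det_mult[OF expo_mat_carrier expo_mat_carrier, symmetric])
  also have "\<dots> = det (expo_mat (inv\<^bsub>A_sym n k\<^esub> \<phi> \<otimes>\<^bsub>A_sym n k\<^esub> \<phi>))"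
    using \<phi> by (simp only: expo_mat_mult inv_closed)
  also have "\<dots> = 1"
    using \<phi> by (simp add: expo_mat_one)
  finally have "det (expo_mat \<phi>) * det (expo_mat (inv\<^bsub>A_sym n k\<^esub> \<phi>)) = 1" .
  then show ?thesis
    by (simp add: zmult_eq_1_iff) blast
qed

text \<open>The determinant written additively: on \<open>A_sym n k\<close> the second case is
  determinant -1.\<close>

definition sign_class :: "(basis word \<Rightarrow> basis word) \<Rightarrow> int" where
  "sign_class \<phi> = (if det (expo_mat \<phi>) = 1 then 0 else 1)"

lemma sign_class_hom: "sign_class \<in> hom (A_sym n k) (integer_mod_group 2)"
proof (rule homI)
  show "sign_class \<phi> \<in> carrier (integer_mod_group 2)" for \<phi>
    by (simp add: sign_class_def carrier_integer_mod_group)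
next
  fix \<phi> \<psi> assume A: "\<phi> \<in> carrier (A_sym n k)" "\<psi> \<in> carrier (A_sym n k)"
  have "det (expo_mat (\<phi> \<otimes>\<^bsub>A_sym n k\<^esub> \<psi>)) = det (expo_mat \<psi>) * det (expo_mat \<phi>)"
    using A by (simp add: expo_mat_mult det_mult[of _ n])
  then show "sign_class (\<phi> \<otimes>\<^bsub>A_sym n k\<^esub> \<psi>) = sign_class \<phi> \<otimes>\<^bsub>integer_mod_group 2\<^esub> sign_class \<psi>"
    using det_expo_mat[OF A(1)] det_expo_mat[OF A(2)] by (auto simp: sign_class_def)
qed

lemma sign_class_reflection:
  assumes "n > 0"
  shows "sign_class (alpha n k reflection) = 1"
proof -
  \<comment> \<open>The identity matrix with row 0, which belongs to x_1, negated.\<close>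
  have "expo_mat (alpha n k reflection) = multrow_mat n 0 (-1)"
  proof (rule eq_matI)
    fix i l assume "i < dim_row (multrow_mat n 0 (-1 :: int))" "l < dim_col (multrow_mat n 0 (-1 :: int))"
    then have il: "i < n" "l < n"
      by simp_all
    then have i: "Suc i \<in> {1..n}" "xgen (Suc i) \<in> carrier F"
      by (simp_all add: atLeastAtMost_iff)
    have "alpha n k reflection (xgen (Suc i)) = (if i = 0 then inv\<^bsub>F\<^esub> xgen (Suc i) else xgen (Suc i))"
      using i reflection_A_bd by (simp add: reflection_def One_nat_def)
    also have "\<dots> = [(GenX (Suc i), i \<noteq> 0)]"
      using letter_eq[of "GenX (Suc i)" False] i(1) by (auto simp: gen_def)
    finally show "expo_mat (alpha n k reflection) $$ (i, l) = multrow_mat n 0 (-1) $$ (i, l)"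
      using il by (auto simp: expo_mat_def)
  qed (simp_all add: expo_mat_def)
  then have "det (expo_mat (alpha n k reflection)) = -1"
    using det_multrow_mat[OF assms, of "-1 :: int"] by simp
  then show ?thesis
    by (simp add: sign_class_def)
qed

end

section \<open>The two homology groups\<close>

context fnk
begin

text \<open>The reversal of products by \<open>alpha\<close> is harmless, since the target is
  commutative.\<close>

lemma sign_class_alpha_hom: "sign_class \<circ> alpha n k \<in> hom (A_bd n k) (integer_mod_group 2)"
proof (rule homI)
  fix a b assume ab: "a \<in> carrier (A_bd n k)" "b \<in> carrier (A_bd n k)"
  then have "alpha n k a \<in> carrier (A_sym n k)" "alpha n k b \<in> carrier (A_sym n k)"
    using alpha_image by blast+
  then show "(sign_class \<circ> alpha n k) (a \<otimes>\<^bsub>A_bd n k\<^esub> b) =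
      (sign_class \<circ> alpha n k) a \<otimes>\<^bsub>integer_mod_group 2\<^esub> (sign_class \<circ> alpha n k) b"
    using ab hom_mult[OF sign_class_hom] by (simp add: alpha_anti_hom add.commute)
qed (simp add: sign_class_def carrier_integer_mod_group)

lemma homology_A_bd:
  assumes n: "n > 2"
  shows "group_homology 1 (A_bd n k) \<cong> integer_mod_group 2"
proof -
  interpret bar_one "A_bd n k"
    by unfold_locales
  show ?thesis
  proof (rule homology_iso_Z2[OF sign_class_alpha_hom reflection_A_bd])
    show "(sign_class \<circ> alpha n k) reflection = 1"
      using n by (simp add: sign_class_reflection)
    fix f g assume f: "f \<in> hom (A_bd n k) (group_homology 1 (A_bd n k))"
      and g: "g \<in> carrier (A_bd n k)" "(sign_class \<circ> alpha n k) g = 0"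
    interpret fnk_hom n k "group_homology 1 (A_bd n k)" f
      by (intro fnk_hom.intro fnk_hom_axioms.intro comm_group_homology f n)
    show "f g = \<one>\<^bsub>group_homology 1 (A_bd n k)\<^esub>"
      using n by (intro hom_trivial_on_kernel[OF sign_class_alpha_hom _ g]) (simp add: sign_class_reflection)
  qed
qed

lemma homology_A_sym:
  assumes n: "n > 2"
  shows "group_homology 1 (A_sym n k) \<cong> integer_mod_group 2"
proof -
  interpret sym: group "A_sym n k"
    by (rule group_A_sym)
  interpret bar_one "A_sym n k"
    by unfold_locales
  show ?thesis
  proof (rule homology_iso_Z2[OF sign_class_hom])
    show "alpha n k reflection \<in> carrier (A_sym n k)"
      using reflection_A_bd alpha_image by blast
    show "sign_class (alpha n k reflection) = 1"
      using n by (simp add: sign_class_reflection)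
    fix f \<phi> assume f: "f \<in> hom (A_sym n k) (group_homology 1 (A_sym n k))"
      and \<phi>: "\<phi> \<in> carrier (A_sym n k)" "sign_class \<phi> = 0"
    interpret H: comm_group "group_homology 1 (A_sym n k)"
      by (rule comm_group_homology)
    \<comment> \<open>An anti-homomorphism followed by a homomorphism to an abelian group is a
      homomorphism, so the result for \<open>A_bd n k\<close> applies to the composite.\<close>
    have f_alpha: "f \<circ> alpha n k \<in> hom (A_bd n k) (group_homology 1 (A_sym n k))"
    proof (rule homI)
      fix a b assume ab: "a \<in> carrier (A_bd n k)" "b \<in> carrier (A_bd n k)"
      then have "alpha n k a \<in> carrier (A_sym n k)" "alpha n k b \<in> carrier (A_sym n k)"
        using alpha_image by blast+
      then show "(f \<circ> alpha n k) (a \<otimes>\<^bsub>A_bd n k\<^esub> b) =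
          (f \<circ> alpha n k) a \<otimes>\<^bsub>group_homology 1 (A_sym n k)\<^esub> (f \<circ> alpha n k) b"
        using ab hom_mult[OF f] hom_in_carrier[OF f] by (simp add: alpha_anti_hom H.m_comm)
    next
      fix a assume "a \<in> carrier (A_bd n k)"
      then have "alpha n k a \<in> carrier (A_sym n k)"
        using alpha_image by blast
      then show "(f \<circ> alpha n k) a \<in> carrier (group_homology 1 (A_sym n k))"
        using hom_in_carrier[OF f] by simp
    qed
    interpret fnk_hom n k "group_homology 1 (A_sym n k)" "f \<circ> alpha n k"
      by (intro fnk_hom.intro fnk_hom_axioms.intro comm_group_homology f_alpha n)
    obtain a where a: "a \<in> carrier (A_bd n k)" "\<phi> = alpha n k a"
      using \<phi>(1) alpha_image by blast
    have "(f \<circ> alpha n k) a = \<one>\<^bsub>group_homology 1 (A_sym n k)\<^esub>"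
      using n a \<phi>(2) by (intro hom_trivial_on_kernel[OF sign_class_alpha_hom]) (simp_all add: sign_class_reflection)
    then show "f \<phi> = \<one>\<^bsub>group_homology 1 (A_sym n k)\<^esub>"
      using a by simp
  qed
qed

end

theorem theorem7p4:
  fixes n k :: nat
  assumes "n > 2" and "k \<ge> 0"
  shows "group_homology 1 (A_bd n k) \<cong> integer_mod_group 2 \<and>
         integer_mod_group 2 \<cong> group_homology 1 (A_sym n k)"
proof
  interpret bar_one "A_sym n k"
    by (intro bar_one.intro fnk.group_A_sym)
  show "group_homology 1 (A_bd n k) \<cong> integer_mod_group 2"
    by (rule fnk.homology_A_bd[OF assms(1)])
  show "integer_mod_group 2 \<cong> group_homology 1 (A_sym n k)"
    using comm_group.axioms(2)[OF comm_group_homology] fnk.homology_A_sym[OF assms(1)]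
    by (rule group.iso_sym)
qed

end
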